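(* Suppose that $\Theta$ is an inner function, that $\phi\in L^2$, and that $B$ is an inner function of order $k$ for some $k\in\{1,2,\dots\}\cup\{\infty\}$. Assume also that $A^\Theta_\phi$ is bounded. Then $A^{\Theta\circ B}_{\phi\circ B}$ is bounded and unitarily equivalent to $I_k\otimes A^\Theta_\phi$.
   Context: $L^2=L^2(\mathbb{T},dm)$ with $m$ normalized Lebesgue measure on the unit circle $\mathbb{T}$; $H^2\subset L^2$ is the Hardy space (negative Fourier coefficients equal to $0$), $H^\infty=H^2\cap L^\infty$. An inner function is $\Theta\in H^2$ with $|\Theta|=1$ a.e. on $\mathbb{T}$; it is of order $n$ if it is a finite Blaschke product of degree $n$, and of order $\infty$ otherwise. The model space is $K_\Theta=H^2\ominus\Theta H^2$, and $P_\Theta$ is the orthogonal projection of $L^2$ onto $K_\Theta$. For $\phi\in L^2$ the (possibly unbounded) truncated Toeplitz operator $A^\Theta_\phi$ is $A^\Theta_\phi f=P_\Theta(\phi f)$, defined on the dense subspace $K_\Theta\cap H^\infty$ of $K_\Theta$; it is called bounded if it extends to a bounded operator on $K_\Theta$, and the extension is denoted by the same symbol. $\phi\circ B$ means composition with the boundary values of $B$. $I_k$ is the identity operator on a Hilbert space of dimension $k$ (separable and infinite dimensional if $k=\infty$), and $\otimes$ is the Hilbert space tensor product. *)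

theory Defs
  imports "HOL-Analysis.Analysis" "HOL-Library.Extended_Nat"
begin

section \<open>Complex inner product spaces and operators on their subspaces\<close>

text \<open>The inner product \<^term>\<open>cinner\<close> is linear in its first argument. Completeness is not part of the
  class; Hilbert spaces are the complete complex subspaces (\<open>hilbert_subspace\<close>) of such a type.\<close>

class complex_inner = real_inner +
  fixes scaleC :: "complex \<Rightarrow> 'a \<Rightarrow> 'a"  (infixr "*\<^sub>C" 75)
    and cinner :: "'a \<Rightarrow> 'a \<Rightarrow> complex"
  assumes scaleC_add_right: "a *\<^sub>C (x + y) = a *\<^sub>C x + a *\<^sub>C y"
    and scaleC_add_left: "(a + b) *\<^sub>C x = a *\<^sub>C x + b *\<^sub>C x"
    and scaleC_scaleC: "a *\<^sub>C b *\<^sub>C x = (a * b) *\<^sub>C x"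
    and scaleC_of_real: "of_real r *\<^sub>C x = r *\<^sub>R x"
    and cinner_commute: "cinner x y = cnj (cinner y x)"
    and cinner_add_left: "cinner (x + y) z = cinner x z + cinner y z"
    and cinner_scaleC_left: "cinner (a *\<^sub>C x) y = a * cinner x y"
    and Re_cinner: "Re (cinner x y) = inner x y"

definition csubspace :: "'a::complex_inner set \<Rightarrow> bool" where
  "csubspace S \<longleftrightarrow> 0 \<in> S \<and> (\<forall>x\<in>S. \<forall>y\<in>S. x + y \<in> S) \<and> (\<forall>c. \<forall>x\<in>S. c *\<^sub>C x \<in> S)"

definition cspan :: "'a::complex_inner set \<Rightarrow> 'a set" where
  "cspan X = csubspace hull X"

definition hilbert_subspace :: "'a::complex_inner set \<Rightarrow> bool" where
  "hilbert_subspace S \<longleftrightarrow> csubspace S \<and> complete S"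

definition corthonormal :: "'a::complex_inner set \<Rightarrow> bool" where
  "corthonormal X \<longleftrightarrow> (\<forall>x\<in>X. \<forall>y\<in>X. cinner x y = (if x = y then 1 else 0))"

text \<open>The dimension \<open>\<infinity>\<close> stands for separable and infinite dimensional.\<close>

definition has_hilbert_dim :: "'a::complex_inner set \<Rightarrow> enat \<Rightarrow> bool" where
  "has_hilbert_dim E k \<longleftrightarrow>
     (\<exists>X. corthonormal X \<and> countable X \<and> closure (cspan X) = E \<and>
          k = (if finite X then enat (card X) else \<infinity>))"

definition clinear_on :: "'a::complex_inner set \<Rightarrow> ('a \<Rightarrow> 'b::complex_inner) \<Rightarrow> bool" where
  "clinear_on S A \<longleftrightarrow> (\<forall>x\<in>S. \<forall>y\<in>S. A (x + y) = A x + A y) \<and> (\<forall>c. \<forall>x\<in>S. A (c *\<^sub>C x) = c *\<^sub>C A x)"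

definition bounded_operator_on :: "'a::complex_inner set \<Rightarrow> ('a \<Rightarrow> 'a) \<Rightarrow> bool" where
  "bounded_operator_on S A \<longleftrightarrow>
     A ` S \<subseteq> S \<and> clinear_on S A \<and> (\<exists>C. \<forall>x\<in>S. norm (A x) \<le> C * norm x)"

definition orth_proj :: "'a::complex_inner set \<Rightarrow> 'a \<Rightarrow> 'a" where
  "orth_proj S x = (THE y. y \<in> S \<and> (\<forall>z\<in>S. cinner (x - y) z = 0))"

definition unitary_between ::
  "'a::complex_inner set \<Rightarrow> 'b::complex_inner set \<Rightarrow> ('a \<Rightarrow> 'b) \<Rightarrow> bool" where
  "unitary_between S S' U \<longleftrightarrow>
     U ` S = S' \<and> clinear_on S U \<and> (\<forall>x\<in>S. \<forall>y\<in>S. cinner (U x) (U y) = cinner x y)"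

definition unitarily_equivalent ::
  "'a::complex_inner set \<Rightarrow> ('a \<Rightarrow> 'a) \<Rightarrow> 'b::complex_inner set \<Rightarrow> ('b \<Rightarrow> 'b) \<Rightarrow> bool" where
  "unitarily_equivalent S A S' A' \<longleftrightarrow>
     (\<exists>U. unitary_between S S' U \<and> (\<forall>x\<in>S. U (A x) = A' (U x)))"

text \<open>\<open>T\<close>, with elementary tensors \<open>\<tau> e f\<close>, is a Hilbert space tensor product of \<open>E\<close> and \<open>F\<close>:
  the inner product formula identifies the span of the elementary tensors with the algebraic tensor
  product carrying its usual inner product, and \<open>T\<close> is the completion of that span.\<close>

definition hilbert_tensor_product ::
  "'e::complex_inner set \<Rightarrow> 'f::complex_inner set \<Rightarrow> 't::complex_inner set \<Rightarrow> ('e \<Rightarrow> 'f \<Rightarrow> 't) \<Rightarrow> bool"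
  where
  "hilbert_tensor_product E F T \<tau> \<longleftrightarrow>
     hilbert_subspace T \<and>
     (\<forall>f\<in>F. clinear_on E (\<lambda>e. \<tau> e f)) \<and> (\<forall>e\<in>E. clinear_on F (\<tau> e)) \<and>
     (\<forall>e\<in>E. \<forall>e'\<in>E. \<forall>f\<in>F. \<forall>f'\<in>F. cinner (\<tau> e f) (\<tau> e' f') = cinner e e' * cinner f f') \<and>
     closure (cspan {\<tau> e f | e f. e \<in> E \<and> f \<in> F}) = T"

text \<open>\<open>A\<^sub>1 \<otimes> A\<^sub>2\<close>; its values are determined on \<open>T\<close> only.\<close>

definition tensor_operator ::
  "'e::complex_inner set \<Rightarrow> 'f::complex_inner set \<Rightarrow> 't::complex_inner set \<Rightarrow> ('e \<Rightarrow> 'f \<Rightarrow> 't) \<Rightarrow>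
    ('e \<Rightarrow> 'e) \<Rightarrow> ('f \<Rightarrow> 'f) \<Rightarrow> 't \<Rightarrow> 't" where
  "tensor_operator E F T \<tau> A\<^sub>1 A\<^sub>2 =
     (SOME S. bounded_operator_on T S \<and> (\<forall>e\<in>E. \<forall>f\<in>F. S (\<tau> e f) = \<tau> (A\<^sub>1 e) (A\<^sub>2 f)))"


section \<open>The space $L^2$ of the unit circle\<close>

text \<open>Normalized Lebesgue measure of the circle, as a Borel measure on the plane that is concentrated
  on the circle.\<close>

definition circle_measure :: "complex measure" where
  "circle_measure = distr (uniform_measure lborel {0..2 * pi}) borel cis"

definition square_integrable :: "(complex \<Rightarrow> complex) \<Rightarrow> bool" where
  "square_integrable f \<longleftrightarrow>
     f \<in> borel_measurable borel \<and> integrable circle_measure (\<lambda>z. (cmod (f z))\<^sup>2)"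

lemma sets_circle_measure [simp, measurable_cong]: "sets circle_measure = sets borel"
  by (simp add: circle_measure_def)

lemma space_circle_measure [simp]: "space circle_measure = UNIV"
  by (simp add: circle_measure_def)

lemma borel_measurable_circle_measure [simp]:
  "borel_measurable circle_measure = borel_measurable borel"
  by (rule measurable_cong_sets) simp_all

lemma square_integrable_zero [simp]: "square_integrable (\<lambda>z. 0)"
  by (simp add: square_integrable_def)

lemma square_integrable_scale:
  assumes "square_integrable f"
  shows "square_integrable (\<lambda>z. c * f z)"
proof -
  have [measurable]: "f \<in> borel_measurable borel"
    using assms by (simp add: square_integrable_def)
  show ?thesis
    using assms by (simp add: square_integrable_def norm_mult power_mult_distrib)
qed

lemma square_integrable_add:
  assumes "square_integrable f" "square_integrable g"
  shows "square_integrable (\<lambda>z. f z + g z)"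
proof -
  have [measurable]: "f \<in> borel_measurable borel" "g \<in> borel_measurable borel"
    using assms by (auto simp: square_integrable_def)
  have bound: "(cmod (f z + g z))\<^sup>2 \<le> 2 * (cmod (f z))\<^sup>2 + 2 * (cmod (g z))\<^sup>2" for z
  proof -
    have "(cmod (f z + g z))\<^sup>2 \<le> (cmod (f z) + cmod (g z))\<^sup>2"
      by (intro power_mono norm_triangle_ineq norm_ge_zero)
    also have "\<dots> \<le> 2 * (cmod (f z))\<^sup>2 + 2 * (cmod (g z))\<^sup>2"
      using sum_squares_bound[of "cmod (f z)" "cmod (g z)"] by (simp add: power2_sum)
    finally show ?thesis .
  qed
  have "integrable circle_measure (\<lambda>z. (cmod (f z + g z))\<^sup>2)"
  proof (rule Bochner_Integration.integrable_bound)
    show "integrable circle_measure (\<lambda>z. 2 * (cmod (f z))\<^sup>2 + 2 * (cmod (g z))\<^sup>2)"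
      using assms by (simp add: square_integrable_def)
  qed (use bound in \<open>auto intro!: AE_I2 order_trans[OF bound]\<close>)
  then show ?thesis
    by (simp add: square_integrable_def)
qed

lemma integrable_mult_cnj:
  assumes "square_integrable f" "square_integrable g"
  shows "integrable circle_measure (\<lambda>z. f z * cnj (g z))"
proof -
  have [measurable]: "f \<in> borel_measurable borel" "g \<in> borel_measurable borel"
    using assms by (auto simp: square_integrable_def)
  have [measurable]: "cnj \<in> borel_measurable borel"
    by (intro borel_measurable_continuous_onI continuous_intros)
  have bound: "cmod (f z * cnj (g z)) \<le> (cmod (f z))\<^sup>2 + (cmod (g z))\<^sup>2" for z
  proof -
    have "0 \<le> cmod (f z) * cmod (g z)" by simp
    moreover have "2 * cmod (f z) * cmod (g z) \<le> (cmod (f z))\<^sup>2 + (cmod (g z))\<^sup>2"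
      by (rule sum_squares_bound)
    ultimately show ?thesis unfolding norm_mult complex_mod_cnj by linarith
  qed
  show ?thesis
  proof (rule Bochner_Integration.integrable_bound)
    show "integrable circle_measure (\<lambda>z. (cmod (f z))\<^sup>2 + (cmod (g z))\<^sup>2)"
      using assms by (simp add: square_integrable_def)
  qed (use bound in \<open>auto intro!: AE_I2 order_trans[OF bound]\<close>)
qed

lemma cinner_integral_cong:
  assumes "square_integrable f" "square_integrable g" "square_integrable f'" "square_integrable g'"
    and "AE z in circle_measure. f z = f' z" "AE z in circle_measure. g z = g' z"
  shows "(\<integral>z. f z * cnj (g z) \<partial>circle_measure) = (\<integral>z. f' z * cnj (g' z) \<partial>circle_measure)"
proof (rule integral_cong_AE)
  show "AE z in circle_measure. f z * cnj (g z) = f' z * cnj (g' z)"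
    using assms(5,6) by eventually_elim simp
qed (use assms integrable_mult_cnj borel_measurable_integrable in blast)+

lemma cinner_integral_commute:
  "(\<integral>z. f z * cnj (g z) \<partial>circle_measure) = cnj (\<integral>z. g z * cnj (f z) \<partial>circle_measure)"
  using Bochner_Integration.integral_cnj[of circle_measure "\<lambda>z. g z * cnj (f z)"] by (simp add: mult.commute)

quotient_type L2 = "complex \<Rightarrow> complex" / partial:
  "\<lambda>f g. square_integrable f \<and> square_integrable g \<and> (AE z in circle_measure. f z = g z)"
  morphisms rep_L2 class_L2
proof (rule part_equivpI)
  show "\<exists>f. square_integrable f \<and> square_integrable f \<and> (AE z in circle_measure. f z = f z)"
    by (rule exI[of _ "\<lambda>z. 0"]) simp
qed (auto intro!: sympI transpI)

instantiation L2 :: real_inner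
begin

lift_definition zero_L2 :: L2 is "\<lambda>z. 0" by simp

lift_definition plus_L2 :: "L2 \<Rightarrow> L2 \<Rightarrow> L2" is "\<lambda>f g z. f z + g z"
  by (auto intro: square_integrable_add)

lift_definition uminus_L2 :: "L2 \<Rightarrow> L2" is "\<lambda>f z. - f z"
  using square_integrable_scale[of _ "-1"] by auto

definition minus_L2 :: "L2 \<Rightarrow> L2 \<Rightarrow> L2" where "minus_L2 f g = f + - g"

lift_definition scaleR_L2 :: "real \<Rightarrow> L2 \<Rightarrow> L2" is "\<lambda>r f z. of_real r * f z"
  by (auto intro: square_integrable_scale)

lift_definition inner_L2 :: "L2 \<Rightarrow> L2 \<Rightarrow> real" is
  "\<lambda>f g. Re (\<integral>z. f z * cnj (g z) \<partial>circle_measure)"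
  by (rule arg_cong[of _ _ Re], rule cinner_integral_cong) auto

definition norm_L2 :: "L2 \<Rightarrow> real" where "norm_L2 f = sqrt (inner f f)"
definition sgn_L2 :: "L2 \<Rightarrow> L2" where "sgn_L2 f = inverse (norm f) *\<^sub>R f"
definition dist_L2 :: "L2 \<Rightarrow> L2 \<Rightarrow> real" where "dist_L2 f g = norm (f - g)"
definition uniformity_L2 :: "(L2 \<times> L2) filter" where
  "uniformity_L2 = (INF e\<in>{0<..}. principal {(f, g). dist f g < e})"
definition open_L2 :: "L2 set \<Rightarrow> bool" where
  "open_L2 U \<longleftrightarrow> (\<forall>x\<in>U. eventually (\<lambda>(x', y). x' = x \<longrightarrow> y \<in> U) uniformity)"

instance
proof
  fix f g h :: L2 and r s :: real
  show "f + g + h = f + (g + h)"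
    by transfer (simp add: square_integrable_add square_integrable_scale add.assoc)
  show "f + g = g + f"
    by transfer (simp add: square_integrable_add square_integrable_scale add.commute)
  show "0 + f = f" by transfer auto
  show "- f + f = 0" by transfer auto
  show "f - g = f + - g" by (fact minus_L2_def)
  show "r *\<^sub>R (f + g) = r *\<^sub>R f + r *\<^sub>R g"
    by transfer (simp add: square_integrable_add square_integrable_scale distrib_left)
  show "(r + s) *\<^sub>R f = r *\<^sub>R f + s *\<^sub>R f"
    by transfer (simp add: square_integrable_add square_integrable_scale distrib_right)
  show "r *\<^sub>R s *\<^sub>R f = (r * s) *\<^sub>R f"
    by transfer (simp add: square_integrable_add square_integrable_scale mult.assoc)
  show "1 *\<^sub>R f = f" by transfer auto
  show "sgn f = inverse (norm f) *\<^sub>R f" by (fact sgn_L2_def)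
  show "dist f g = norm (f - g)" by (fact dist_L2_def)
  show "uniformity = (INF e\<in>{0<..}. principal {(x :: L2, y). dist x y < e})"
    by (fact uniformity_L2_def)
  show "open U \<longleftrightarrow> (\<forall>x\<in>U. \<forall>\<^sub>F (x', y) in uniformity. x' = x \<longrightarrow> y \<in> U)" for U :: "L2 set"
    by (fact open_L2_def)
  show "norm f = sqrt (inner f f)" by (fact norm_L2_def)
  show "inner f g = inner g f"
    by transfer (subst cinner_integral_commute, simp)
  show "inner (f + g) h = inner f h + inner g h"
    by transfer (auto simp: distrib_right integrable_mult_cnj)
  show "inner (r *\<^sub>R f) g = r * inner f g"
    by transfer (auto simp: mult.assoc)
  have norm_sq: "Re (\<integral>z. u z * cnj (u z) \<partial>circle_measure) = (\<integral>z. (cmod (u z))\<^sup>2 \<partial>circle_measure)"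
    for u
    by (simp only: complex_norm_square[symmetric] integral_complex_of_real Re_complex_of_real)
  show "0 \<le> inner f f"
    by transfer (simp only: norm_sq integral_nonneg_AE zero_le_power2 AE_I2)
  show "inner f f = 0 \<longleftrightarrow> f = 0"
  proof (transfer, unfold norm_sq)
    fix f
    assume "square_integrable f \<and> square_integrable f \<and> (AE z in circle_measure. f z = f z)"
    then show "(\<integral>z. (cmod (f z))\<^sup>2 \<partial>circle_measure) = 0 \<longleftrightarrow>
      square_integrable f \<and> square_integrable (\<lambda>z. 0) \<and> (AE z in circle_measure. f z = 0)"
      by (subst integral_nonneg_eq_0_iff_AE) (auto simp: square_integrable_def)
  qed
qed

end

instantiation L2 :: complex_inner
begin

lift_definition scaleC_L2 :: "complex \<Rightarrow> L2 \<Rightarrow> L2" is "\<lambda>c f z. c * f z"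
  by (auto intro: square_integrable_scale)

lift_definition cinner_L2 :: "L2 \<Rightarrow> L2 \<Rightarrow> complex" is
  "\<lambda>f g. \<integral>z. f z * cnj (g z) \<partial>circle_measure"
  by (rule cinner_integral_cong) auto

instance
proof
  fix f g h :: L2 and a b :: complex and r :: real
  show "a *\<^sub>C (f + g) = a *\<^sub>C f + a *\<^sub>C g"
    by transfer (simp add: square_integrable_add square_integrable_scale distrib_left)
  show "(a + b) *\<^sub>C f = a *\<^sub>C f + b *\<^sub>C f"
    by transfer (simp add: square_integrable_add square_integrable_scale distrib_right)
  show "a *\<^sub>C b *\<^sub>C f = (a * b) *\<^sub>C f"
    by transfer (simp add: square_integrable_add square_integrable_scale mult.assoc)
  show "of_real r *\<^sub>C f = r *\<^sub>R f"
    by transfer (auto intro!: square_integrable_scale)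
  show "cinner f g = cnj (cinner g f)"
    by transfer (rule cinner_integral_commute)
  show "cinner (f + g) h = cinner f h + cinner g h"
    by transfer (auto simp: distrib_right integrable_mult_cnj)
  show "cinner (a *\<^sub>C f) g = a * cinner f g"
    by transfer (auto simp: mult.assoc)
  show "Re (cinner f g) = inner f g"
    by transfer simp
qed

end


section \<open>Inner functions, model spaces and truncated Toeplitz operators\<close>

definition fourier_coeff :: "(complex \<Rightarrow> complex) \<Rightarrow> int \<Rightarrow> complex" where
  "fourier_coeff f n = (\<integral>z. f z * cnj (z powi n) \<partial>circle_measure)"

definition H2 :: "L2 set" where
  "H2 = {f. \<forall>n<0. fourier_coeff (rep_L2 f) n = 0}"

definition Hinf :: "L2 set" where
  "Hinf = {f \<in> H2. \<exists>C. AE z in circle_measure. cmod (rep_L2 f z) \<le> C}"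

text \<open>Inner functions and symbols are represented by functions, not by their classes in \<^typ>\<open>L2\<close>, so
  that they can be composed. An inner function is given by its boundary values.\<close>

definition inner_function :: "(complex \<Rightarrow> complex) \<Rightarrow> bool" where
  "inner_function \<Theta> \<longleftrightarrow>
     square_integrable \<Theta> \<and> class_L2 \<Theta> \<in> H2 \<and> (AE z in circle_measure. cmod (\<Theta> z) = 1)"

definition finite_blaschke_product :: "nat \<Rightarrow> (complex \<Rightarrow> complex) \<Rightarrow> bool" where
  "finite_blaschke_product n B \<longleftrightarrow>
     (\<exists>c a. cmod c = 1 \<and> (\<forall>i<n. cmod (a i) < 1) \<and>
        (AE z in circle_measure. B z = c * (\<Prod>i<n. (z - a i) / (1 - cnj (a i) * z))))"

definition has_order :: "(complex \<Rightarrow> complex) \<Rightarrow> enat \<Rightarrow> bool" where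
  "has_order B k \<longleftrightarrow>
     (case k of enat n \<Rightarrow> finite_blaschke_product n B | \<infinity> \<Rightarrow> \<nexists>n. finite_blaschke_product n B)"

text \<open>Multiplication by \<open>\<phi>\<close>; meaningful only where the product is square integrable.\<close>

definition mult_L2 :: "(complex \<Rightarrow> complex) \<Rightarrow> L2 \<Rightarrow> L2" where
  "mult_L2 \<phi> f = class_L2 (\<lambda>z. \<phi> z * rep_L2 f z)"

definition model_space :: "(complex \<Rightarrow> complex) \<Rightarrow> L2 set" where
  "model_space \<Theta> = {f \<in> H2. \<forall>h\<in>H2. cinner f (mult_L2 \<Theta> h) = 0}"

definition tto_extension ::
  "(complex \<Rightarrow> complex) \<Rightarrow> (complex \<Rightarrow> complex) \<Rightarrow> (L2 \<Rightarrow> L2) \<Rightarrow> bool" where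
  "tto_extension \<Theta> \<phi> A \<longleftrightarrow>
     bounded_operator_on (model_space \<Theta>) A \<and>
     (\<forall>f \<in> model_space \<Theta> \<inter> Hinf. A f = orth_proj (model_space \<Theta>) (mult_L2 \<phi> f))"

definition tto_bounded :: "(complex \<Rightarrow> complex) \<Rightarrow> (complex \<Rightarrow> complex) \<Rightarrow> bool" where
  "tto_bounded \<Theta> \<phi> \<longleftrightarrow> (\<exists>A. tto_extension \<Theta> \<phi> A)"

text \<open>The bounded extension, determined on the model space only; arbitrary for unbounded operators.\<close>

definition tto :: "(complex \<Rightarrow> complex) \<Rightarrow> (complex \<Rightarrow> complex) \<Rightarrow> L2 \<Rightarrow> L2" where
  "tto \<Theta> \<phi> = (SOME A. tto_extension \<Theta> \<phi> A)"

end

(*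
A function h in the model space of B satisfies B^n h \<bottom> h for n \<ge> 1. Hence the image of the measure
\<bar>h\<bar>^2 dm under B has the moments of (norm h)^2 dm and therefore equals it, so that f \<mapsto> h (f \<circ> B) is
isometric up to the factor norm h. Polarization gives
\<langle>h (f \<circ> B), h' (g \<circ> B)\<rangle> = \<langle>h, h'\<rangle> \<langle>f, g\<rangle>. By the Wold decomposition of multiplication by B, an
orthonormal basis of the model space of B turns these maps into an orthogonal decomposition of the
model space of \<Theta> \<circ> B into copies of the model space of \<Theta>, on which the truncated Toeplitz operator
acts diagonally; the weak formula \<langle>A f, w\<rangle> = \<langle>f, cnj \<phi> w\<rangle> with w bounded shows this without
boundedness of the components f. The number of copies is the dimension of the model space of B. For a
finite Blaschke product it is the degree. If it is finite, then an eigenvector of the backward shift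
on the model space is a reproducing kernel, which splits a Blaschke factor off B.
*)

theory Submission
  imports Defs "HOL-Computational_Algebra.Fundamental_Theorem_Algebra"
begin

section \<open>Complex inner product spaces\<close>

text \<open>Inner functions are given by boundary values alone, so nothing is evaluated inside the
  disc: the value at 0 is the zeroth Fourier coefficient, analyticity is the vanishing of the
  negative coefficients, and both are tested on powers of z and carried to closed spans by
  continuity.

  Boundedness is missing in two places. A bounded u in the model space of
  \<open>\<Theta> \<circ> B\<close> is not known to have bounded components f, and on an unbounded f
  the operator A is only a limit; hence \<phi> is moved to the test vector. The test vectors h (w
  \<circ> B) need not be bounded either, because h need not be; that cnj (\<phi> \<circ> B) h (w
  \<circ> B) is still square integrable holds because it is the image of cnj \<phi> w under the map
  attached to h.

  The tensor product is an arbitrary one, known only through its inner product formula and the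
  density of the span of elementary tensors. Both sides are therefore treated as orthogonal sums of
  isometric copies of the model space of \<Theta>, indexed by orthonormal bases of equal
  cardinality.\<close>

interpretation cvs: vector_space "scaleC :: complex \<Rightarrow> 'a::complex_inner \<Rightarrow> 'a"
proof
  show "1 *\<^sub>C x = x" for x :: 'a
    using scaleC_of_real[of 1 x] by simp
qed (simp_all add: scaleC_add_right scaleC_add_left scaleC_scaleC)

lemma csubspace_iff: "csubspace = cvs.subspace"
  by (simp add: fun_eq_iff csubspace_def cvs.subspace_def)

lemma cspan_eq: "cspan = cvs.span"
  by (simp add: fun_eq_iff cspan_def cvs.span_def csubspace_iff)

lemma norm_scaleC: "norm (a *\<^sub>C x) = cmod a * norm (x::'a::complex_inner)"
proof -
  have "inner (a *\<^sub>C x) (a *\<^sub>C x) = Re (a * cnj (a * cinner x x))"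
    by (metis Re_cinner cinner_commute cinner_scaleC_left)
  also have "\<dots> = Re ((a * cnj a) * cnj (cinner x x))"
    by (simp add: mult.assoc)
  also have "\<dots> = (cmod a)\<^sup>2 * inner x x"
    by (simp add: complex_norm_square[symmetric] Re_cinner)
  finally show ?thesis
    by (simp add: norm_eq_sqrt_inner real_sqrt_mult)
qed

lemma cinner_scaleC_right: "cinner x (a *\<^sub>C y) = cnj a * cinner x y"
  by (metis cinner_commute cinner_scaleC_left complex_cnj_mult)

lemma Im_cinner_self: "Im (cinner x x) = 0"
  by (metis add_cancel_right_right cinner_commute complex_In_mult_cnj_zero complex_cnj_cancel_iff
      complex_eq_iff complex_is_Real_iff Reals_cnj_iff)

lemma cinner_self: "cinner x x = of_real ((norm x)\<^sup>2)"
  by (simp add: complex_eq_iff Im_cinner_self Re_cinner dot_square_norm)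

lemma cinner_self_eq_0 [simp]: "cinner x x = 0 \<longleftrightarrow> x = 0"
  by (simp add: cinner_self)

text \<open>A unimodular factor \<open>c\<close> turns the inner product into its absolute value,
  which reduces the claim to the Cauchy-Schwarz inequality of the real inner product.\<close>

lemma cmod_cinner_le: "cmod (cinner x y) \<le> norm x * norm y"
proof (cases "cinner x y = 0")
  case False
  define c where "c = cnj (sgn (cinner x y))"
  have "cmod c = 1"
    using False by (simp add: c_def norm_sgn)
  have "c * cinner x y = of_real (cmod (cinner x y))"
    using False
    by (simp add: c_def sgn_eq complex_norm_square[symmetric] mult.commute field_simps power2_eq_square)
  then have "cmod (cinner x y) = Re (cinner (c *\<^sub>C x) y)"
    by (simp add: cinner_scaleC_left)
  also have "\<dots> \<le> norm (c *\<^sub>C x) * norm y"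
    by (simp add: Re_cinner norm_cauchy_schwarz)
  finally show ?thesis
    using \<open>cmod c = 1\<close> by (simp add: norm_scaleC)
qed simp

lemma cinner_add_right: "cinner x (y + z) = cinner x y + cinner x z"
  by (metis cinner_add_left cinner_commute complex_cnj_add)

lemma scaleR_conv_scaleC: "r *\<^sub>R x = of_real r *\<^sub>C (x::'a::complex_inner)"
  by (simp add: scaleC_of_real)

lemma bounded_bilinear_cinner: "bounded_bilinear cinner"
proof
  show "\<exists>K. \<forall>a b. cmod (cinner a b) \<le> norm a * norm b * K"
    by (rule exI[of _ 1]) (simp add: cmod_cinner_le)
qed (simp_all add: cinner_add_left cinner_add_right scaleR_conv_scaleC cinner_scaleC_left
      cinner_scaleC_right scaleR_conv_of_real)

interpretation cinner: bounded_bilinear cinner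
  by (rule bounded_bilinear_cinner)

lemma bounded_bilinear_scaleC: "bounded_bilinear (scaleC :: complex \<Rightarrow> 'a::complex_inner \<Rightarrow> 'a)"
proof
  show "\<exists>K. \<forall>a b. norm (a *\<^sub>C (b :: 'a)) \<le> norm a * norm b * K"
    by (rule exI[of _ 1]) (simp add: norm_scaleC)
qed (simp_all add: scaleC_add_left scaleC_add_right scaleR_conv_scaleC scaleC_scaleC
      scaleR_conv_of_real mult.commute)

interpretation scaleC: bounded_bilinear "scaleC :: complex \<Rightarrow> 'a::complex_inner \<Rightarrow> 'a"
  by (rule bounded_bilinear_scaleC)

section \<open>Closed subspaces and closures of spans\<close>

lemma closed_cinner_left: "closed {x. cinner x y = 0}"
  by (intro closed_Collect_eq continuous_intros cinner.continuous_on)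

lemma closed_cinner_right: "closed {x. cinner y x = 0}"
  by (intro closed_Collect_eq continuous_intros cinner.continuous_on)

lemma csubspace_cinner_right: "csubspace {x. cinner y x = 0}"
  by (simp add: csubspace_def cinner_add_right cinner_scaleC_right cinner.zero_right)

lemma csubspace_closure:
  assumes "csubspace S"
  shows "csubspace (closure S)"
  unfolding csubspace_def
proof (intro conjI ballI allI)
  show "0 \<in> closure S"
    using assms closure_subset by (auto simp: csubspace_def)
next
  fix x y assume "x \<in> closure S" "y \<in> closure S"
  then obtain u v where "\<And>n. u n \<in> S" "u \<longlonglongrightarrow> x" "\<And>n. v n \<in> S" "v \<longlonglongrightarrow> y"
    unfolding closure_sequential by blast
  then have "(\<lambda>n. u n + v n) \<longlonglongrightarrow> x + y" "\<And>n. u n + v n \<in> S"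
    using assms by (auto intro: tendsto_add simp: csubspace_def)
  then show "x + y \<in> closure S"
    unfolding closure_sequential by (intro exI conjI allI)
next
  fix c x assume "x \<in> closure S"
  then obtain u where "\<And>n. u n \<in> S" "u \<longlonglongrightarrow> x"
    unfolding closure_sequential by blast
  then have "(\<lambda>n. c *\<^sub>C u n) \<longlonglongrightarrow> c *\<^sub>C x" "\<And>n. c *\<^sub>C u n \<in> S"
    using assms by (auto intro: scaleC.tendsto simp: csubspace_def)
  then show "c *\<^sub>C x \<in> closure S"
    unfolding closure_sequential by (intro exI conjI allI)
qed

lemma csubspace_cspan: "csubspace (cspan G)"
  by (simp add: csubspace_iff cspan_eq)

lemma cspan_superset: "G \<subseteq> cspan G"
  by (simp add: cspan_eq cvs.span_superset)

lemma cspan_minimal: "G \<subseteq> S \<Longrightarrow> csubspace S \<Longrightarrow> cspan G \<subseteq> S"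
  by (simp add: cspan_eq csubspace_iff cvs.span_minimal)

lemma closure_cspan_minimal:
  "G \<subseteq> S \<Longrightarrow> csubspace S \<Longrightarrow> closed S \<Longrightarrow> closure (cspan G) \<subseteq> S"
  by (simp add: cspan_minimal closure_minimal)

lemma subset_closure_cspan: "G \<subseteq> closure (cspan G)"
  using cspan_superset closure_subset by blast

lemma closure_cspan_mono:
  "G \<subseteq> closure (cspan G') \<Longrightarrow> closure (cspan G) \<subseteq> closure (cspan G')"
  by (rule closure_cspan_minimal) (auto intro: csubspace_closure csubspace_cspan)

lemma csubspace_diff: "csubspace S \<Longrightarrow> x \<in> S \<Longrightarrow> y \<in> S \<Longrightarrow> x - y \<in> S"
  by (simp add: csubspace_iff cvs.subspace_diff)

lemma csubspace_sum: "csubspace S \<Longrightarrow> (\<And>i. i \<in> I \<Longrightarrow> f i \<in> S) \<Longrightarrow> sum f I \<in> S"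
  by (simp add: csubspace_iff cvs.subspace_sum)

lemma csubspace_0: "csubspace S \<Longrightarrow> 0 \<in> S"
  and csubspace_add: "csubspace S \<Longrightarrow> x \<in> S \<Longrightarrow> y \<in> S \<Longrightarrow> x + y \<in> S"
  and csubspace_scale: "csubspace S \<Longrightarrow> x \<in> S \<Longrightarrow> c *\<^sub>C x \<in> S"
  by (simp_all add: csubspace_def)

lemma orthogonal_closure_cspan:
  assumes "\<And>g. g \<in> G \<Longrightarrow> cinner u g = 0" "x \<in> closure (cspan G)"
  shows "cinner u x = 0"
  using closure_cspan_minimal[of G "{x. cinner u x = 0}"] assms
  by (auto intro: csubspace_cinner_right closed_cinner_right)

subsection \<open>Orthogonal projections\<close>

text \<open>Subtracting from \<open>w\<close> its component along \<open>z\<close> lowers the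
  squared norm by that of the component (Pythagoras). Minimality forces the component to be
  0.\<close>

lemma orthogonal_if_minimal:
  fixes w z :: "'a::complex_inner"
  assumes "\<And>c. norm w \<le> norm (w - c *\<^sub>C z)"
  shows "cinner w z = 0"
proof (cases "z = 0")
  case False
  define c where "c = cinner w z / of_real ((norm z)\<^sup>2)"
  have nz: "(norm z)\<^sup>2 > 0"
    using False by simp
  have "cinner (w - c *\<^sub>C z) z = 0"
    using nz by (simp add: cinner.diff_left cinner_scaleC_left cinner_self c_def)
  then have "cinner (w - c *\<^sub>C z) (c *\<^sub>C z) = 0"
    by (simp add: cinner_scaleC_right)
  then have "inner (w - c *\<^sub>C z) (c *\<^sub>C z) = 0"
    by (metis Re_cinner zero_complex.sel(1))
  then have "(norm w)\<^sup>2 = (norm (w - c *\<^sub>C z))\<^sup>2 + (norm (c *\<^sub>C z))\<^sup>2"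
    using norm_add_Pythagorean[of "w - c *\<^sub>C z" "c *\<^sub>C z"] by (simp add: orthogonal_def)
  moreover have "(norm w)\<^sup>2 \<le> (norm (w - c *\<^sub>C z))\<^sup>2"
    using assms by (simp add: power_mono)
  ultimately have "(norm (c *\<^sub>C z))\<^sup>2 \<le> 0"
    by linarith
  then have "norm (c *\<^sub>C z) = 0"
    by simp
  then have "c = 0"
    using False by (simp add: norm_scaleC)
  then show ?thesis
    using nz by (simp add: c_def)
qed (simp add: cinner.zero_right)

lemma parallelogram:
  fixes x y :: "'a::real_inner"
  shows "(norm (x + y))\<^sup>2 + (norm (x - y))\<^sup>2 = 2 * (norm x)\<^sup>2 + 2 * (norm y)\<^sup>2"
  by (simp add: power2_norm_eq_inner inner_add_left inner_add_right inner_diff_left inner_diff_right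
      inner_commute)

text \<open>A minimizing sequence in \<open>S\<close> is Cauchy by the parallelogram law, since
  midpoints stay in \<open>S\<close>. Its limit is a nearest point, and the residual at a nearest
  point is orthogonal to \<open>S\<close>. Completeness is asked of \<open>S\<close> because the
  ambient type need not be complete.\<close>

lemma projection_exists:
  fixes S :: "'a::complex_inner set"
  assumes "csubspace S" "complete S"
  shows "\<exists>y\<in>S. \<forall>z\<in>S. cinner (x - y) z = 0"
proof -
  define d where "d = infdist x S"
  have ne: "S \<noteq> {}"
    using assms(1) csubspace_0 by blast
  have le: "d \<le> norm (x - y)" if "y \<in> S" for y
    using infdist_le[OF that, of x] by (simp add: d_def dist_norm)
  have d0: "0 \<le> d"
    by (simp add: d_def infdist_nonneg)
  have "\<exists>y\<in>S. norm (x - y) < d + 1 / Suc n" for n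
  proof -
    have "infdist x S < d + 1 / Suc n"
      by (simp add: d_def)
    then show ?thesis
      using ne by (metis infdist_notempty cINF_less_iff bdd_below_image_dist dist_norm)
  qed
  then obtain y where y: "\<And>n. y n \<in> S" "\<And>n. norm (x - y n) < d + 1 / Suc n"
    by metis
  have dist_y: "(norm (y m - y n))\<^sup>2 \<le> 2 * (d + 1 / Suc m)\<^sup>2 + 2 * (d + 1 / Suc n)\<^sup>2 - 4 * d\<^sup>2" for m n
  proof -
    define h where "h = (1/2) *\<^sub>C (y m + y n)"
    have "h \<in> S"
      unfolding h_def by (intro csubspace_scale csubspace_add y assms)
    have "2 *\<^sub>C (x - h) = (x + x) - (y m + y n)"
      using scaleC_add_left[of 1 1 x] by (simp add: h_def cvs.scale_right_diff_distrib scaleC_scaleC)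
    then have "(x - y m) + (x - y n) = 2 *\<^sub>C (x - h)"
      by (simp add: algebra_simps)
    then have "norm ((x - y m) + (x - y n)) = 2 * norm (x - h)"
      by (simp add: norm_scaleC)
    then have 1: "4 * d\<^sup>2 \<le> (norm ((x - y m) + (x - y n)))\<^sup>2"
      using le[OF \<open>h \<in> S\<close>] d0 by (simp add: power_mult_distrib power_mono)
    have 2: "(norm (x - y k))\<^sup>2 \<le> (d + 1 / Suc k)\<^sup>2" for k
      by (rule power_mono[OF less_imp_le[OF y(2)] norm_ge_zero])
    have "(norm ((x - y m) + (x - y n)))\<^sup>2 + (norm (y m - y n))\<^sup>2 =
        2 * (norm (x - y m))\<^sup>2 + 2 * (norm (x - y n))\<^sup>2"
      using parallelogram[of "x - y m" "x - y n"] by (simp add: norm_minus_commute)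
    moreover have "b \<le> 2 * p + 2 * q - 4 * t"
      if "4 * t \<le> a" "r \<le> p" "s \<le> q" "a + b = 2 * r + 2 * s" for a b p q r s t :: real
      using that by linarith
    ultimately show ?thesis
      using 1 2[of m] 2[of n] by blast
  qed
  have "Cauchy y"
  proof (rule metric_CauchyI)
    fix e :: real assume "e > 0"
    have "(\<lambda>n. 4 * (d + 1 / Suc n)\<^sup>2 - 4 * d\<^sup>2) \<longlonglongrightarrow> 4 * (d + 0)\<^sup>2 - 4 * d\<^sup>2"
      by (intro tendsto_intros lim_1_over_n LIMSEQ_Suc lim_inverse_n')
    then have "eventually (\<lambda>n. 4 * (d + 1 / Suc n)\<^sup>2 - 4 * d\<^sup>2 < e\<^sup>2) sequentially"
      using \<open>e > 0\<close> by (intro order_tendstoD) auto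
    then obtain N where N: "4 * (d + 1 / Suc N)\<^sup>2 - 4 * d\<^sup>2 < e\<^sup>2"
      using eventually_happens'[OF sequentially_bot] by blast
    have mono: "(d + 1 / Suc n)\<^sup>2 \<le> (d + 1 / Suc N)\<^sup>2" if "n \<ge> N" for n
      using that d0 by (intro power_mono add_left_mono) (auto simp: frac_le)
    have "dist (y m) (y n) < e" if "m \<ge> N" "n \<ge> N" for m n
    proof -
      have "(norm (y m - y n))\<^sup>2 < e\<^sup>2"
        using dist_y[of m n] mono[OF that(1)] mono[OF that(2)] N by linarith
      then show ?thesis
        using \<open>e > 0\<close> by (simp add: dist_norm power2_less_imp_less)
    qed
    then show "\<exists>M. \<forall>m\<ge>M. \<forall>n\<ge>M. dist (y m) (y n) < e"
      by blast
  qed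
  then obtain p where p: "p \<in> S" "y \<longlonglongrightarrow> p"
    using assms(2) y(1) by (meson completeE)
  have "(\<lambda>n. norm (x - y n)) \<longlonglongrightarrow> norm (x - p)"
    by (intro tendsto_intros p)
  moreover have "(\<lambda>n. d + 1 / Suc n) \<longlonglongrightarrow> d + 0"
    by (intro tendsto_intros lim_1_over_n LIMSEQ_Suc lim_inverse_n')
  ultimately have "norm (x - p) \<le> d"
    using y(2) by (metis (no_types, lifting) LIMSEQ_le add.right_neutral less_imp_le)
  have "cinner (x - p) z = 0" if "z \<in> S" for z
  proof (rule orthogonal_if_minimal)
    fix c
    have "norm (x - p) \<le> norm (x - (p + c *\<^sub>C z))"
      using \<open>norm (x - p) \<le> d\<close> le assms(1) p(1) that
      by (meson csubspace_add csubspace_scale order_trans)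
    then show "norm (x - p) \<le> norm (x - p - c *\<^sub>C z)"
      by (simp add: diff_diff_eq)
  qed
  then show ?thesis
    using p(1) by blast
qed

lemma orth_proj_eqI:
  assumes "csubspace S" "y \<in> S" "\<And>z. z \<in> S \<Longrightarrow> cinner (x - y) z = 0"
  shows "orth_proj S x = y"
  unfolding orth_proj_def
proof (rule the_equality)
  fix y' assume y': "y' \<in> S \<and> (\<forall>z\<in>S. cinner (x - y') z = 0)"
  have "y' - y \<in> S"
    using assms y' by (simp add: csubspace_diff)
  then have "cinner (x - y) (y' - y) = 0" "cinner (x - y') (y' - y) = 0"
    using assms(3) y' by auto
  then have "cinner ((x - y) - (x - y')) (y' - y) = 0"
    by (subst cinner.diff_left) simp
  then show "y' = y"
    by (simp add: algebra_simps del: cinner.diff_left)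
qed (use assms in blast)

lemma orth_proj:
  assumes "csubspace S" "complete S"
  shows "orth_proj S x \<in> S" and "z \<in> S \<Longrightarrow> cinner (x - orth_proj S x) z = 0"
  using projection_exists[OF assms, of x] orth_proj_eqI[OF assms(1), of _ x] by fastforce+

text \<open>If the closed span were smaller than \<open>S\<close>, the difference between some
  vector of \<open>S\<close> and its projection would be nonzero and orthogonal to \<open>G\<close>.
  This is the density criterion behind all the spanning results below.\<close>

lemma closure_cspan_eqI:
  assumes "csubspace S" "complete S" "G \<subseteq> S"
    and "\<And>u. u \<in> S \<Longrightarrow> (\<And>g. g \<in> G \<Longrightarrow> cinner u g = 0) \<Longrightarrow> u = 0"
  shows "closure (cspan G) = S"
proof
  show sub: "closure (cspan G) \<subseteq> S"
    using assms by (intro closure_cspan_minimal complete_imp_closed)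
  let ?M = "closure (cspan G)"
  have M: "csubspace ?M" "complete ?M"
    using sub assms(2) by (auto intro: csubspace_closure csubspace_cspan complete_closed_subset)
  show "S \<subseteq> ?M"
  proof
    fix u assume "u \<in> S"
    have "u - orth_proj ?M u = 0"
    proof (rule assms(4))
      show "u - orth_proj ?M u \<in> S"
        using orth_proj(1)[OF M] sub \<open>u \<in> S\<close> assms(1) by (blast intro: csubspace_diff)
      show "cinner (u - orth_proj ?M u) g = 0" if "g \<in> G" for g
        using orth_proj(2)[OF M] that subset_closure_cspan by blast
    qed
    then show "u \<in> ?M"
      using orth_proj(1)[OF M, of u] by simp
  qed
qed

subsection \<open>Orthonormal systems\<close>

lemma corthonormal_norm: "corthonormal X \<Longrightarrow> x \<in> X \<Longrightarrow> norm x = 1"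
  by (metis Re_cinner corthonormal_def norm_eq_1 one_complex.sel(1))

lemma cinner_corthonormal_residual:
  assumes "corthonormal X" "finite X" "y \<in> X"
  shows "cinner (u - (\<Sum>x\<in>X. cinner u x *\<^sub>C x)) y = 0"
proof -
  have "(\<Sum>x\<in>X. cinner (cinner u x *\<^sub>C x) y) = (\<Sum>x\<in>X. if x = y then cinner u y else 0)"
    using assms(1,3) by (intro sum.cong) (auto simp: corthonormal_def cinner_scaleC_left)
  then show ?thesis
    using assms(2,3) by (simp add: cinner.diff_left cinner.sum_left)
qed

text \<open>A vector of the closure minus its Fourier sum over \<open>X\<close> still lies in the
  closure and is orthogonal to it, hence is 0.\<close>

lemma closure_cspan_finite:
  assumes "corthonormal X" "finite X"
  shows "closure (cspan X) = cspan X"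
proof
  show "closure (cspan X) \<subseteq> cspan X"
  proof
    fix u assume u: "u \<in> closure (cspan X)"
    define p where "p = (\<Sum>x\<in>X. cinner u x *\<^sub>C x)"
    have p: "p \<in> cspan X"
      unfolding p_def using cspan_superset by (auto intro!: csubspace_sum csubspace_scale csubspace_cspan)
    then have "u - p \<in> closure (cspan X)"
      using u closure_subset by (blast intro: csubspace_diff csubspace_closure csubspace_cspan)
    then have "cinner (u - p) (u - p) = 0"
      using orthogonal_closure_cspan[of X "u - p"] cinner_corthonormal_residual[OF assms]
      by (simp add: p_def)
    then show "u \<in> cspan X"
      using p by simp
  qed
qed (rule closure_subset)

lemma independent_corthonormal:
  assumes "corthonormal X"
  shows "\<not> cvs.dependent X"
  unfolding cvs.dependent_explicit
proof (intro notI, elim exE conjE bexE)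
  fix t u v assume t: "finite t" "t \<subseteq> X" "(\<Sum>v\<in>t. u v *\<^sub>C v) = 0" "v \<in> t" "u v \<noteq> 0"
  have "cinner (\<Sum>v\<in>t. u v *\<^sub>C v) v = (\<Sum>w\<in>t. if w = v then u v else 0)"
    using assms t unfolding cinner.sum_left
    by (intro sum.cong) (auto simp: corthonormal_def cinner_scaleC_left subset_iff)
  then show False
    using t by (simp add: cinner.zero_left)
qed

text \<open>One Gram-Schmidt step: \<open>e\<close> is the normalized residual of \<open>u\<close>,
  which is nonzero because \<open>u\<close> lies outside the span.\<close>

lemma corthonormal_extend:
  assumes "corthonormal X" "finite X" "u \<notin> cspan X"
  shows "\<exists>e. e \<notin> X \<and> e \<in> cspan (insert u X) \<and> corthonormal (insert e X) \<and> cspan (insert e X) = cspan (insert u X)"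
proof -
  define r where "r = u - (\<Sum>x\<in>X. cinner u x *\<^sub>C x)"
  define e where "e = of_real (inverse (norm r)) *\<^sub>C r"
  have sum: "(\<Sum>x\<in>X. cinner u x *\<^sub>C x) \<in> cspan Y" if "X \<subseteq> Y" for Y
    using cspan_superset that by (blast intro!: csubspace_sum csubspace_scale csubspace_cspan)
  have "r \<noteq> 0"
    using assms(3) sum[of X] by (auto simp: r_def)
  have "norm e = 1"
    using \<open>r \<noteq> 0\<close> by (simp add: e_def norm_scaleC norm_inverse)
  then have ee: "cinner e e = 1"
    by (simp add: cinner_self)
  have ex: "cinner e x = 0" "cinner x e = 0" if "x \<in> X" for x
  proof -
    show "cinner e x = 0"
      using cinner_corthonormal_residual[OF assms(1,2) that, of u]
      by (simp add: e_def r_def cinner_scaleC_left)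
    then show "cinner x e = 0"
      by (metis cinner_commute complex_cnj_zero)
  qed
  have "e \<notin> X"
    using ee ex by force
  have "u = of_real (norm r) *\<^sub>C e + (\<Sum>x\<in>X. cinner u x *\<^sub>C x)"
    using \<open>r \<noteq> 0\<close> by (simp add: e_def scaleC_scaleC r_def)
  also have "\<dots> \<in> cspan (insert e X)"
    using cspan_superset[of "insert e X"]
    by (intro csubspace_add csubspace_scale csubspace_cspan sum) auto
  finally have "u \<in> cspan (insert e X)" .
  moreover have e_in: "e \<in> cspan (insert u X)"
    unfolding e_def r_def using cspan_superset[of "insert u X"]
    by (intro csubspace_diff csubspace_scale csubspace_cspan sum) auto
  ultimately have "cspan (insert e X) = cspan (insert u X)"
    using cspan_superset[of "insert u X"] cspan_superset[of "insert e X"]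
    by (intro equalityI cspan_minimal csubspace_cspan) auto
  moreover have "corthonormal (insert e X)"
    using assms(1) ee ex \<open>e \<notin> X\<close> unfolding corthonormal_def by auto
  ultimately show ?thesis
    using \<open>e \<notin> X\<close> e_in by blast
qed

text \<open>The sequence may be linearly dependent: a vector already in the span adds nothing. The
  resulting system can thus be finite or infinite, and it is countable in either case.\<close>

lemma Gram_Schmidt:
  fixes v :: "nat \<Rightarrow> 'a::complex_inner"
  shows "\<exists>X. corthonormal X \<and> countable X \<and> cspan X = cspan (range v)"
proof -
  define P where "P n X \<longleftrightarrow> finite X \<and> corthonormal X \<and> cspan X = cspan (v ` {..<n})" for n X
  have step: "\<exists>Y. P (Suc n) Y \<and> X \<subseteq> Y" if PX: "P n X" for n X
  proof (cases "v n \<in> cspan X")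
    case True
    have "cspan (v ` {..<Suc n}) = cspan (insert (v n) X)"
      using that by (simp add: P_def lessThan_Suc cspan_eq cvs.span_insert)
    then show ?thesis
      using that True by (metis P_def cspan_eq cvs.span_redundant order_refl)
  next
    case False
    then obtain e where "corthonormal (insert e X)" "cspan (insert e X) = cspan (insert (v n) X)"
      using corthonormal_extend[of X "v n"] PX unfolding P_def by blast
    moreover have "cspan (v ` {..<Suc n}) = cspan (insert (v n) X)"
      using that by (simp add: P_def lessThan_Suc cspan_eq cvs.span_insert)
    ultimately have "P (Suc n) (insert e X)"
      using that by (simp add: P_def)
    then show ?thesis
      by blast
  qed
  have "P 0 {}"
    by (simp add: P_def corthonormal_def)
  then have "\<exists>X. \<forall>n. P n (X n) \<and> X n \<subseteq> X (Suc n)"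
    by (intro dependent_nat_choice step) blast
  then obtain X where X: "\<And>n. P n (X n)" "\<And>n. X n \<subseteq> X (Suc n)"
    by blast
  have mono: "X m \<subseteq> X n" if "m \<le> n" for m n
    by (rule lift_Suc_mono_le[of X, OF X(2) that])
  have "corthonormal (\<Union>n. X n)"
    unfolding corthonormal_def
  proof (intro ballI)
    fix x y assume "x \<in> (\<Union>n. X n)" "y \<in> (\<Union>n. X n)"
    then obtain m n where "x \<in> X m" "y \<in> X n"
      by blast
    then have "x \<in> X (max m n)" "y \<in> X (max m n)"
      using mono[of m "max m n"] mono[of n "max m n"] by auto
    then show "cinner x y = (if x = y then 1 else 0)"
      using X(1)[of "max m n"] by (simp add: P_def corthonormal_def)
  qed
  moreover have "countable (\<Union>n. X n)"
    using X(1) by (auto simp: P_def intro: countable_finite)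
  moreover have "cspan (\<Union>n. X n) = cspan (range v)"
  proof (intro equalityI cspan_minimal csubspace_cspan)
    show "(\<Union>n. X n) \<subseteq> cspan (range v)"
    proof
      fix x assume "x \<in> (\<Union>n. X n)"
      then obtain n where "x \<in> cspan (v ` {..<n})"
        using X(1) cspan_superset[of "X _"] unfolding P_def by blast
      then show "x \<in> cspan (range v)"
        using cvs.span_mono[of "v ` {..<n}" "range v"] by (auto simp: cspan_eq)
    qed
    show "range v \<subseteq> cspan (\<Union>n. X n)"
    proof clarify
      fix n
      have "v n \<in> cspan (X (Suc n))"
        using X(1)[of "Suc n"] cspan_superset[of "v ` {..<Suc n}"] by (auto simp: P_def)
      then show "v n \<in> cspan (\<Union>n. X n)"
        using cvs.span_mono[of "X (Suc n)" "\<Union>n. X n"] by (auto simp: cspan_eq)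
    qed
  qed
  ultimately show ?thesis
    by blast
qed

subsection \<open>Bounded operators\<close>

lemma clinear_on_add: "clinear_on S A \<Longrightarrow> x \<in> S \<Longrightarrow> y \<in> S \<Longrightarrow> A (x + y) = A x + A y"
  and clinear_on_scale: "clinear_on S A \<Longrightarrow> x \<in> S \<Longrightarrow> A (c *\<^sub>C x) = c *\<^sub>C A x"
  by (simp_all add: clinear_on_def)

lemma clinear_on_0: "clinear_on S A \<Longrightarrow> csubspace S \<Longrightarrow> A 0 = 0"
  using clinear_on_scale[of S A 0 0] csubspace_0[of S] by simp

lemma clinear_on_diff: "clinear_on S A \<Longrightarrow> csubspace S \<Longrightarrow> x \<in> S \<Longrightarrow> y \<in> S \<Longrightarrow> A (x - y) = A x - A y"
  using clinear_on_add[of S A "x - y" y] csubspace_diff[of S x y] by (simp add: algebra_simps)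

lemma clinear_on_subset: "clinear_on S A \<Longrightarrow> T \<subseteq> S \<Longrightarrow> clinear_on T A"
  unfolding clinear_on_def by blast

lemma continuous_on_clinear:
  assumes "csubspace S" "clinear_on S A" "\<And>x. x \<in> S \<Longrightarrow> norm (A x) \<le> C * norm x"
  shows "continuous_on S A"
proof (rule lipschitz_on_continuous_on)
  show "(max C 0)-lipschitz_on S A"
  proof (rule lipschitz_onI)
    fix x y assume "x \<in> S" "y \<in> S"
    then have "norm (A x - A y) \<le> C * norm (x - y)"
      using assms clinear_on_diff[OF assms(2,1)] csubspace_diff[OF assms(1)] by metis
    also have "\<dots> \<le> max C 0 * norm (x - y)"
      by (intro mult_right_mono) auto
    finally show "dist (A x) (A y) \<le> max C 0 * dist x y"
      by (simp add: dist_norm)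
  qed simp
qed

lemma clinear_on_eqI:
  assumes "csubspace S" "closed S" "clinear_on S A" "continuous_on S A" "clinear_on S A'" "continuous_on S A'"
    and "G \<subseteq> S" "\<And>g. g \<in> G \<Longrightarrow> A g = A' g" "x \<in> closure (cspan G)"
  shows "A x = A' x"
proof -
  have "closed {x \<in> S. A x - A' x = 0}"
    by (intro continuous_closed_preimage_constant continuous_intros assms)
  moreover have "csubspace {x \<in> S. A x - A' x = 0}"
    using assms(1,3,5) by (auto simp: csubspace_def clinear_on_def clinear_on_0)
  moreover have "G \<subseteq> {x \<in> S. A x - A' x = 0}"
    using assms(7,8) by auto
  ultimately have "closure (cspan G) \<subseteq> {x \<in> S. A x - A' x = 0}"
    by (intro closure_cspan_minimal)
  then show ?thesis
    using assms(9) by auto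
qed

text \<open>The operator is given by its graph \<open>P\<close>, so its values need not be known to
  be well defined: the bound, applied to the difference of two pairs, makes the value unique. The
  closure \<open>Q\<close> of the graph is the extended operator; only the target has to be
  complete.\<close>

lemma linear_relation_extension:
  fixes P :: "'a::complex_inner \<Rightarrow> 'b::complex_inner \<Rightarrow> bool"
  assumes add: "\<And>u v u' v'. P u v \<Longrightarrow> P u' v' \<Longrightarrow> P (u + u') (v + v')"
    and scale: "\<And>c u v. P u v \<Longrightarrow> P (c *\<^sub>C u) (c *\<^sub>C v)"
    and bound: "\<And>u v. P u v \<Longrightarrow> norm v \<le> C * norm u"
    and T: "\<And>u v. P u v \<Longrightarrow> v \<in> T" "complete T"
  shows "\<exists>L. clinear_on (closure {u. \<exists>v. P u v}) L \<and> (\<forall>u v. P u v \<longrightarrow> L u = v) \<and>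
    (\<forall>u \<in> closure {u. \<exists>v. P u v}. L u \<in> T \<and> norm (L u) \<le> C * norm u)"
proof -
  define Q where "Q u v \<longleftrightarrow> (\<exists>U V. (\<forall>n. P (U n) (V n)) \<and> U \<longlonglongrightarrow> u \<and> V \<longlonglongrightarrow> v)" for u v
  have Q_add: "Q (u + u') (v + v')" if Q: "Q u v" "Q u' v'" for u v u' v'
  proof -
    obtain U V where UV: "\<forall>n. P (U n) (V n)" "U \<longlonglongrightarrow> u" "V \<longlonglongrightarrow> v"
      using Q(1) Q_def by blast
    obtain U' V' where UV': "\<forall>n. P (U' n) (V' n)" "U' \<longlonglongrightarrow> u'" "V' \<longlonglongrightarrow> v'"
      using Q(2) Q_def by blast
    show ?thesis
      unfolding Q_def
      by (intro exI[of _ "\<lambda>n. U n + U' n"] exI[of _ "\<lambda>n. V n + V' n"] conjI allI add tendsto_add)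
        (use UV UV' in auto)
  qed
  have Q_scale: "Q (c *\<^sub>C u) (c *\<^sub>C v)" if Q: "Q u v" for c u v
  proof -
    obtain U V where UV: "\<forall>n. P (U n) (V n)" "U \<longlonglongrightarrow> u" "V \<longlonglongrightarrow> v"
      using Q Q_def by blast
    show ?thesis
      unfolding Q_def
      by (intro exI[of _ "\<lambda>n. c *\<^sub>C U n"] exI[of _ "\<lambda>n. c *\<^sub>C V n"] conjI allI scale
          scaleC.tendsto tendsto_const) (use UV in auto)
  qed
  have Q_bound: "norm v \<le> C * norm u" if Q: "Q u v" for u v
  proof -
    obtain U V where UV: "\<forall>n. P (U n) (V n)" "U \<longlonglongrightarrow> u" "V \<longlonglongrightarrow> v"
      using Q Q_def by blast
    have "(\<lambda>n. norm (V n)) \<longlonglongrightarrow> norm v" "(\<lambda>n. C * norm (U n)) \<longlonglongrightarrow> C * norm u"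
      using UV by (auto intro!: tendsto_intros)
    then show ?thesis
      using UV(1) bound by (intro LIMSEQ_le) auto
  qed
  have Q_unique: "v = v'" if "Q u v" "Q u v'" for u v v'
  proof -
    have "Q (u + (-1) *\<^sub>C u) (v + (-1) *\<^sub>C v')"
      using that by (intro Q_add Q_scale)
    then have "Q 0 (v - v')"
      by simp
    then show ?thesis
      using Q_bound by fastforce
  qed
  have P_Q: "Q u v" if "P u v" for u v
    using that unfolding Q_def by (intro exI[of _ "\<lambda>_. u"] exI[of _ "\<lambda>_. v"]) simp
  have Q_ex: "\<exists>v. Q u v" if u: "u \<in> closure {u. \<exists>v. P u v}" for u
  proof -
    obtain U where U: "\<forall>n. \<exists>v. P (U n) v" "U \<longlonglongrightarrow> u"
      using u unfolding closure_sequential by blast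
    obtain V where V: "\<And>n. P (U n) (V n)"
      using choice[OF U(1)] by blast
    have "Cauchy V"
    proof (rule metric_CauchyI)
      fix e :: real assume "e > 0"
      define D where "D = max C 1"
      have "e / D > 0"
        using \<open>e > 0\<close> by (simp add: D_def)
      then obtain M where M: "\<And>m n. m \<ge> M \<Longrightarrow> n \<ge> M \<Longrightarrow> dist (U m) (U n) < e / D"
        using metric_CauchyD[OF LIMSEQ_imp_Cauchy[OF U(2)]] by blast
      have "dist (V m) (V n) < e" if "m \<ge> M" "n \<ge> M" for m n
      proof -
        have "P (U m + (-1) *\<^sub>C U n) (V m + (-1) *\<^sub>C V n)"
          by (intro add scale V)
        then have "norm (V m - V n) \<le> C * norm (U m - U n)"
          using bound by fastforce
        also have "\<dots> \<le> D * norm (U m - U n)"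
          by (intro mult_right_mono) (auto simp: D_def)
        also have "\<dots> < e"
          using M[OF that] by (simp add: D_def dist_norm pos_less_divide_eq mult.commute)
        finally show ?thesis
          by (simp add: dist_norm)
      qed
      then show "\<exists>M. \<forall>m\<ge>M. \<forall>n\<ge>M. dist (V m) (V n) < e"
        by blast
    qed
    then obtain v where "V \<longlonglongrightarrow> v"
      using completeE[OF T(2) _ \<open>Cauchy V\<close>] T(1)[OF V] by blast
    then show ?thesis
      using U(2) V Q_def by blast
  qed
  have Q_T: "v \<in> T" if Q: "Q u v" for u v
  proof -
    obtain U V where UV: "\<forall>n. P (U n) (V n)" "U \<longlonglongrightarrow> u" "V \<longlonglongrightarrow> v"
      using Q Q_def by blast
    show ?thesis
      using closed_sequentially[OF complete_imp_closed[OF T(2)] _ UV(3)] T(1) UV(1) by blast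
  qed
  define L where "L u = (THE v. Q u v)" for u
  have L_eq: "L u = v" if "Q u v" for u v
    unfolding L_def using that Q_unique by blast
  have L: "Q u (L u)" if "u \<in> closure {u. \<exists>v. P u v}" for u
    using Q_ex[OF that] L_eq by metis
  have "clinear_on (closure {u. \<exists>v. P u v}) L"
    unfolding clinear_on_def by (blast intro: L L_eq Q_add Q_scale)
  then show ?thesis
    using L L_eq P_Q Q_T Q_bound by blast
qed

text \<open>The orthogonal sum of copies of \<open>K\<close> indexed by \<open>X\<close>: each
  \<open>V h\<close> embeds \<open>K\<close> isometrically, and different copies are
  orthogonal.\<close>

definition isometric_family :: "'i set \<Rightarrow> 'a::complex_inner set \<Rightarrow> ('i \<Rightarrow> 'a \<Rightarrow> 'b::complex_inner) \<Rightarrow> bool" where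
  "isometric_family X K V \<longleftrightarrow> (\<forall>h\<in>X. clinear_on K (V h)) \<and>
     (\<forall>h\<in>X. \<forall>h'\<in>X. \<forall>f\<in>K. \<forall>g\<in>K. cinner (V h f) (V h' g) = (if h = h' then cinner f g else 0))"

lemma norm_sum_isometric_family:
  assumes "isometric_family X K V" "finite F" "F \<subseteq> X" "\<And>h. h \<in> F \<Longrightarrow> g h \<in> K"
  shows "(norm (\<Sum>h\<in>F. V h (g h)))\<^sup>2 = (\<Sum>h\<in>F. (norm (g h))\<^sup>2)"
proof -
  have "complex_of_real ((norm (\<Sum>h\<in>F. V h (g h)))\<^sup>2) =
      (\<Sum>h\<in>F. \<Sum>h'\<in>F. cinner (V h (g h)) (V h' (g h')))"
    unfolding cinner_self[symmetric] cinner.sum_left cinner.sum_right by (rule sum.swap)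
  also have "\<dots> = (\<Sum>h\<in>F. \<Sum>h'\<in>F. if h = h' then cinner (g h) (g h) else 0)"
    using assms by (intro sum.cong) (auto simp: isometric_family_def subset_iff)
  also have "\<dots> = of_real (\<Sum>h\<in>F. (norm (g h))\<^sup>2)"
    using assms(2) by (simp add: cinner_self)
  finally show ?thesis
    by (simp only: of_real_eq_iff)
qed

text \<open>By Pythagoras, the operator that acts as \<open>A\<close> from each
  \<open>V\<close>-copy to the matching \<open>W\<close>-copy inherits the bound \<open>C\<close> of
  \<open>A\<close>. With \<open>A\<close> the identity it yields the unitary; with \<open>V\<close>
  equal to \<open>W\<close> it yields the diagonal operators on the model space and on the tensor
  product.\<close>

lemma isometric_family_extension:
  fixes V :: "'i \<Rightarrow> 'a::complex_inner \<Rightarrow> 'b::complex_inner" and W :: "'i \<Rightarrow> 'a \<Rightarrow> 'c::complex_inner"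
  assumes V: "isometric_family X K V" and W: "isometric_family X K W"
    and K: "csubspace K" and A: "A ` K \<subseteq> K" "clinear_on K A" "\<And>f. f \<in> K \<Longrightarrow> norm (A f) \<le> C * norm f" "0 \<le> C"
    and T: "csubspace T" "complete T" "\<And>h f. h \<in> X \<Longrightarrow> f \<in> K \<Longrightarrow> W h f \<in> T"
    and S: "S \<subseteq> closure (cspan {V h f |h f. h \<in> X \<and> f \<in> K})"
  shows "\<exists>L. clinear_on S L \<and> (\<forall>h\<in>X. \<forall>f\<in>K. L (V h f) = W h (A f)) \<and>
    (\<forall>u\<in>S. L u \<in> T \<and> norm (L u) \<le> C * norm u)"
proof -
  define P where "P u v \<longleftrightarrow> (\<exists>F g. finite F \<and> F \<subseteq> X \<and> (\<forall>h. g h \<in> K) \<and>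
    u = (\<Sum>h\<in>F. V h (g h)) \<and> v = (\<Sum>h\<in>F. W h (A (g h))))" for u v
  have A0: "A 0 = 0" and V0: "\<And>h. h \<in> X \<Longrightarrow> V h 0 = 0" and W0: "\<And>h. h \<in> X \<Longrightarrow> W h 0 = 0"
    using V W A(2) K by (auto simp: isometric_family_def intro: clinear_on_0)
  have P_single: "P (V h f) (W h (A f))" if "h \<in> X" "f \<in> K" for h f
    unfolding P_def using that by (intro exI[of _ "{h}"] exI[of _ "\<lambda>_. f"]) simp
  have P_add: "P (u + u') (v + v')" if uv: "P u v" and uv': "P u' v'" for u v u' v'
  proof -
    obtain F g where F: "finite F" "F \<subseteq> X" "\<forall>h. g h \<in> K"
        "u = (\<Sum>h\<in>F. V h (g h))" "v = (\<Sum>h\<in>F. W h (A (g h)))"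
      using uv unfolding P_def by blast
    obtain F' g' where F': "finite F'" "F' \<subseteq> X" "\<forall>h. g' h \<in> K"
        "u' = (\<Sum>h\<in>F'. V h (g' h))" "v' = (\<Sum>h\<in>F'. W h (A (g' h)))"
      using uv' unfolding P_def by blast
    \<comment> \<open>The two sums run over different index sets; padding with 0 moves both to
      \<open>F \<union> F'\<close>, where they can be added term by term.\<close>
    define k where "k h = (if h \<in> F then g h else 0)" for h
    define k' where "k' h = (if h \<in> F' then g' h else 0)" for h
    have k: "k h \<in> K" "k' h \<in> K" for h
      using F(3) F'(3) csubspace_0[OF K] by (auto simp: k_def k'_def)
    have "u = (\<Sum>h\<in>F\<union>F'. V h (k h))" "v = (\<Sum>h\<in>F\<union>F'. W h (A (k h)))"
      unfolding F(4,5) using F F' V0 W0 A0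
      by (auto intro!: sum.mono_neutral_cong_left simp: k_def)
    moreover have "u' = (\<Sum>h\<in>F\<union>F'. V h (k' h))" "v' = (\<Sum>h\<in>F\<union>F'. W h (A (k' h)))"
      unfolding F'(4,5) using F F' V0 W0 A0
      by (auto intro!: sum.mono_neutral_cong_left simp: k'_def)
    moreover have "V h (k h + k' h) = V h (k h) + V h (k' h)"
      "W h (A (k h + k' h)) = W h (A (k h)) + W h (A (k' h))" if "h \<in> X" for h
      using that V W A k unfolding isometric_family_def
      by (auto simp: clinear_on_add image_subset_iff)
    ultimately have "u + u' = (\<Sum>h\<in>F\<union>F'. V h (k h + k' h))"
      "v + v' = (\<Sum>h\<in>F\<union>F'. W h (A (k h + k' h)))"
      using F(2) F'(2) by (auto simp: sum.distrib[symmetric] intro!: sum.cong)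
    then show ?thesis
      unfolding P_def using F F' k csubspace_add[OF K]
      by (intro exI[of _ "F \<union> F'"] exI[of _ "\<lambda>h. k h + k' h"]) auto
  qed
  have P_scale: "P (c *\<^sub>C u) (c *\<^sub>C v)" if uv: "P u v" for c u v
  proof -
    obtain F g where F: "finite F" "F \<subseteq> X" "\<forall>h. g h \<in> K"
        "u = (\<Sum>h\<in>F. V h (g h))" "v = (\<Sum>h\<in>F. W h (A (g h)))"
      using uv unfolding P_def by blast
    have "V h (c *\<^sub>C g h) = c *\<^sub>C V h (g h)" "W h (A (c *\<^sub>C g h)) = c *\<^sub>C W h (A (g h))" if "h \<in> X" for h
      using that V W A F(3) unfolding isometric_family_def
      by (auto simp: clinear_on_scale image_subset_iff)
    then have "c *\<^sub>C u = (\<Sum>h\<in>F. V h (c *\<^sub>C g h))" "c *\<^sub>C v = (\<Sum>h\<in>F. W h (A (c *\<^sub>C g h)))"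
      using F(2) unfolding F(4,5) by (auto simp: scaleC.sum_right intro!: sum.cong)
    then show ?thesis
      unfolding P_def using F csubspace_scale[OF K]
      by (intro exI[of _ F] exI[of _ "\<lambda>h. c *\<^sub>C g h"]) auto
  qed
  have P_bound: "norm v \<le> C * norm u" and P_T: "v \<in> T" if uv: "P u v" for u v
  proof -
    obtain F g where F: "finite F" "F \<subseteq> X" "\<forall>h. g h \<in> K"
        "u = (\<Sum>h\<in>F. V h (g h))" "v = (\<Sum>h\<in>F. W h (A (g h)))"
      using uv unfolding P_def by blast
    have "(norm v)\<^sup>2 = (\<Sum>h\<in>F. (norm (A (g h)))\<^sup>2)"
      unfolding F(5) using F A by (intro norm_sum_isometric_family[OF W]) auto
    also have "\<dots> \<le> (\<Sum>h\<in>F. (C * norm (g h))\<^sup>2)"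
      using F A by (intro sum_mono power_mono) auto
    also have "\<dots> = C\<^sup>2 * (\<Sum>h\<in>F. (norm (g h))\<^sup>2)"
      by (simp add: power_mult_distrib sum_distrib_left)
    also have "(\<Sum>h\<in>F. (norm (g h))\<^sup>2) = (norm u)\<^sup>2"
      unfolding F(4) using F by (intro norm_sum_isometric_family[OF V, symmetric]) auto
    finally have "(norm v)\<^sup>2 \<le> (C * norm u)\<^sup>2"
      by (simp only: power_mult_distrib)
    then show "norm v \<le> C * norm u"
      by (rule power2_le_imp_le) (simp add: A(4))
    show "v \<in> T"
      unfolding F(5) using F(2,3) A(1) by (intro csubspace_sum T(1,3)) blast+
  qed
  have "csubspace {u. \<exists>v. P u v}"
    unfolding csubspace_def
  proof (intro conjI ballI allI)
    show "0 \<in> {u. \<exists>v. P u v}"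
      unfolding P_def mem_Collect_eq using csubspace_0[OF K]
      by (intro exI[of _ 0] exI[of _ "{}"] exI[of _ "\<lambda>_. 0"]) simp
  next
    fix x y assume "x \<in> {u. \<exists>v. P u v}" "y \<in> {u. \<exists>v. P u v}"
    then obtain v v' where "P x v" "P y v'"
      by blast
    then show "x + y \<in> {u. \<exists>v. P u v}"
      using P_add by blast
  next
    fix c x assume "x \<in> {u. \<exists>v. P u v}"
    then obtain v where "P x v"
      by blast
    then show "c *\<^sub>C x \<in> {u. \<exists>v. P u v}"
      using P_scale by blast
  qed
  then have "cspan {V h f |h f. h \<in> X \<and> f \<in> K} \<subseteq> {u. \<exists>v. P u v}"
    using P_single by (intro cspan_minimal) auto
  then have sub: "S \<subseteq> closure {u. \<exists>v. P u v}"
    using S closure_mono by blast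
  have "\<exists>L. clinear_on (closure {u. \<exists>v. P u v}) L \<and> (\<forall>u v. P u v \<longrightarrow> L u = v) \<and>
    (\<forall>u \<in> closure {u. \<exists>v. P u v}. L u \<in> T \<and> norm (L u) \<le> C * norm u)"
  proof (rule linear_relation_extension)
    show "P (u + u') (v + v')" if "P u v" "P u' v'" for u u' v v'
      by (rule P_add[OF that])
    show "P (c *\<^sub>C u) (c *\<^sub>C v)" if "P u v" for c u v
      by (rule P_scale[OF that])
    show "norm v \<le> C * norm u" "v \<in> T" if "P u v" for u v
      by (rule P_bound[OF that] P_T[OF that])+
  qed (rule T(2))
  then obtain L where L: "clinear_on (closure {u. \<exists>v. P u v}) L" "\<And>u v. P u v \<Longrightarrow> L u = v"
      "\<forall>u \<in> closure {u. \<exists>v. P u v}. L u \<in> T \<and> norm (L u) \<le> C * norm u"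
    by blast
  show ?thesis
  proof (intro exI[of _ L] conjI ballI)
    show "clinear_on S L"
      by (rule clinear_on_subset[OF L(1) sub])
    show "L (V h f) = W h (A f)" if "h \<in> X" "f \<in> K" for h f
      by (rule L(2)[OF P_single[OF that]])
    show "L u \<in> T" "norm (L u) \<le> C * norm u" if "u \<in> S" for u
      using L(3) sub that by auto
  qed
qed

text \<open>Polarization: the diagonal at x + y gives F x y + F y x = 0, and replacing x by \<i> x
  flips the relative sign of the two terms, so each of them is 0.\<close>

lemma sesquilinear_eq_0:
  fixes F :: "'a::complex_inner \<Rightarrow> 'a \<Rightarrow> complex"
  assumes S: "csubspace S"
    and addl: "\<And>x y z. x \<in> S \<Longrightarrow> y \<in> S \<Longrightarrow> z \<in> S \<Longrightarrow> F (x + y) z = F x z + F y z"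
    and addr: "\<And>x y z. x \<in> S \<Longrightarrow> y \<in> S \<Longrightarrow> z \<in> S \<Longrightarrow> F x (y + z) = F x y + F x z"
    and scalel: "\<And>c x y. x \<in> S \<Longrightarrow> y \<in> S \<Longrightarrow> F (c *\<^sub>C x) y = c * F x y"
    and scaler: "\<And>c x y. x \<in> S \<Longrightarrow> y \<in> S \<Longrightarrow> F x (c *\<^sub>C y) = cnj c * F x y"
    and diag: "\<And>x. x \<in> S \<Longrightarrow> F x x = 0"
    and "x \<in> S" "y \<in> S"
  shows "F x y = 0"
proof -
  have 1: "F u v + F v u = 0" if "u \<in> S" "v \<in> S" for u v
  proof -
    have "F (u + v) (u + v) = F u (u + v) + F v (u + v)"
      using that S by (intro addl csubspace_add)
    also have "F u (u + v) = F u u + F u v"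
      using that by (intro addr)
    also have "F v (u + v) = F v u + F v v"
      using that by (intro addr)
    finally show ?thesis
      using diag that S by (simp add: csubspace_add)
  qed
  have "F x y + F y x = 0" "\<i> * F x y + - \<i> * F y x = 0"
    using 1[of x y] 1[of "\<i> *\<^sub>C x" y] assms(7,8) S scalel scaler by (auto simp: csubspace_scale)
  then have "\<i> * (F x y + F y x) + (\<i> * F x y + - \<i> * F y x) = 0"
    by simp
  then show ?thesis
    by (simp add: algebra_simps)
qed

section \<open>The circle\<close>

lemma cis_borel [measurable]: "cis \<in> borel_measurable borel"
  by (intro borel_measurable_continuous_onI continuous_intros)

lemma cnj_borel [measurable]: "cnj \<in> borel_measurable borel"
  by (intro borel_measurable_continuous_onI continuous_intros)

lemma emeasure_Icc_2pi: "emeasure lborel {0..2 * pi} = ennreal (2 * pi)"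
  by simp

lemma prob_circle: "emeasure circle_measure UNIV = 1"
  by (simp add: circle_measure_def emeasure_distr divide_ennreal)

interpretation circle: finite_measure circle_measure
  by standard (simp add: prob_circle)

lemma measure_circle_UNIV [simp]: "measure circle_measure UNIV = 1"
  by (simp add: measure_def prob_circle)

lemma AE_circle: "AE z in circle_measure. cmod z = 1"
proof -
  have "{z::complex. cmod z = 1} \<in> sets borel"
    by measurable
  moreover have "cis \<in> uniform_measure lborel {0..2 * pi} \<rightarrow>\<^sub>M borel"
    by measurable
  ultimately show ?thesis
    unfolding circle_measure_def by (subst AE_distr_iff) simp_all
qed

lemma AE_circle_nz: "AE z in circle_measure. z \<noteq> 0"
  using AE_circle by eventually_elim auto

lemma integral_circle:
  fixes f :: "complex \<Rightarrow> complex"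
  assumes [measurable]: "f \<in> borel_measurable borel"
  shows "(\<integral>z. f z \<partial>circle_measure) =
    (\<integral>x. indicator {0..2*pi} x *\<^sub>R f (cis x) \<partial>lborel) / of_real (2 * pi)"
proof -
  have "uniform_measure lborel {0..2 * pi} =
      density lborel (\<lambda>x. ennreal (indicator {0..2 * pi} x / (2 * pi)))"
    unfolding uniform_measure_def emeasure_Icc_2pi
    by (intro density_cong AE_I2) (auto simp: divide_ennreal[of 1 "2 * pi", simplified] split: split_indicator)
  then have "(\<integral>z. f z \<partial>circle_measure) =
      (\<integral>x. (indicator {0..2 * pi} x / (2 * pi)) *\<^sub>R f (cis x) \<partial>lborel)"
    by (simp add: circle_measure_def integral_distr integral_density)
  also have "\<dots> = (\<integral>x. (indicator {0..2*pi} x *\<^sub>R f (cis x)) / of_real (2 * pi) \<partial>lborel)"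
    by (intro Bochner_Integration.integral_cong) (auto simp: scaleR_conv_of_real)
  finally show ?thesis
    by (simp only: integral_divide_zero)
qed

lemma integral_powi: "(\<integral>z. z powi n \<partial>circle_measure) = (if n = 0 then 1 else 0)"
proof (cases "n = 0")
  case False
  have [measurable]: "(\<lambda>z::complex. z powi n) \<in> borel_measurable borel"
    unfolding power_int_def by measurable
  have "(\<integral>x. indicator {0..2*pi} x *\<^sub>R cis (of_int n * x) \<partial>lborel) =
     cis (of_int n * (2 * pi)) / (\<i> * of_int n) - cis (of_int n * 0) / (\<i> * of_int n)"
  proof (rule integral_FTC_Icc)
    fix x :: real
    show "((\<lambda>x. cis (of_int n * x) / (\<i> * of_int n)) has_vector_derivative cis (of_int n * x))
      (at x within {0..2*pi})"
      using False unfolding cis_conv_exp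
      by (auto intro!: derivative_eq_intros has_vector_derivative_real_field simp: field_simps)
  qed (auto intro!: continuous_intros)
  also have "\<dots> = 0"
    using cis_multiple_2pi[of "of_int n"] by (simp add: mult.commute mult.left_commute)
  finally show ?thesis
    using False by (simp add: integral_circle cis_power_int)
qed simp

subsection \<open>Measures on the circle are determined by their moments\<close>

text \<open>On the circle cnj z is the inverse of z, so a polynomial in the real and imaginary part
  is a trigonometric polynomial; the factor z^N clears its negative powers.\<close>

lemma real_polynomial_circle:
  assumes "real_polynomial_function p"
  shows "\<exists>Q N. \<forall>z. cmod z = 1 \<longrightarrow> of_real (p z) * z ^ N = poly Q z"
  using assms
proof induction
  case (linear f)
  define a b where "a = complex_of_real (f 1)" and "b = complex_of_real (f \<i>)"
  have "of_real (f z) * z ^ 1 = poly [:(a + \<i> * b) / 2, 0, (a - \<i> * b) / 2:] z" if "cmod z = 1" for z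
  proof -
    have "z = Re z *\<^sub>R 1 + Im z *\<^sub>R \<i>"
      by (simp add: complex_eq_iff)
    then have "f z = Re z * f 1 + Im z * f \<i>"
      using linear_add[OF bounded_linear.linear[OF linear], of "Re z *\<^sub>R 1" "Im z *\<^sub>R \<i>"]
        linear_scale[OF bounded_linear.linear[OF linear]] by simp
    then have fz: "of_real (f z) = of_real (Re z) * a + of_real (Im z) * b"
      by (simp add: a_def b_def)
    have "z * cnj z = 1"
      using that by (simp add: complex_norm_square[symmetric])
    moreover have "of_real (Re z) = (z + cnj z) / 2" "of_real (Im z) = - \<i> * (z - cnj z) / 2"
      by (simp_all add: complex_eq_iff)
    ultimately have "of_real (f z) * z ^ 1 = a * (z * z + z * cnj z) / 2 - \<i> * b * (z * z - z * cnj z) / 2"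
      unfolding fz by (simp only:) (simp add: algebra_simps add_divide_distrib diff_divide_distrib)
    also have "\<dots> = poly [:(a + \<i> * b) / 2, 0, (a - \<i> * b) / 2:] z"
      using \<open>z * cnj z = 1\<close> by (simp add: algebra_simps add_divide_distrib diff_divide_distrib)
    finally show ?thesis .
  qed
  then show ?case
    by blast
next
  case (const c)
  show ?case
    by (intro exI[of _ "[:of_real c:]"] exI[of _ 0]) simp
next
  case (add f g)
  then obtain Q N R M where "\<forall>z. cmod z = 1 \<longrightarrow> of_real (f z) * z ^ N = poly Q z"
    "\<forall>z. cmod z = 1 \<longrightarrow> of_real (g z) * z ^ M = poly R z"
    by blast
  then have "\<forall>z. cmod z = 1 \<longrightarrow> of_real (f z + g z) * z ^ (N + M) = poly (Q * monom 1 M + R * monom 1 N) z"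
    by (simp add: poly_monom power_add algebra_simps)
  then show ?case
    by blast
next
  case (mult f g)
  then obtain Q N R M where "\<forall>z. cmod z = 1 \<longrightarrow> of_real (f z) * z ^ N = poly Q z"
    "\<forall>z. cmod z = 1 \<longrightarrow> of_real (g z) * z ^ M = poly R z"
    by blast
  then have "\<forall>z. cmod z = 1 \<longrightarrow> of_real (f z * g z) * z ^ (N + M) = poly (Q * R) z"
    by (simp add: power_add) (metis mult.assoc mult.commute)
  then show ?case
    by blast
qed

lemma integrable_bounded_AE:
  fixes f :: "_ \<Rightarrow> 'b::{banach, second_countable_topology}"
  assumes "finite_measure M" "f \<in> borel_measurable M" "AE z in M. norm (f z) \<le> C"
  shows "integrable M f"
  using assms finite_measure.integrable_const_bound by blast

lemma integrable_powi_circle: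
  assumes "finite_measure M" "sets M = sets borel" "AE z in M. cmod z = 1"
  shows "integrable M (\<lambda>z::complex. z powi n)"
proof (rule integrable_bounded_AE[OF assms(1)])
  show "(\<lambda>z. z powi n) \<in> borel_measurable M"
    unfolding measurable_cong_sets[OF assms(2) refl] power_int_def by measurable
  show "AE z in M. norm (z powi n) \<le> 1"
    using assms(3) by eventually_elim (simp add: norm_power_int)
qed

lemma integral_poly_powi_circle:
  assumes "finite_measure M" "sets M = sets borel" "AE z in M. cmod z = 1"
    and p: "\<And>z. cmod z = 1 \<Longrightarrow> of_real (p z) * z ^ N = poly Q z" "p \<in> borel_measurable borel"
  shows "complex_of_real (\<integral>z. p z \<partial>M) = (\<Sum>i\<le>degree Q. coeff Q i * (\<integral>z. z powi (int i - int N) \<partial>M))"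
proof -
  have [measurable]: "(\<lambda>z::complex. z powi n) \<in> borel_measurable M" for n
    unfolding measurable_cong_sets[OF assms(2) refl] power_int_def by measurable
  have [measurable]: "p \<in> borel_measurable M"
    unfolding measurable_cong_sets[OF assms(2) refl] by (rule p)
  have "complex_of_real (\<integral>z. p z \<partial>M) = (\<integral>z. complex_of_real (p z) \<partial>M)"
    by simp
  also have "\<dots> = (\<integral>z. (\<Sum>i\<le>degree Q. coeff Q i * z powi (int i - int N)) \<partial>M)"
  proof (rule integral_cong_AE)
    show "AE z in M. complex_of_real (p z) = (\<Sum>i\<le>degree Q. coeff Q i * z powi (int i - int N))"
      using assms(3)
    proof eventually_elim
      case (elim z)
      then have "z \<noteq> 0"
        by auto
      have "(\<Sum>i\<le>degree Q. coeff Q i * z powi (int i - int N)) = poly Q z / z ^ N"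
        using \<open>z \<noteq> 0\<close> by (simp add: poly_altdef sum_divide_distrib power_int_diff)
      also have "\<dots> = of_real (p z)"
        using p(1)[OF elim] \<open>z \<noteq> 0\<close> by (simp add: field_simps)
      finally show ?case
        by simp
    qed
  qed measurable
  also have "\<dots> = (\<Sum>i\<le>degree Q. coeff Q i * (\<integral>z. z powi (int i - int N) \<partial>M))"
    using integrable_powi_circle[OF assms(1-3)] by simp
  finally show ?thesis .
qed

text \<open>Moments of negative order are conjugates of those of positive order. Stone-Weierstrass
  passes from moments to continuous functions, these decrease to indicators of closed sets, and
  closed sets are an intersection-stable generator of the Borel sets.\<close>

lemma circle_measure_eqI:
  fixes M N :: "complex measure"
  assumes M: "finite_measure M" "sets M = sets borel" "AE z in M. cmod z = 1"
    and N: "finite_measure N" "sets N = sets borel" "AE z in N. cmod z = 1"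
    and moments: "\<And>n::nat. (\<integral>z. z ^ n \<partial>M) = (\<integral>z. z ^ n \<partial>N)"
  shows "M = N"
proof -
  interpret M: finite_measure M by fact
  interpret N: finite_measure N by fact
  have cnj_powi: "cnj (z powi (- int n)) = z ^ n" if "cmod z = 1" for z n
  proof -
    have "z * cnj z = 1"
      using that by (simp add: complex_norm_square[symmetric])
    then have "inverse (cnj z) = z"
      by (metis inverse_unique mult.commute)
    then show ?thesis
      by (simp add: power_int_minus flip: power_inverse)
  qed
  have neg: "(\<integral>z. z powi (- int n) \<partial>K) = cnj (\<integral>z. z ^ n \<partial>K)"
    if "sets K = sets borel" "AE z in K. cmod z = 1" for n and K :: "complex measure"
  proof -
    have [measurable]: "(\<lambda>z::complex. z powi n) \<in> borel_measurable K" for n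
      unfolding measurable_cong_sets[OF that(1) refl] power_int_def by measurable
    have [measurable]: "(\<lambda>z::complex. z ^ n) \<in> borel_measurable K" for n
      unfolding measurable_cong_sets[OF that(1) refl] by measurable
    have "(\<integral>z. z powi (- int n) \<partial>K) = cnj (\<integral>z. cnj (z powi (- int n)) \<partial>K)"
      using Bochner_Integration.integral_cnj[of K "\<lambda>z. cnj (z powi (- int n))"] by (simp only: complex_cnj_cnj)
    also have "(\<integral>z. cnj (z powi (- int n)) \<partial>K) = (\<integral>z. z ^ n \<partial>K)"
    proof (rule integral_cong_AE)
      show "AE z in K. cnj (z powi (- int n)) = z ^ n"
        using that(2) by eventually_elim (rule cnj_powi)
    qed measurable
    finally show ?thesis .
  qed
  have powi: "(\<integral>z. z powi n \<partial>M) = (\<integral>z. z powi n \<partial>N)" for n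
  proof (cases "n \<ge> 0")
    case True
    then show ?thesis
      using moments[of "nat n"] by (simp add: power_int_def)
  next
    case False
    then show ?thesis
      using neg[OF M(2,3), of "nat (-n)"] neg[OF N(2,3), of "nat (-n)"] moments by simp
  qed
  have poly_eq: "(\<integral>z. p z \<partial>M) = (\<integral>z. p z \<partial>N)" if p: "real_polynomial_function p" for p :: "complex \<Rightarrow> real"
  proof -
    obtain Q n where "\<And>z. cmod z = 1 \<Longrightarrow> of_real (p z) * z ^ n = poly Q z"
      using real_polynomial_circle[OF p] by blast
    moreover have "p \<in> borel_measurable borel"
      using p by (intro borel_measurable_continuous_onI continuous_on_polymonial_function)
        (simp add: real_polynomial_function_eq)
    ultimately have "complex_of_real (\<integral>z. p z \<partial>M) = complex_of_real (\<integral>z. p z \<partial>N)"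
      using integral_poly_powi_circle[OF M, of p n Q] integral_poly_powi_circle[OF N, of p n Q] powi
      by simp
    then show ?thesis
      by simp
  qed
  have cont_eq: "(\<integral>z. g z \<partial>M) = (\<integral>z. g z \<partial>N)" if g: "continuous_on UNIV g" for g :: "complex \<Rightarrow> real"
  proof -
    \<comment> \<open>\<open>p\<close> approximates \<open>g\<close> on the circle only, and
      continuous functions are bounded there; this is enough because \<open>K\<close> is
      concentrated on the circle.\<close>
    have close: "\<bar>(\<integral>z. g z \<partial>K) - (\<integral>z. p z \<partial>K)\<bar> \<le> e * measure K UNIV"
      if K: "finite_measure K" "sets K = sets borel" "AE z in K. cmod z = 1"
        and p: "continuous_on UNIV p" "\<And>z. z \<in> sphere 0 1 \<Longrightarrow> \<bar>g z - p z\<bar> < e"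
      for K :: "complex measure" and p e
    proof -
      have "integrable K f" if f: "continuous_on UNIV f" for f :: "complex \<Rightarrow> real"
      proof -
        have "compact (f ` sphere 0 1)"
          using f by (intro compact_continuous_image) (auto intro: continuous_on_subset)
        then have "bounded (f ` sphere 0 1)"
          by (rule compact_imp_bounded)
        then obtain C where "\<And>z. z \<in> sphere 0 1 \<Longrightarrow> \<bar>f z\<bar> \<le> C"
          unfolding bounded_iff by (metis image_eqI real_norm_def)
        moreover have "f \<in> borel_measurable K"
          unfolding measurable_cong_sets[OF K(2) refl] using f by (rule borel_measurable_continuous_onI)
        ultimately show ?thesis
          using K(3) by (intro integrable_bounded_AE[OF K(1), of _ C]) auto
      qed
      then have int: "integrable K g" "integrable K p"
        using g p by auto
      then have "\<bar>(\<integral>z. g z \<partial>K) - (\<integral>z. p z \<partial>K)\<bar> = \<bar>\<integral>z. g z - p z \<partial>K\<bar>"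
        by simp
      also have "\<dots> \<le> (\<integral>z. \<bar>g z - p z\<bar> \<partial>K)"
        by (rule integral_abs_bound)
      also have "\<dots> \<le> (\<integral>z. e \<partial>K)"
        using K(3) p(2) int by (intro integral_mono_AE finite_measure.integrable_const[OF K(1)])
          (auto simp: less_imp_le elim!: eventually_mono)
      also have "\<dots> = e * measure K UNIV"
        using sets_eq_imp_space_eq[OF K(2)] by simp
      finally show ?thesis .
    qed
    have "\<bar>(\<integral>z. g z \<partial>M) - (\<integral>z. g z \<partial>N)\<bar> \<le> 0 + e" if "e > 0" for e
    proof -
      \<comment> \<open>The summand 1 keeps the denominator positive when both measures are
        zero.\<close>
      define d where "d = e / (measure M UNIV + measure N UNIV + 1)"
      have mn: "measure M UNIV + measure N UNIV \<ge> 0"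
        by simp
      then have "d > 0"
        using \<open>e > 0\<close> by (simp add: d_def add_nonneg_pos)
      then obtain p where p: "real_polynomial_function p" "\<And>z. z \<in> sphere 0 1 \<Longrightarrow> \<bar>g z - p z\<bar> < d"
        using Stone_Weierstrass_real_polynomial_function[of "sphere 0 1" g d] g
        by (metis compact_sphere continuous_on_subset subset_UNIV)
      have "continuous_on UNIV p"
        using p(1) by (simp add: real_polynomial_function_eq continuous_on_polymonial_function)
      then have "\<bar>(\<integral>z. g z \<partial>M) - (\<integral>z. g z \<partial>N)\<bar> \<le> d * measure M UNIV + d * measure N UNIV"
        using close[OF M _ p(2)] close[OF N _ p(2)] poly_eq[OF p(1)] by force
      also have "\<dots> \<le> e"
      proof -
        have "measure M UNIV + measure N UNIV + 1 \<noteq> 0"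
          using mn by linarith
        then have "d * (measure M UNIV + measure N UNIV + 1) = e"
          by (simp add: d_def)
        then show ?thesis
          using \<open>d > 0\<close> by (simp add: algebra_simps)
      qed
      finally show ?thesis
        by simp
    qed
    then have "\<bar>(\<integral>z. g z \<partial>M) - (\<integral>z. g z \<partial>N)\<bar> \<le> 0"
      by (rule field_le_epsilon)
    then show ?thesis
      by simp
  qed
  \<comment> \<open>The empty set is treated apart: \<open>infdist z {}\<close> is 0 by convention,
    so the functions \<open>g n\<close> would be constantly 1 instead of tending to the
    indicator.\<close>
  have closed_eq: "emeasure M C = emeasure N C" if C: "closed C" for C
  proof (cases "C = {}")
    case False
    define g where "g n z = max 0 (1 - real n * infdist z C)" for n z
    have g_cont: "continuous_on UNIV (g n)" for n
      unfolding g_def by (intro continuous_intros)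
    have g_bound: "0 \<le> g n z" "g n z \<le> 1" for n z
      by (auto simp: g_def infdist_nonneg)
    have g_lim: "(\<lambda>n. g n z) \<longlonglongrightarrow> indicator C z" for z
    proof (cases "z \<in> C")
      case True
      then show ?thesis
        by (simp add: g_def)
    next
      case z: False
      then have pos: "infdist z C > 0"
        using C False by (metis infdist_pos_not_in_closed)
      obtain n0 :: nat where n0: "real n0 * infdist z C > 1"
        using reals_Archimedean3[OF pos] by blast
      have "eventually (\<lambda>n. g n z = 0) sequentially"
        using eventually_ge_at_top[of n0]
      proof eventually_elim
        case (elim n)
        then have "real n0 * infdist z C \<le> real n * infdist z C"
          using pos by (intro mult_right_mono) auto
        then show ?case
          using n0 by (simp add: g_def)
      qed
      then show ?thesis
        using z by (auto intro: tendsto_eventually)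
    qed
    have lim: "(\<lambda>n. \<integral>z. g n z \<partial>K) \<longlonglongrightarrow> measure K C"
      if K: "finite_measure K" "sets K = sets borel" for K :: "complex measure"
    proof -
      have "(\<lambda>n. \<integral>z. g n z \<partial>K) \<longlonglongrightarrow> (\<integral>z. indicator C z \<partial>K)"
      proof (rule integral_dominated_convergence)
        show "integrable K (\<lambda>z. 1::real)"
          by (rule finite_measure.integrable_const[OF K(1)])
        show "g n \<in> borel_measurable K" for n
          unfolding measurable_cong_sets[OF K(2) refl]
          by (rule borel_measurable_continuous_onI[OF g_cont])
        show "(indicator C :: complex \<Rightarrow> real) \<in> borel_measurable K"
          unfolding measurable_cong_sets[OF K(2) refl]
          by (rule borel_measurable_indicator[OF borel_closed[OF C]])
      qed (use g_lim g_bound in auto)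
      then show ?thesis
        using K C by simp
    qed
    have "measure M C = measure N C"
      using lim[OF M(1,2)] lim[OF N(1,2)] cont_eq[OF g_cont] LIMSEQ_unique by simp
    then show ?thesis
      by (simp add: M.emeasure_eq_measure N.emeasure_eq_measure)
  qed simp
  show ?thesis
  proof (rule measure_eqI_generator_eq[where E = "Collect closed" and \<Omega> = UNIV and A = "\<lambda>_. UNIV"])
    show "sets M = sigma_sets UNIV (Collect closed)" "sets N = sigma_sets UNIV (Collect closed)"
      unfolding M(2) N(2) borel_eq_closed by simp_all
  qed (auto simp: Int_stable_def closed_eq)
qed


subsection \<open>The quotient L2\<close>

lemma square_integrable_rep [simp]: "square_integrable (rep_L2 f)"
  using Quotient_rep_reflp[OF Quotient_L2, of f] by simp

lemma class_rep [simp]: "class_L2 (rep_L2 f) = f"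
  by (rule Quotient_abs_rep[OF Quotient_L2])

lemma rep_class: "square_integrable g \<Longrightarrow> AE z in circle_measure. rep_L2 (class_L2 g) z = g z"
  using Quotient_rep_abs[OF Quotient_L2, of g] by simp

lemma class_L2_eqI:
  "square_integrable f \<Longrightarrow> square_integrable g \<Longrightarrow> AE z in circle_measure. f z = g z \<Longrightarrow> class_L2 f = class_L2 g"
  using Quotient_rel_abs[OF Quotient_L2, of f g] by simp

lemma class_L2_eqD:
  "square_integrable f \<Longrightarrow> square_integrable g \<Longrightarrow> class_L2 f = class_L2 g \<Longrightarrow> AE z in circle_measure. f z = g z"
  using Quotient_rel[OF Quotient_L2, of f g] by simp

lemma rep_measurable [measurable]: "rep_L2 f \<in> borel_measurable borel"
  using square_integrable_rep[of f] unfolding square_integrable_def by blast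

lemma cinner_class:
  assumes "square_integrable f" "square_integrable g"
  shows "cinner (class_L2 f) (class_L2 g) = (\<integral>z. f z * cnj (g z) \<partial>circle_measure)"
  using assms by (simp add: cinner_L2.abs_eq)

lemma plus_class:
  assumes "square_integrable f" "square_integrable g"
  shows "class_L2 f + class_L2 g = class_L2 (\<lambda>z. f z + g z)"
  using assms by (simp add: plus_L2.abs_eq)

lemma scaleC_class:
  assumes "square_integrable f"
  shows "c *\<^sub>C class_L2 f = class_L2 (\<lambda>z. c * f z)"
  using assms by (simp add: scaleC_L2.abs_eq)

lemma minus_class:
  assumes "square_integrable f" "square_integrable g"
  shows "class_L2 f - class_L2 g = class_L2 (\<lambda>z. f z - g z)"
  using plus_class[OF assms(1) square_integrable_scale[OF assms(2), of "-1"]] scaleC_class[OF assms(2), of "-1"]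
  by (simp flip: add_uminus_conv_diff)

lemma square_integrable_diff:
  "square_integrable f \<Longrightarrow> square_integrable g \<Longrightarrow> square_integrable (\<lambda>z. f z - g z)"
  using square_integrable_add[OF _ square_integrable_scale[of g "-1"]] by simp

lemma zero_class: "0 = class_L2 (\<lambda>z. 0)"
  by (simp add: zero_L2.abs_eq)

section \<open>Norms as integrals and the Riesz-Fischer theorem\<close>

lemma norm_class_sq:
  assumes "square_integrable f"
  shows "(norm (class_L2 f))\<^sup>2 = (\<integral>z. (cmod (f z))\<^sup>2 \<partial>circle_measure)"
proof -
  have "complex_of_real ((norm (class_L2 f))\<^sup>2) = (\<integral>z. complex_of_real ((cmod (f z))\<^sup>2) \<partial>circle_measure)"
    unfolding cinner_self[symmetric] complex_norm_square using assms by (rule cinner_class[OF _ assms])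
  then show ?thesis
    by (simp only: integral_complex_of_real of_real_eq_iff)
qed

lemma nn_integral_norm_class:
  assumes "square_integrable f"
  shows "(\<integral>\<^sup>+z. ennreal ((cmod (f z))\<^sup>2) \<partial>circle_measure) = ennreal ((norm (class_L2 f))\<^sup>2)"
  unfolding norm_class_sq[OF assms]
  using assms by (intro nn_integral_eq_integral) (auto simp: square_integrable_def)

lemma square_integrableI_nn:
  assumes "f \<in> borel_measurable borel" "(\<integral>\<^sup>+z. ennreal ((cmod (f z))\<^sup>2) \<partial>circle_measure) < \<infinity>"
  shows "square_integrable f"
proof -
  have [measurable]: "f \<in> borel_measurable borel"
    by fact
  show ?thesis
    using assms by (simp add: square_integrable_def integrable_iff_bounded)
qed

lemma norm_class_leI:
  assumes "f \<in> borel_measurable borel" "(\<integral>\<^sup>+z. ennreal ((cmod (f z))\<^sup>2) \<partial>circle_measure) \<le> ennreal (c\<^sup>2)" "0 \<le> c"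
  shows "square_integrable f" "norm (class_L2 f) \<le> c"
proof -
  show f: "square_integrable f"
    using assms by (intro square_integrableI_nn) (auto intro: le_less_trans)
  then have "(norm (class_L2 f))\<^sup>2 \<le> c\<^sup>2"
    using assms(2) by (simp add: nn_integral_norm_class)
  then show "norm (class_L2 f) \<le> c"
    using assms(3) by (rule power2_le_imp_le)
qed

text \<open>Geometrically small increments have a finite sum of integrals, so they are summable at
  almost every point and the representatives converge there. Fatou's lemma turns this into
  convergence in norm.\<close>

lemma L2_fast_Cauchy_convergent:
  fixes X :: "nat \<Rightarrow> L2"
  assumes fast: "\<And>n. norm (X (Suc n) - X n) \<le> (1/2)^n"
  shows "\<exists>L. X \<longlonglongrightarrow> L"
proof -
  define f where "f n = rep_L2 (X n)" for n
  have sq: "square_integrable (f n)" for n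
    by (simp add: f_def)
  have [measurable]: "f n \<in> borel_measurable borel" for n
    unfolding f_def by measurable
  have X: "X n = class_L2 (f n)" for n
    by (simp add: f_def)
  have dist: "norm (X m - X n) \<le> 2 * (1/2)^n" if "m \<ge> n" for m n
  proof -
    \<comment> \<open>The right-hand side is the geometric sum of (1/2)^i over n \<le> i <
      m.\<close>
    have "norm (X m - X n) \<le> 2 * (1/2)^n - 2 * (1/2)^m"
      using that
    proof (induction m rule: dec_induct)
      case (step m)
      have "norm (X (Suc m) - X n) \<le> norm (X (Suc m) - X m) + norm (X m - X n)"
        by (rule norm_triangle_sub[of "X (Suc m) - X n" "X m - X n", simplified, THEN order_trans]) (simp add: add.commute)
      also have "\<dots> \<le> (1/2)^m + (2 * (1/2)^n - 2 * (1/2)^m)"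
        by (intro add_mono fast step)
      finally show ?case
        by simp
    qed simp
    also have "\<dots> \<le> 2 * (1/2)^n"
      by simp
    finally show ?thesis .
  qed
  have int1: "(\<integral>\<^sup>+z. ennreal (cmod (f (Suc n) z - f n z)) \<partial>circle_measure) \<le> ennreal ((1/2)^n)" for n
  proof -
    \<comment> \<open>The inequality x \<le> x^2 / (2 e) + e / 2, weighted by the size e of the
      increment, passes from the second moment to the first: each half contributes at most e /
      2.\<close>
    define e :: real where "e = (1/2)^n"
    have e: "e > 0"
      by (simp add: e_def)
    have "(\<integral>\<^sup>+z. ennreal (cmod (f (Suc n) z - f n z)) \<partial>circle_measure)
        \<le> (\<integral>\<^sup>+z. ennreal (1 / (2 * e)) * ennreal ((cmod (f (Suc n) z - f n z))\<^sup>2) + ennreal (e / 2) \<partial>circle_measure)"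
    proof (rule nn_integral_mono)
      fix z
      have "x \<le> 1 / (2 * e) * x\<^sup>2 + e / 2" for x
        using e sum_squares_bound[of x e] by (simp add: field_simps power2_eq_square)
      then show "ennreal (cmod (f (Suc n) z - f n z)) \<le>
          ennreal (1 / (2 * e)) * ennreal ((cmod (f (Suc n) z - f n z))\<^sup>2) + ennreal (e / 2)"
        using e by (simp flip: ennreal_mult' ennreal_plus)
    qed
    also have "\<dots> = ennreal (1 / (2 * e)) * ennreal ((norm (X (Suc n) - X n))\<^sup>2) + ennreal (e / 2)"
      using sq by (simp add: nn_integral_add nn_integral_cmult X minus_class square_integrable_diff
          prob_circle nn_integral_norm_class)
    also have "\<dots> \<le> ennreal (1 / (2 * e)) * ennreal (e\<^sup>2) + ennreal (e / 2)"
      using fast[of n] by (intro add_mono mult_left_mono ennreal_leI power_mono) (auto simp: e_def)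
    also have "\<dots> = ennreal e"
      using e by (simp flip: ennreal_mult' ennreal_plus add: power2_eq_square)
    finally show ?thesis
      by (simp add: e_def)
  qed
  have "(\<integral>\<^sup>+z. (\<Sum>n. ennreal (cmod (f (Suc n) z - f n z))) \<partial>circle_measure) =
      (\<Sum>n. \<integral>\<^sup>+z. ennreal (cmod (f (Suc n) z - f n z)) \<partial>circle_measure)"
    by (rule nn_integral_suminf) measurable
  also have "\<dots> \<le> (\<Sum>n. ennreal ((1/2)^n))"
    by (intro suminf_le int1) auto
  also have "\<dots> = ennreal (\<Sum>n. (1/2)^n)"
    by (intro suminf_ennreal2) (auto intro: summable_geometric)
  finally have "(\<integral>\<^sup>+z. (\<Sum>n. ennreal (cmod (f (Suc n) z - f n z))) \<partial>circle_measure) \<noteq> \<infinity>"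
    by (auto simp: top_unique)
  then have "AE z in circle_measure. (\<Sum>n. ennreal (cmod (f (Suc n) z - f n z))) \<noteq> \<infinity>"
    by (intro nn_integral_PInf_AE) measurable
  then have conv: "AE z in circle_measure. convergent (\<lambda>n. f n z)"
  proof eventually_elim
    case (elim z)
    have "summable (\<lambda>n. cmod (f (Suc n) z - f n z))"
      using elim by (intro summable_suminf_not_top) auto
    then have "summable (\<lambda>n. f (Suc n) z - f n z)"
      by (rule summable_norm_cancel)
    then have "convergent (\<lambda>n. \<Sum>i<n. f (Suc i) z - f i z)"
      by (simp add: summable_iff_convergent)
    then have "convergent (\<lambda>n. f n z - f 0 z)"
      using sum_lessThan_telescope[of "\<lambda>i. f i z"] by (simp only:)
    then show ?case
      using convergent_diff_const_right_iff by blast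
  qed
  define g where "g z = lim (\<lambda>n. f n z)" for z
  have [measurable]: "g \<in> borel_measurable borel"
    unfolding g_def by measurable
  have lim: "AE z in circle_measure. (\<lambda>n. f n z) \<longlonglongrightarrow> g z"
    using conv unfolding g_def by eventually_elim (simp add: convergent_LIMSEQ_iff)
  have fatou: "(\<integral>\<^sup>+z. ennreal ((cmod (g z - f n z))\<^sup>2) \<partial>circle_measure) \<le> ennreal ((2 * (1/2)^n)\<^sup>2)" for n
  proof -
    have "(\<integral>\<^sup>+z. ennreal ((cmod (g z - f n z))\<^sup>2) \<partial>circle_measure) =
        (\<integral>\<^sup>+z. liminf (\<lambda>m. ennreal ((cmod (f m z - f n z))\<^sup>2)) \<partial>circle_measure)"
    proof (rule nn_integral_cong_AE)
      show "AE z in circle_measure. ennreal ((cmod (g z - f n z))\<^sup>2) = liminf (\<lambda>m. ennreal ((cmod (f m z - f n z))\<^sup>2))"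
        using lim
      proof eventually_elim
        case (elim z)
        have "(\<lambda>m. ennreal ((cmod (f m z - f n z))\<^sup>2)) \<longlonglongrightarrow> ennreal ((cmod (g z - f n z))\<^sup>2)"
          by (intro tendsto_intros elim)
        then show ?case
          by (metis lim_imp_Liminf sequentially_bot)
      qed
    qed
    also have "\<dots> \<le> liminf (\<lambda>m. \<integral>\<^sup>+z. ennreal ((cmod (f m z - f n z))\<^sup>2) \<partial>circle_measure)"
      by (intro nn_integral_liminf) measurable
    also have "\<dots> = liminf (\<lambda>m. ennreal ((norm (X m - X n))\<^sup>2))"
      using sq by (simp add: X minus_class nn_integral_norm_class square_integrable_diff)
    also have "\<dots> \<le> ennreal ((2 * (1/2)^n)\<^sup>2)"
    proof (rule Liminf_le)
      show "\<forall>\<^sub>F m in sequentially. ennreal ((norm (X m - X n))\<^sup>2) \<le> ennreal ((2 * (1/2)^n)\<^sup>2)"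
        using eventually_ge_at_top[of n] by eventually_elim (intro ennreal_leI power_mono dist norm_ge_zero)
    qed simp
    finally show ?thesis .
  qed
  have gf: "square_integrable (\<lambda>z. g z - f n z)" "norm (class_L2 (\<lambda>z. g z - f n z)) \<le> 2 * (1/2)^n" for n
    by (rule norm_class_leI[OF _ fatou]; simp)+
  have g: "square_integrable g"
    using square_integrable_add[OF gf(1)[of 0] sq[of 0]] by simp
  have le: "norm (X n - class_L2 g) \<le> 2 * (1/2)^n" for n
    using gf(2)[of n] minus_class[OF g sq[of n]] by (simp add: X norm_minus_commute)
  have "(\<lambda>n. 2 * (1/2::real)^n) \<longlonglongrightarrow> 0"
    using tendsto_mult_right_zero[OF LIMSEQ_realpow_zero[of "1/2::real"], of 2] by simp
  then have "(\<lambda>n. X n - class_L2 g) \<longlonglongrightarrow> 0"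
    by (rule Lim_null_comparison[OF always_eventually[OF allI[OF le]]])
  then have "X \<longlonglongrightarrow> class_L2 g"
    by (rule LIM_zero_cancel)
  then show ?thesis
    by blast
qed

lemma complete_L2: "complete (UNIV :: L2 set)"
proof (rule completeI)
  fix X :: "nat \<Rightarrow> L2" assume "Cauchy X"
  have "\<exists>N. \<forall>m\<ge>N. \<forall>n\<ge>N. dist (X m) (X n) < (1/2)^k" for k
    using \<open>Cauchy X\<close> by (intro metric_CauchyD) auto
  then obtain N where N: "\<And>k m n. m \<ge> N k \<Longrightarrow> n \<ge> N k \<Longrightarrow> dist (X m) (X n) < (1/2)^k"
    by metis
  \<comment> \<open>The partial sums dominate every \<open>N k\<close>, and the summand
    \<open>k\<close> makes \<open>r\<close> strictly increasing.\<close>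
  define r where "r k = (\<Sum>i\<le>k. N i) + k" for k
  have "strict_mono r"
    by (rule strict_monoI_Suc) (simp add: r_def)
  have r: "r k \<ge> N k" for k
    unfolding r_def by (rule trans_le_add1) (rule member_le_sum, auto)
  have "norm (X (r (Suc k)) - X (r k)) \<le> (1/2)^k" for k
    using N[of k "r (Suc k)" "r k"] r[of k] strict_mono_leD[OF \<open>strict_mono r\<close>, of k "Suc k"]
    by (simp add: dist_norm)
  then obtain L where "(X \<circ> r) \<longlonglongrightarrow> L"
    using L2_fast_Cauchy_convergent[of "X \<circ> r"] by auto
  then show "\<exists>l\<in>UNIV. X \<longlonglongrightarrow> l"
    using Cauchy_converges_subseq[OF \<open>Cauchy X\<close> \<open>strict_mono r\<close>] by blast
qed

lemma complete_L2_closed: "closed S \<Longrightarrow> complete (S :: L2 set)"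
  using complete_closed_subset[OF _ subset_UNIV complete_L2] by blast

section \<open>Multiplication operators and the Hardy space\<close>

text \<open>The domain \<open>D\<close> is kept general for maps that are known to be linear only on
  a subspace, such as h \<mapsto> \<open>V h f\<close> on the model space of \<open>B\<close> and e
  \<mapsto> \<open>\<tau> e f\<close> on \<open>E\<close>.\<close>

lemma closure_cspan_image_on:
  fixes L :: "'a::complex_inner \<Rightarrow> 'b::complex_inner"
  assumes D: "csubspace D" "closed D" and L: "clinear_on D L" "\<And>x. x \<in> D \<Longrightarrow> norm (L x) \<le> C * norm x"
    and S: "csubspace S" "closed S" and G: "G \<subseteq> D" "\<And>g. g \<in> G \<Longrightarrow> L g \<in> S" and x: "x \<in> closure (cspan G)"
  shows "L x \<in> S"
proof -
  have "closure (cspan G) \<subseteq> D \<inter> L -` S"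
  proof (rule closure_cspan_minimal)
    show "G \<subseteq> D \<inter> L -` S"
      using G by blast
    show "csubspace (D \<inter> L -` S)"
      using S(1) D(1) L(1) by (auto simp: csubspace_def clinear_on_def clinear_on_0)
    show "closed (D \<inter> L -` S)"
      using continuous_on_clinear[OF D(1) L] by (rule continuous_closed_preimage[OF _ D(2) S(2)])
  qed
  then show ?thesis
    using x by blast
qed

lemma closure_cspan_image:
  fixes L :: "'a::complex_inner \<Rightarrow> 'b::complex_inner"
  assumes L: "bounded_linear L" "\<And>c x. L (c *\<^sub>C x) = c *\<^sub>C L x"
    and S: "csubspace S" "closed S" and G: "\<And>g. g \<in> G \<Longrightarrow> L g \<in> S" and x: "x \<in> closure (cspan G)"
  shows "L x \<in> S"
proof -
  interpret L: bounded_linear L by fact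
  obtain C where C: "\<And>x. norm (L x) \<le> norm x * C"
    using L.bounded by blast
  show ?thesis
  proof (rule closure_cspan_image_on[where D = UNIV and C = C, OF _ _ _ _ S _ G x])
    show "norm (L x) \<le> C * norm x" for x
      using C[of x] by (simp add: mult.commute)
  qed (simp_all add: csubspace_def clinear_on_def L.add L(2))
qed

section \<open>Bounded symbols and their multiplication operators\<close>

definition bounded_symbol :: "(complex \<Rightarrow> complex) \<Rightarrow> bool" where
  "bounded_symbol \<psi> \<longleftrightarrow> \<psi> \<in> borel_measurable borel \<and> (\<exists>C. AE z in circle_measure. cmod (\<psi> z) \<le> C)"

lemma bounded_symbolE:
  assumes "bounded_symbol \<psi>"
  obtains C where "\<psi> \<in> borel_measurable borel" "0 \<le> C" "AE z in circle_measure. cmod (\<psi> z) \<le> C"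
proof -
  obtain C where C: "\<psi> \<in> borel_measurable borel" "AE z in circle_measure. cmod (\<psi> z) \<le> C"
    using assms unfolding bounded_symbol_def by blast
  moreover have "AE z in circle_measure. cmod (\<psi> z) \<le> \<bar>C\<bar>"
    using C(2) by eventually_elim simp
  ultimately show ?thesis
    using that[of "\<bar>C\<bar>"] by simp
qed

lemma bounded_symbol_measurable: "bounded_symbol \<psi> \<Longrightarrow> \<psi> \<in> borel_measurable borel"
  by (simp add: bounded_symbol_def)

lemma square_integrable_bounded_mult:
  assumes "bounded_symbol \<psi>" "square_integrable f"
  shows "square_integrable (\<lambda>z. \<psi> z * f z)"
proof -
  obtain C where C: "\<psi> \<in> borel_measurable borel" "0 \<le> C" "AE z in circle_measure. cmod (\<psi> z) \<le> C"
    using assms(1) by (rule bounded_symbolE)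
  have [measurable]: "\<psi> \<in> borel_measurable borel" "f \<in> borel_measurable borel"
    using C assms(2) by (auto simp: square_integrable_def)
  have "integrable circle_measure (\<lambda>z. (cmod (\<psi> z * f z))\<^sup>2)"
  proof (rule Bochner_Integration.integrable_bound)
    show "integrable circle_measure (\<lambda>z. C\<^sup>2 * (cmod (f z))\<^sup>2)"
      using assms(2) by (simp add: square_integrable_def)
    show "AE z in circle_measure. norm ((cmod (\<psi> z * f z))\<^sup>2) \<le> norm (C\<^sup>2 * (cmod (f z))\<^sup>2)"
      using C(3)
    proof eventually_elim
      case (elim z)
      then show ?case
        by (simp add: norm_mult power_mult_distrib mult_right_mono power_mono)
    qed
  qed simp
  then show ?thesis
    by (simp add: square_integrable_def)
qed

lemma mult_L2_class:
  assumes "bounded_symbol \<psi>" "square_integrable f"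
  shows "mult_L2 \<psi> (class_L2 f) = class_L2 (\<lambda>z. \<psi> z * f z)"
  unfolding mult_L2_def
proof (rule class_L2_eqI)
  show "AE z in circle_measure. \<psi> z * rep_L2 (class_L2 f) z = \<psi> z * f z"
    using rep_class[OF assms(2)] by eventually_elim simp
qed (use assms in \<open>auto intro: square_integrable_bounded_mult\<close>)

lemma class_induct: "(\<And>g. square_integrable g \<Longrightarrow> P (class_L2 g)) \<Longrightarrow> P f"
  by (metis class_rep square_integrable_rep)

lemma mult_L2_add: "bounded_symbol \<psi> \<Longrightarrow> mult_L2 \<psi> (f + g) = mult_L2 \<psi> f + mult_L2 \<psi> g"
  by (induct f rule: class_induct, induct g rule: class_induct)
    (simp add: plus_class mult_L2_class square_integrable_bounded_mult square_integrable_add distrib_left)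

lemma mult_L2_scaleC: "bounded_symbol \<psi> \<Longrightarrow> mult_L2 \<psi> (c *\<^sub>C f) = c *\<^sub>C mult_L2 \<psi> f"
  by (induct f rule: class_induct)
    (simp add: scaleC_class mult_L2_class square_integrable_bounded_mult square_integrable_scale mult.left_commute)

lemma bounded_symbol_mult:
  assumes "bounded_symbol \<psi>" "bounded_symbol \<xi>"
  shows "bounded_symbol (\<lambda>z. \<psi> z * \<xi> z)"
proof -
  obtain C where C: "\<psi> \<in> borel_measurable borel" "0 \<le> C" "AE z in circle_measure. cmod (\<psi> z) \<le> C"
    using assms(1) by (rule bounded_symbolE)
  obtain D where D: "\<xi> \<in> borel_measurable borel" "0 \<le> D" "AE z in circle_measure. cmod (\<xi> z) \<le> D"
    using assms(2) by (rule bounded_symbolE)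
  have "AE z in circle_measure. cmod (\<psi> z * \<xi> z) \<le> C * D"
    using C(3) D(3) by eventually_elim (simp add: norm_mult mult_mono C D)
  then show ?thesis
    using C(1) D(1) unfolding bounded_symbol_def by auto
qed

lemma bounded_symbol_add:
  assumes "bounded_symbol \<psi>" "bounded_symbol \<xi>"
  shows "bounded_symbol (\<lambda>z. \<psi> z + \<xi> z)"
proof -
  obtain C where C: "\<psi> \<in> borel_measurable borel" "0 \<le> C" "AE z in circle_measure. cmod (\<psi> z) \<le> C"
    using assms(1) by (rule bounded_symbolE)
  obtain D where D: "\<xi> \<in> borel_measurable borel" "0 \<le> D" "AE z in circle_measure. cmod (\<xi> z) \<le> D"
    using assms(2) by (rule bounded_symbolE)
  have "AE z in circle_measure. cmod (\<psi> z + \<xi> z) \<le> C + D"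
    using C(3) D(3) by eventually_elim (meson add_mono norm_triangle_ineq order_trans)
  then show ?thesis
    using C(1) D(1) unfolding bounded_symbol_def by auto
qed

lemma bounded_symbol_const [simp]: "bounded_symbol (\<lambda>z. c)"
  unfolding bounded_symbol_def by auto

lemma bounded_symbol_cnj: "bounded_symbol \<psi> \<Longrightarrow> bounded_symbol (\<lambda>z. cnj (\<psi> z))"
  unfolding bounded_symbol_def by (auto intro: measurable_compose[OF _ cnj_borel])

lemma bounded_symbol_unimodular:
  "\<psi> \<in> borel_measurable borel \<Longrightarrow> AE z in circle_measure. cmod (\<psi> z) = 1 \<Longrightarrow> bounded_symbol \<psi>"
  unfolding bounded_symbol_def by (auto intro!: exI[of _ 1] elim: eventually_mono)

lemma powi_measurable [measurable]: "(\<lambda>z::complex. z powi n) \<in> borel_measurable borel"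
  unfolding power_int_def by measurable

lemma bounded_symbol_powi [simp]: "bounded_symbol (\<lambda>z. z powi n)"
  by (rule bounded_symbol_unimodular)
    (use AE_circle in \<open>auto simp: norm_power_int elim: eventually_mono\<close>)

lemma bounded_symbol_power [simp]: "bounded_symbol (\<lambda>z. z ^ n)"
  using bounded_symbol_powi[of "int n"] by simp

lemma square_integrable_const [simp]: "square_integrable (\<lambda>z. c)"
  by (simp add: square_integrable_def)

lemma bounded_symbol_square_integrable: "bounded_symbol \<psi> \<Longrightarrow> square_integrable \<psi>"
  using square_integrable_bounded_mult[of \<psi> "\<lambda>z. 1"] by simp

lemma mult_L2_mult_L2:
  assumes "bounded_symbol \<psi>" "bounded_symbol \<xi>"
  shows "mult_L2 \<psi> (mult_L2 \<xi> f) = mult_L2 (\<lambda>z. \<psi> z * \<xi> z) f"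
  using assms by (induct f rule: class_induct)
    (simp add: mult_L2_class square_integrable_bounded_mult bounded_symbol_mult mult.assoc)

lemma mult_L2_cong:
  assumes "bounded_symbol \<psi>" "bounded_symbol \<xi>" "AE z in circle_measure. \<psi> z = \<xi> z"
  shows "mult_L2 \<psi> f = mult_L2 \<xi> f"
  unfolding mult_L2_def using assms
  by (intro class_L2_eqI square_integrable_bounded_mult) (auto elim: eventually_mono)

lemma mult_L2_one: "AE z in circle_measure. \<psi> z = 1 \<Longrightarrow> bounded_symbol \<psi> \<Longrightarrow> mult_L2 \<psi> f = f"
  using mult_L2_cong[of \<psi> "\<lambda>z. 1" f] by (simp add: mult_L2_def)

lemma cinner_mult_L2:
  assumes "bounded_symbol \<psi>"
  shows "cinner (mult_L2 \<psi> f) g = cinner f (mult_L2 (\<lambda>z. cnj (\<psi> z)) g)"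
  using assms bounded_symbol_cnj[OF assms]
  by (induct f rule: class_induct, induct g rule: class_induct)
    (simp add: mult_L2_class square_integrable_bounded_mult cinner_class mult.assoc mult.left_commute)

lemma mult_L2_cnj_self:
  assumes "bounded_symbol \<psi>" "AE z in circle_measure. cmod (\<psi> z) = 1"
  shows "mult_L2 (\<lambda>z. cnj (\<psi> z)) (mult_L2 \<psi> f) = f" "mult_L2 \<psi> (mult_L2 (\<lambda>z. cnj (\<psi> z)) f) = f"
proof -
  have "AE z in circle_measure. cnj (\<psi> z) * \<psi> z = 1"
    using assms(2) by eventually_elim (simp add: mult.commute flip: complex_norm_square)
  then show "mult_L2 (\<lambda>z. cnj (\<psi> z)) (mult_L2 \<psi> f) = f" "mult_L2 \<psi> (mult_L2 (\<lambda>z. cnj (\<psi> z)) f) = f"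
    using assms(1) by (simp_all add: mult_L2_mult_L2 bounded_symbol_cnj mult_L2_one bounded_symbol_mult mult.commute)
qed

lemma cinner_mult_L2_unimodular:
  assumes "bounded_symbol \<psi>" "AE z in circle_measure. cmod (\<psi> z) = 1"
  shows "cinner (mult_L2 \<psi> f) (mult_L2 \<psi> g) = cinner f g"
  by (simp add: cinner_mult_L2 mult_L2_cnj_self assms)

lemma norm_mult_L2_le:
  assumes "\<psi> \<in> borel_measurable borel" "0 \<le> C" "AE z in circle_measure. cmod (\<psi> z) \<le> C"
  shows "norm (mult_L2 \<psi> f) \<le> C * norm f"
proof -
  have [measurable]: "\<psi> \<in> borel_measurable borel"
    by fact
  have "(\<integral>\<^sup>+z. ennreal ((cmod (\<psi> z * rep_L2 f z))\<^sup>2) \<partial>circle_measure)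
      \<le> (\<integral>\<^sup>+z. ennreal (C\<^sup>2) * ennreal ((cmod (rep_L2 f z))\<^sup>2) \<partial>circle_measure)"
  proof (rule nn_integral_mono_AE)
    show "AE z in circle_measure. ennreal ((cmod (\<psi> z * rep_L2 f z))\<^sup>2) \<le> ennreal (C\<^sup>2) * ennreal ((cmod (rep_L2 f z))\<^sup>2)"
      using assms(3)
    proof eventually_elim
      case (elim z)
      then show ?case
        using assms(2) by (simp add: norm_mult power_mult_distrib mult_right_mono power_mono ennreal_leI flip: ennreal_mult')
    qed
  qed
  also have "\<dots> = ennreal ((C * norm f)\<^sup>2)"
    by (simp add: nn_integral_cmult nn_integral_norm_class power_mult_distrib ennreal_mult')
  finally show ?thesis
    unfolding mult_L2_def using assms(2) by (intro norm_class_leI(2)) auto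
qed

lemma bounded_linear_mult_L2:
  assumes "bounded_symbol \<psi>"
  shows "bounded_linear (mult_L2 \<psi>)"
proof -
  obtain C where "\<psi> \<in> borel_measurable borel" "0 \<le> C" "AE z in circle_measure. cmod (\<psi> z) \<le> C"
    using assms by (rule bounded_symbolE)
  then have "norm (mult_L2 \<psi> f) \<le> norm f * C" for f
    using norm_mult_L2_le[of \<psi> C f] by (simp add: mult.commute)
  then show ?thesis
    using assms by (intro bounded_linear_intro[of _ C]) (auto simp: mult_L2_add mult_L2_scaleC scaleR_conv_scaleC)
qed

subsection \<open>Fourier coefficients\<close>

definition zpow :: "int \<Rightarrow> L2" where
  "zpow n = class_L2 (\<lambda>z. z powi n)"

lemma square_integrable_powi [simp]: "square_integrable (\<lambda>z. z powi n)"
  by (simp add: bounded_symbol_square_integrable)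

lemma AE_powi_add: "AE z in circle_measure. (z::complex) powi (m + n) = z powi m * z powi n"
  using AE_circle_nz by eventually_elim (simp add: power_int_add)

lemma mult_zpow: "mult_L2 (\<lambda>z. z powi m) (zpow n) = zpow (m + n)"
proof -
  have "mult_L2 (\<lambda>z. z powi m) (zpow n) = class_L2 (\<lambda>z. z powi m * z powi n)"
    by (simp add: zpow_def mult_L2_class)
  also have "\<dots> = zpow (m + n)"
    unfolding zpow_def using AE_powi_add[of m n]
    by (intro class_L2_eqI square_integrable_bounded_mult) (auto elim: eventually_mono)
  finally show ?thesis .
qed

lemma cnj_powi_circle: "cmod z = 1 \<Longrightarrow> cnj (z powi n) = z powi (- n)"
proof -
  assume "cmod z = 1"
  then have "z * cnj z = 1"
    by (simp add: complex_norm_square[symmetric])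
  then have "cnj z = inverse z"
    by (metis inverse_unique)
  then show ?thesis
    by (simp add: power_int_minus power_int_inverse)
qed

lemma AE_cnj_powi: "AE z in circle_measure. cnj (z powi n) = z powi (- n)"
  using AE_circle by eventually_elim (rule cnj_powi_circle)

lemma mult_cnj_powi: "mult_L2 (\<lambda>z. cnj (z powi n)) f = mult_L2 (\<lambda>z. z powi (- n)) f"
  using AE_cnj_powi by (intro mult_L2_cong bounded_symbol_cnj bounded_symbol_powi) 

lemma cinner_zpow: "cinner (zpow m) (zpow n) = (if m = n then 1 else 0)"
proof -
  have "cinner (zpow m) (zpow n) = (\<integral>z. z powi m * cnj (z powi n) \<partial>circle_measure)"
    unfolding zpow_def by (rule cinner_class) simp_all
  also have "\<dots> = (\<integral>z. z powi (m - n) \<partial>circle_measure)"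
  proof (rule integral_cong_AE)
    show "AE z in circle_measure. z powi m * cnj (z powi n) = z powi (m - n)"
      using AE_cnj_powi[of n] AE_powi_add[of m "-n"] by eventually_elim simp
  qed (simp_all only: borel_measurable_circle_measure, measurable)
  finally show ?thesis
    by (simp add: integral_powi)
qed

lemma norm_zpow [simp]: "norm (zpow n) = 1"
  using cinner_zpow[of n n] cinner_self[of "zpow n"]
  by (metis Re_complex_of_real norm_ge_zero one_complex.sel(1) power_one power2_eq_iff_nonneg zero_le_one)

lemma cinner_mult_powi: "cinner (mult_L2 (\<lambda>z. z powi m) f) (zpow n) = cinner f (zpow (n - m))"
  unfolding cinner_mult_L2[OF bounded_symbol_powi] mult_cnj_powi mult_zpow by simp

lemma fourier_coeff_rep: "fourier_coeff (rep_L2 f) n = cinner f (zpow n)"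
proof -
  have "cinner (class_L2 (rep_L2 f)) (zpow n) = fourier_coeff (rep_L2 f) n"
    unfolding zpow_def fourier_coeff_def by (rule cinner_class) simp_all
  then show ?thesis
    by simp
qed

text \<open>The positive and the negative part of \<open>u\<close> are densities of two finite
  measures with equal moments; these measures coincide, and so do the densities almost
  everywhere.\<close>

lemma moment_0_imp_AE_0:
  fixes u :: "complex \<Rightarrow> real"
  assumes u: "integrable circle_measure u"
    and moments: "\<And>n::nat. (\<integral>z. of_real (u z) * z ^ n \<partial>circle_measure) = 0"
  shows "AE z in circle_measure. u z = 0"
proof -
  have [measurable]: "u \<in> borel_measurable borel"
    using borel_measurable_integrable[OF u] by simp
  define p where "p z = max (u z) 0" for z
  define q where "q z = max (- u z) 0" for z
  have pq: "u z = p z - q z" "0 \<le> p z" "0 \<le> q z" for z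
    by (auto simp: p_def q_def)
  have [measurable]: "p \<in> borel_measurable borel" "q \<in> borel_measurable borel"
    unfolding p_def q_def by measurable
  have int: "integrable circle_measure p" "integrable circle_measure q"
    unfolding p_def[abs_def] q_def[abs_def] using u by (auto intro!: integrable_max)
  have fin: "finite_measure (density circle_measure f)" if "integrable circle_measure f" "\<And>z. 0 \<le> f z"
    "f \<in> borel_measurable borel" for f
    using that by (intro finite_measureI) (auto simp: emeasure_density nn_integral_eq_integral cong: nn_integral_cong)
  have pow: "integrable circle_measure (\<lambda>z. f z *\<^sub>R z ^ n)"
    if f: "integrable circle_measure f" for f :: "complex \<Rightarrow> real" and n
  proof (rule Bochner_Integration.integrable_bound[OF f])
    have [measurable]: "f \<in> borel_measurable borel"
      using borel_measurable_integrable[OF f] by simp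
    show "(\<lambda>z. f z *\<^sub>R z ^ n) \<in> borel_measurable circle_measure"
      by simp
    show "AE z in circle_measure. norm (f z *\<^sub>R z ^ n) \<le> norm (f z)"
      using AE_circle by eventually_elim (simp add: norm_power)
  qed
  have "density circle_measure p = density circle_measure q"
  proof (rule circle_measure_eqI)
    show "finite_measure (density circle_measure p)" "finite_measure (density circle_measure q)"
      using int pq by (auto intro: fin)
    show "AE z in density circle_measure p. cmod z = 1" "AE z in density circle_measure q. cmod z = 1"
      using AE_circle by (auto simp: AE_density elim: eventually_mono)
    fix n :: nat
    have "(\<integral>z. p z *\<^sub>R z ^ n \<partial>circle_measure) - (\<integral>z. q z *\<^sub>R z ^ n \<partial>circle_measure) =
        (\<integral>z. of_real (u z) * z ^ n \<partial>circle_measure)"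
      using pow[OF int(1), of n] pow[OF int(2), of n]
      by (subst Bochner_Integration.integral_diff[symmetric])
        (auto simp: pq(1) scaleR_conv_of_real left_diff_distrib)
    then have "(\<integral>z. p z *\<^sub>R z ^ n \<partial>circle_measure) = (\<integral>z. q z *\<^sub>R z ^ n \<partial>circle_measure)"
      using moments by simp
    then show "(\<integral>z. z ^ n \<partial>density circle_measure p) = (\<integral>z. z ^ n \<partial>density circle_measure q)"
      using pq by (simp add: integral_density)
  qed simp_all
  then have "AE z in circle_measure. ennreal (p z) = ennreal (q z)"
    by (intro circle.density_unique) simp_all
  then show ?thesis
    by eventually_elim (use pq in simp)
qed

text \<open>Completeness of the trigonometric system. Coefficients of index \<le> 0 are moments of
  f, those of index \<ge> 0 are conjugates of moments of cnj f; hence the real and the imaginary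
  part both have zero moments.\<close>

lemma L2_eq_0I:
  assumes f: "\<And>n. cinner f (zpow n) = 0"
  shows "f = 0"
proof -
  let ?f = "rep_L2 f"
  have int: "integrable circle_measure ?f"
    using integrable_mult_cnj[of ?f "\<lambda>z. 1"] by simp
  have int_powi: "integrable circle_measure (\<lambda>z. ?f z * z powi n)" for n
  proof (rule Bochner_Integration.integrable_bound[OF int])
    show "AE z in circle_measure. norm (?f z * z powi n) \<le> norm (?f z)"
      using AE_circle by eventually_elim (simp add: norm_mult norm_power_int)
  qed simp
  have 0: "(\<integral>z. ?f z * z powi n \<partial>circle_measure) = 0" for n
  proof -
    have "(\<integral>z. ?f z * z powi n \<partial>circle_measure) = (\<integral>z. ?f z * cnj (z powi (- n)) \<partial>circle_measure)"
    proof (rule integral_cong_AE)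
      show "AE z in circle_measure. ?f z * z powi n = ?f z * cnj (z powi (- n))"
        using AE_cnj_powi[of "-n"] by eventually_elim simp
    qed (simp_all only: borel_measurable_circle_measure, measurable)
    also have "\<dots> = 0"
      using f[of "-n"] fourier_coeff_rep[of f "-n"] by (simp add: fourier_coeff_def)
    finally show ?thesis .
  qed
  have cnj0: "(\<integral>z. cnj (?f z) * z ^ n \<partial>circle_measure) = 0"
    and int_cnj: "integrable circle_measure (\<lambda>z. cnj (?f z) * z ^ n)" for n
  proof -
    have ae: "AE z in circle_measure. cnj (?f z) * z ^ n = cnj (?f z * z powi (- int n))"
      using AE_cnj_powi[of "- int n"] by eventually_elim simp
    have "(\<integral>z. cnj (?f z) * z ^ n \<partial>circle_measure) = (\<integral>z. cnj (?f z * z powi (- int n)) \<partial>circle_measure)"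
      by (rule integral_cong_AE[OF _ _ ae]) (simp_all only: borel_measurable_circle_measure, measurable)
    then show "(\<integral>z. cnj (?f z) * z ^ n \<partial>circle_measure) = 0"
      unfolding Bochner_Integration.integral_cnj 0 by simp
    show "integrable circle_measure (\<lambda>z. cnj (?f z) * z ^ n)"
      using int_powi[of "- int n"] integrable_cnj ae
      by (subst integrable_cong_AE[OF _ _ ae]) (simp_all only: borel_measurable_circle_measure, measurable)
  qed
  have f0: "(\<integral>z. ?f z * z ^ n \<partial>circle_measure) = 0" "integrable circle_measure (\<lambda>z. ?f z * z ^ n)" for n
    using 0[of "int n"] int_powi[of "int n"] by simp_all
  have "AE z in circle_measure. Re (?f z) = 0"
  proof (rule moment_0_imp_AE_0)
    fix n :: nat
    have "(\<integral>z. of_real (Re (?f z)) * z ^ n \<partial>circle_measure) = (\<integral>z. (?f z * z ^ n + cnj (?f z) * z ^ n) / 2 \<partial>circle_measure)"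
      by (intro Bochner_Integration.integral_cong) (auto simp: complex_eq_iff field_simps)
    then show "(\<integral>z. of_real (Re (?f z)) * z ^ n \<partial>circle_measure) = 0"
      using f0[of n] cnj0[of n] int_cnj[of n] by simp
  qed (use int in simp)
  moreover have "AE z in circle_measure. Im (?f z) = 0"
  proof (rule moment_0_imp_AE_0)
    fix n :: nat
    have "(\<integral>z. of_real (Im (?f z)) * z ^ n \<partial>circle_measure) = (\<integral>z. (?f z * z ^ n - cnj (?f z) * z ^ n) * (- \<i> / 2) \<partial>circle_measure)"
      by (intro Bochner_Integration.integral_cong) (auto simp: complex_eq_iff field_simps)
    then show "(\<integral>z. of_real (Im (?f z)) * z ^ n \<partial>circle_measure) = 0"
      using f0[of n] cnj0[of n] int_cnj[of n] by simp
  qed (use int in simp)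
  ultimately have "AE z in circle_measure. ?f z = 0"
    by eventually_elim (simp add: complex_eq_iff)
  then have "class_L2 ?f = class_L2 (\<lambda>z. 0)"
    by (intro class_L2_eqI) auto
  then show ?thesis
    by (simp add: zero_class)
qed

subsection \<open>The Hardy space\<close>

lemma H2_iff: "f \<in> H2 \<longleftrightarrow> (\<forall>n<0. cinner f (zpow n) = 0)"
  by (simp add: H2_def fourier_coeff_rep)

lemma H2_eq_INT: "H2 = (\<Inter>n\<in>{..<0}. {f. cinner f (zpow n) = 0})"
  by (auto simp: H2_iff)

lemma closed_H2: "closed H2"
  unfolding H2_eq_INT by (intro closed_INT ballI closed_cinner_left)

lemma csubspace_H2: "csubspace H2"
  by (auto simp: csubspace_def H2_iff cinner_add_left cinner_scaleC_left cinner.zero_left)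

lemma complete_H2: "complete H2"
  by (rule complete_L2_closed[OF closed_H2])

lemma zpow_H2: "0 \<le> n \<Longrightarrow> zpow n \<in> H2"
  by (auto simp: H2_iff cinner_zpow)

lemma H2_span: "closure (cspan (zpow ` {0..})) = H2"
proof (rule closure_cspan_eqI[OF csubspace_H2 complete_H2])
  show "zpow ` {0..} \<subseteq> H2"
    using zpow_H2 by auto
  fix u assume "u \<in> H2" and u: "\<And>g. g \<in> zpow ` {0..} \<Longrightarrow> cinner u g = 0"
  then have "cinner u (zpow n) = 0" for n
    by (cases "n < 0") (auto simp: H2_iff)
  then show "u = 0"
    by (rule L2_eq_0I)
qed

text \<open>On a power z^m the product is also the product of z^m with the class of \<psi>, which
  only raises the indices of its coefficients. Powers span the Hardy space densely, and
  multiplication by \<psi> is continuous.\<close>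

lemma mult_L2_H2:
  assumes "bounded_symbol \<psi>" "class_L2 \<psi> \<in> H2" "f \<in> H2"
  shows "mult_L2 \<psi> f \<in> H2"
proof (rule closure_cspan_image[OF bounded_linear_mult_L2 mult_L2_scaleC csubspace_H2 closed_H2])
  show "mult_L2 \<psi> g \<in> H2" if g: "g \<in> zpow ` {0..}" for g
  proof -
    obtain m where m: "0 \<le> m" "g = zpow m"
      using g by auto
    have "mult_L2 \<psi> g = mult_L2 (\<lambda>z. z powi m) (class_L2 \<psi>)"
      using assms(1) by (simp add: m zpow_def mult_L2_class bounded_symbol_square_integrable mult.commute)
    then show ?thesis
      using assms(2) m(1) by (simp add: H2_iff cinner_mult_powi)
  qed
  show "f \<in> closure (cspan (zpow ` {0..}))"
    using assms(3) by (simp add: H2_span)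
qed (use assms in auto)

lemma mult_powi_H2: "0 \<le> n \<Longrightarrow> f \<in> H2 \<Longrightarrow> mult_L2 (\<lambda>z. z powi n) f \<in> H2"
  by (simp add: H2_iff cinner_mult_powi)

lemma inner_functionD:
  assumes "inner_function \<Theta>"
  shows "bounded_symbol \<Theta>" "square_integrable \<Theta>" "class_L2 \<Theta> \<in> H2" "AE z in circle_measure. cmod (\<Theta> z) = 1"
    "\<Theta> \<in> borel_measurable borel"
  using assms bounded_symbol_unimodular by (auto simp: inner_function_def square_integrable_def)

lemma inner_mult_H2: "inner_function \<Theta> \<Longrightarrow> f \<in> H2 \<Longrightarrow> mult_L2 \<Theta> f \<in> H2"
  by (intro mult_L2_H2 inner_functionD)

lemma inner_cinner: "inner_function \<Theta> \<Longrightarrow> cinner (mult_L2 \<Theta> f) (mult_L2 \<Theta> g) = cinner f g"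
  by (intro cinner_mult_L2_unimodular inner_functionD)

section \<open>The backward shift, which sends f to (f - f(0)) / z\<close>

definition backward_shift :: "L2 \<Rightarrow> L2" where
  "backward_shift f = mult_L2 (\<lambda>z. z powi (-1)) (f - cinner f (zpow 0) *\<^sub>C zpow 0)"

lemma cinner_backward_shift:
  "cinner (backward_shift f) (zpow n) = (if n = -1 then 0 else cinner f (zpow (n + 1)))"
  unfolding backward_shift_def cinner_mult_powi
  by (auto simp: cinner.diff_left cinner_scaleC_left cinner_zpow)

lemma mult_backward_shift: "mult_L2 (\<lambda>z. z powi 1) (backward_shift f) = f - cinner f (zpow 0) *\<^sub>C zpow 0"
proof -
  have "AE z::complex in circle_measure. z powi 1 * z powi (-1) = 1"
    using AE_powi_add[of 1 "-1"] by eventually_elim simp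
  then show ?thesis
    unfolding backward_shift_def mult_L2_mult_L2[OF bounded_symbol_powi bounded_symbol_powi]
    by (intro mult_L2_one bounded_symbol_mult bounded_symbol_powi)
qed

lemma backward_shift_H2: "f \<in> H2 \<Longrightarrow> backward_shift f \<in> H2"
  by (simp add: H2_iff cinner_backward_shift)

subsection \<open>Model spaces\<close>

lemma csubspace_model_space: "csubspace (model_space \<Theta>)"
  using csubspace_H2
  by (auto simp: csubspace_def model_space_def cinner_add_left cinner_scaleC_left cinner.zero_left)

lemma closed_model_space: "closed (model_space \<Theta>)"
proof -
  have "model_space \<Theta> = H2 \<inter> (\<Inter>h\<in>H2. {f. cinner f (mult_L2 \<Theta> h) = 0})"
    by (auto simp: model_space_def)
  then show ?thesis
    by (auto intro!: closed_Int closed_INT closed_H2 closed_cinner_left)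
qed

lemma complete_model_space: "complete (model_space \<Theta>)"
  by (rule complete_L2_closed[OF closed_model_space])

lemma model_space_H2: "f \<in> model_space \<Theta> \<Longrightarrow> f \<in> H2"
  by (simp add: model_space_def)

lemma model_spaceI:
  assumes "bounded_symbol \<Theta>" "f \<in> H2" "\<And>n. n \<ge> 0 \<Longrightarrow> cinner f (mult_L2 \<Theta> (zpow n)) = 0"
  shows "f \<in> model_space \<Theta>"
proof -
  have "mult_L2 \<Theta> h \<in> {g. cinner f g = 0}" if h: "h \<in> H2" for h
  proof (rule closure_cspan_image[OF bounded_linear_mult_L2 mult_L2_scaleC csubspace_cinner_right closed_cinner_right])
    show "h \<in> closure (cspan (zpow ` {0..}))"
      using h by (simp add: H2_span)
  qed (use assms in auto)
  then show ?thesis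
    using assms(2) by (simp add: model_space_def)
qed

text \<open>Multiplication by \<Theta> is isometric, so the component of f in \<Theta> H^2 is
  \<Theta> g with g the projection of cnj \<Theta> f to the Hardy space.\<close>

lemma H2_decompose:
  assumes "inner_function \<Theta>" "f \<in> H2"
  shows "\<exists>k\<in>model_space \<Theta>. \<exists>g\<in>H2. f = k + mult_L2 \<Theta> g"
proof -
  note \<Theta> = inner_functionD[OF assms(1)]
  define g where "g = orth_proj H2 (mult_L2 (\<lambda>z. cnj (\<Theta> z)) f)"
  have g: "g \<in> H2" "\<And>h. h \<in> H2 \<Longrightarrow> cinner (mult_L2 (\<lambda>z. cnj (\<Theta> z)) f - g) h = 0"
    unfolding g_def by (rule orth_proj[OF csubspace_H2 complete_H2]; assumption)+
  have "f - mult_L2 \<Theta> g \<in> model_space \<Theta>"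
    unfolding model_space_def
  proof (intro CollectI conjI ballI)
    show "f - mult_L2 \<Theta> g \<in> H2"
      using assms g by (intro csubspace_diff csubspace_H2 inner_mult_H2)
    fix h assume "h \<in> H2"
    have "cinner (f - mult_L2 \<Theta> g) (mult_L2 \<Theta> h) = cinner f (mult_L2 \<Theta> h) - cinner g h"
      using assms(1) by (simp add: cinner.diff_left inner_cinner)
    also have "cinner f (mult_L2 \<Theta> h) = cinner (mult_L2 (\<lambda>z. cnj (\<Theta> z)) f) h"
      using \<Theta> by (simp add: cinner_mult_L2 bounded_symbol_cnj)
    finally show "cinner (f - mult_L2 \<Theta> g) (mult_L2 \<Theta> h) = 0"
      using g(2)[OF \<open>h \<in> H2\<close>] by (simp add: cinner.diff_left)
  qed
  then show ?thesis
    using g(1) by (intro bexI[of _ "f - mult_L2 \<Theta> g"] bexI[of _ g]) auto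
qed

section \<open>Bounded functions in the model space\<close>

definition Linf :: "L2 set" where
  "Linf = {f. \<exists>C. AE z in circle_measure. cmod (rep_L2 f z) \<le> C}"

lemma bounded_symbol_rep: "f \<in> Linf \<longleftrightarrow> bounded_symbol (rep_L2 f)"
  by (simp add: Linf_def bounded_symbol_def)

lemma Hinf_eq: "Hinf = H2 \<inter> Linf"
  by (auto simp: Hinf_def Linf_def)

lemma class_Linf: "bounded_symbol \<psi> \<Longrightarrow> class_L2 \<psi> \<in> Linf"
proof -
  assume "bounded_symbol \<psi>"
  then obtain C where "AE z in circle_measure. cmod (\<psi> z) \<le> C"
    unfolding bounded_symbol_def by blast
  then have "AE z in circle_measure. cmod (rep_L2 (class_L2 \<psi>) z) \<le> C"
    using rep_class[OF bounded_symbol_square_integrable[OF \<open>bounded_symbol \<psi>\<close>]]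
    by eventually_elim simp
  then show ?thesis
    by (auto simp: Linf_def)
qed

lemma csubspace_Linf: "csubspace Linf"
  unfolding csubspace_def
proof (intro conjI ballI allI)
  show "0 \<in> Linf"
    unfolding zero_class by (intro class_Linf) simp
  fix f c assume f: "f \<in> Linf"
  have "c *\<^sub>C class_L2 (rep_L2 f) \<in> Linf"
    using bounded_symbol_mult[OF bounded_symbol_const[of c] f[unfolded bounded_symbol_rep]]
    by (simp add: scaleC_class class_Linf del: class_rep)
  then show "c *\<^sub>C f \<in> Linf"
    by simp
  fix g assume g: "g \<in> Linf"
  have "class_L2 (rep_L2 f) + class_L2 (rep_L2 g) \<in> Linf"
    using bounded_symbol_add[OF f[unfolded bounded_symbol_rep] g[unfolded bounded_symbol_rep]]
    by (simp add: plus_class class_Linf del: class_rep)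
  then show "f + g \<in> Linf"
    by simp
qed

text \<open>The projection of \<open>z\<^sup>n\<close> to the model space; it is bounded because the projection of
  \<open>cnj \<Theta> z\<^sup>n\<close> to the Hardy space is a polynomial.\<close>

definition model_zpow :: "(complex \<Rightarrow> complex) \<Rightarrow> nat \<Rightarrow> L2" where
  "model_zpow \<Theta> n = zpow (int n) -
     (\<Sum>m\<le>n. cnj (cinner (class_L2 \<Theta>) (zpow (int n - int m))) *\<^sub>C mult_L2 \<Theta> (zpow (int m)))"

text \<open>\<open>model_zpow \<Theta> n\<close> represents the n-th Fourier coefficient as a
  functional on the model space. For n = 0 it is the reproducing kernel at the origin, one minus the
  conjugate of \<Theta>(0) times \<Theta>.\<close>

lemma
  assumes "inner_function \<Theta>"
  shows model_zpow_in: "model_zpow \<Theta> n \<in> model_space \<Theta> \<inter> Hinf"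
    and cinner_model_zpow: "f \<in> model_space \<Theta> \<Longrightarrow> cinner f (model_zpow \<Theta> n) = cinner f (zpow (int n))"
proof -
  note \<Theta> = inner_functionD[OF assms]
  have comm: "mult_L2 \<Theta> (zpow m) = class_L2 (\<lambda>z. \<Theta> z * z powi m)" "mult_L2 \<Theta> (zpow m) = mult_L2 (\<lambda>z. z powi m) (class_L2 \<Theta>)" for m
    using \<Theta> by (simp_all add: zpow_def mult_L2_class mult.commute)
  have H2: "model_zpow \<Theta> n \<in> H2"
    unfolding model_zpow_def using assms
    by (intro csubspace_diff csubspace_sum csubspace_scale csubspace_H2 inner_mult_H2 zpow_H2) auto
  have "model_zpow \<Theta> n \<in> Linf"
    unfolding model_zpow_def comm(1) using \<Theta> 
    by (intro csubspace_diff csubspace_sum csubspace_scale csubspace_Linf class_Linf bounded_symbol_mult)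
      (auto simp: zpow_def intro!: class_Linf)
  moreover have "model_zpow \<Theta> n \<in> model_space \<Theta>"
  proof (rule model_spaceI[OF \<Theta>(1) H2])
    fix j :: int assume j: "j \<ge> 0"
    have "cinner (model_zpow \<Theta> n) (mult_L2 \<Theta> (zpow j)) =
      cinner (zpow (int n)) (mult_L2 \<Theta> (zpow j)) - (\<Sum>m\<le>n. cnj (cinner (class_L2 \<Theta>) (zpow (int n - int m))) * (if int m = j then 1 else 0))"
      using assms by (simp add: model_zpow_def cinner.diff_left cinner.sum_left cinner_scaleC_left inner_cinner cinner_zpow)
    also have "(\<Sum>m\<le>n. cnj (cinner (class_L2 \<Theta>) (zpow (int n - int m))) * (if int m = j then 1 else 0)) =
      (\<Sum>m\<le>n. if m = nat j then cnj (cinner (class_L2 \<Theta>) (zpow (int n - j))) else 0)"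
      using j by (intro sum.cong) auto
    \<comment> \<open>If j > n, no term of the sum survives, and the coefficient on the right has a
      negative index, so both sides are 0.\<close>
    also have "\<dots> = cnj (cinner (class_L2 \<Theta>) (zpow (int n - j)))"
      using \<Theta>(3) by (auto simp: H2_iff)
    also have "cinner (zpow (int n)) (mult_L2 \<Theta> (zpow j)) = cnj (cinner (class_L2 \<Theta>) (zpow (int n - j)))"
      unfolding comm(2) by (subst cinner_commute) (simp add: cinner_mult_powi)
    finally show "cinner (model_zpow \<Theta> n) (mult_L2 \<Theta> (zpow j)) = 0"
      by simp
  qed
  ultimately show "model_zpow \<Theta> n \<in> model_space \<Theta> \<inter> Hinf"
    using H2 by (simp add: Hinf_eq)
  assume "f \<in> model_space \<Theta>"
  then have "cinner f (mult_L2 \<Theta> (zpow (int m))) = 0" for m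
    by (simp add: model_space_def zpow_H2)
  then show "cinner f (model_zpow \<Theta> n) = cinner f (zpow (int n))"
    by (simp add: model_zpow_def cinner.diff_right cinner.sum_right cinner_scaleC_right)
qed

text \<open>A vector of the model space orthogonal to the whole family has no nonzero Fourier
  coefficient. As the family is countable and bounded, this provides both a countable orthonormal
  basis and the density of bounded functions.\<close>

lemma model_zpow_span:
  assumes "inner_function \<Theta>"
  shows "closure (cspan (range (model_zpow \<Theta>))) = model_space \<Theta>"
proof (rule closure_cspan_eqI[OF csubspace_model_space complete_model_space])
  show "range (model_zpow \<Theta>) \<subseteq> model_space \<Theta>"
    using model_zpow_in[OF assms] by auto
  fix u assume u: "u \<in> model_space \<Theta>" "\<And>g. g \<in> range (model_zpow \<Theta>) \<Longrightarrow> cinner u g = 0"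
  have "cinner u (zpow n) = 0" for n
  proof (cases "n < 0")
    case True
    then show ?thesis
      using model_space_H2[OF u(1)] by (simp add: H2_iff)
  next
    case False
    then show ?thesis
      using cinner_model_zpow[OF assms u(1), of "nat n"] u(2) by simp
  qed
  then show "u = 0"
    by (rule L2_eq_0I)
qed

lemma model_space_Hinf_dense:
  assumes "inner_function \<Theta>"
  shows "closure (cspan (model_space \<Theta> \<inter> Hinf)) = model_space \<Theta>"
proof
  show "closure (cspan (model_space \<Theta> \<inter> Hinf)) \<subseteq> model_space \<Theta>"
    by (intro closure_cspan_minimal csubspace_model_space closed_model_space) auto
  have "range (model_zpow \<Theta>) \<subseteq> closure (cspan (model_space \<Theta> \<inter> Hinf))"
    using model_zpow_in[OF assms] subset_closure_cspan by blast
  then show "model_space \<Theta> \<subseteq> closure (cspan (model_space \<Theta> \<inter> Hinf))"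
    using closure_cspan_mono model_zpow_span[OF assms] by blast
qed

lemma model_space_basis:
  assumes "inner_function \<Theta>"
  shows "\<exists>X. corthonormal X \<and> countable X \<and> closure (cspan X) = model_space \<Theta>"
  using Gram_Schmidt[of "model_zpow \<Theta>"] model_zpow_span[OF assms] by metis

section \<open>Composition with an inner function\<close>

lemma zpow_imageE:
  assumes "g \<in> zpow ` {0..}"
  obtains n where "g = zpow (int n)"
proof -
  obtain m where "0 \<le> m" "g = zpow m"
    using assms by auto
  then show ?thesis
    using that[of "nat m"] by simp
qed

section \<open>Powers of an inner function and weighted composition\<close>

lemma bounded_symbol_power_fun:
  assumes "bounded_symbol \<psi>"
  shows "bounded_symbol (\<lambda>z. \<psi> z ^ n)"
  using assms by (induction n) (auto intro: bounded_symbol_mult)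

lemma mult_L2_power_Suc:
  "bounded_symbol \<psi> \<Longrightarrow> mult_L2 (\<lambda>z. \<psi> z ^ Suc n) f = mult_L2 \<psi> (mult_L2 (\<lambda>z. \<psi> z ^ n) f)"
  by (simp add: mult_L2_mult_L2 bounded_symbol_power_fun)

lemma mult_L2_power_0: "mult_L2 (\<lambda>z. \<psi> z ^ 0) f = f"
  by (simp add: mult_L2_one)

lemma inner_power_H2:
  assumes "inner_function B" "f \<in> H2"
  shows "mult_L2 (\<lambda>z. B z ^ n) f \<in> H2"
proof (induction n)
  case (Suc n)
  then show ?case
    using assms(1) by (simp only: mult_L2_power_Suc inner_functionD inner_mult_H2)
qed (use assms in \<open>simp only: mult_L2_power_0\<close>)

text \<open>A representative of f is composed with \<open>B\<close>; that another representative
  gives the same class is shown in \<open>V_class\<close>, for nonconstant \<open>B\<close> and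
  \<open>h\<close> in its model space.\<close>

definition weighted_comp :: "(complex \<Rightarrow> complex) \<Rightarrow> L2 \<Rightarrow> L2 \<Rightarrow> L2" where
  "weighted_comp B h f = class_L2 (\<lambda>z. rep_L2 h z * rep_L2 f (B z))"

text \<open>For \<open>h\<close> in the model space of \<open>B\<close>, all nonzero Fourier coefficients of the image of the measure
  \<open>\<bar>h\<bar>\<^sup>2 dm\<close> under \<open>B\<close> vanish, because \<open>B\<^sup>n h\<close> is orthogonal to \<open>h\<close>.\<close>

lemma distr_model_space:
  assumes B: "inner_function B" and h: "h \<in> model_space B"
  shows "distr (density circle_measure (\<lambda>z. ennreal ((cmod (rep_L2 h z))\<^sup>2))) borel B =
    density circle_measure (\<lambda>_. ennreal ((norm h)\<^sup>2))" (is "?M = ?N")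
proof (rule circle_measure_eqI)
  note BD = inner_functionD[OF B]
  have [measurable]: "B \<in> borel_measurable borel"
    by (rule BD)
  let ?D = "density circle_measure (\<lambda>z. ennreal ((cmod (rep_L2 h z))\<^sup>2))"
  have "emeasure ?D UNIV = ennreal ((norm h)\<^sup>2)"
    using nn_integral_norm_class[of "rep_L2 h"] by (simp add: emeasure_density)
  then show "finite_measure ?M"
    by (intro finite_measureI) (simp add: emeasure_distr)
  show "finite_measure ?N"
    by (intro finite_measureI) (simp add: emeasure_density nn_integral_cmult prob_circle)
  have "{z::complex. cmod z = 1} \<in> sets borel"
    by measurable
  then show "AE z in ?M. cmod z = 1"
    using BD(4) by (subst AE_distr_iff) (auto simp: AE_density elim: eventually_mono)
  show "AE z in ?N. cmod z = 1"
    using AE_circle by (auto simp: AE_density elim: eventually_mono)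
  fix n :: nat
  have pow: "bounded_symbol (\<lambda>z. B z ^ n)"
    by (rule bounded_symbol_power_fun[OF BD(1)])
  have "(\<integral>z. z ^ n \<partial>?M) = (\<integral>z. (cmod (rep_L2 h z))\<^sup>2 *\<^sub>R B z ^ n \<partial>circle_measure)"
    by (simp add: integral_distr integral_density)
  also have "\<dots> = (\<integral>z. (B z ^ n * rep_L2 h z) * cnj (rep_L2 h z) \<partial>circle_measure)"
    by (simp only: scaleR_conv_of_real complex_norm_square ac_simps)
  also have "\<dots> = cinner (class_L2 (\<lambda>z. B z ^ n * rep_L2 h z)) (class_L2 (rep_L2 h))"
    using pow by (intro cinner_class[symmetric] square_integrable_bounded_mult) simp_all
  also have "\<dots> = cinner (mult_L2 (\<lambda>z. B z ^ n) h) h"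
    by (simp add: mult_L2_def)
  also have "\<dots> = (if n = 0 then of_real ((norm h)\<^sup>2) else 0)"
  proof (cases n)
    case 0
    then show ?thesis
      by (simp add: mult_L2_one cinner_self)
  next
    case (Suc m)
    have "cinner h (mult_L2 (\<lambda>z. B z ^ n) h) = 0"
      unfolding Suc mult_L2_power_Suc[OF BD(1)]
      using h inner_power_H2[OF B, of h] by (simp add: model_space_def)
    then have "cinner (mult_L2 (\<lambda>z. B z ^ n) h) h = 0"
      by (metis cinner_commute complex_cnj_zero)
    then show ?thesis
      using Suc by simp
  qed
  also have "\<dots> = (\<integral>z. (norm h)\<^sup>2 *\<^sub>R z ^ n \<partial>circle_measure)"
    using integral_powi[of "int n"] by (simp add: scaleR_conv_of_real)
  also have "\<dots> = (\<integral>z. z ^ n \<partial>?N)"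
    by (simp add: integral_density)
  finally show "(\<integral>z. z ^ n \<partial>?M) = (\<integral>z. z ^ n \<partial>?N)" .
qed simp_all

lemma nn_integral_model_space:
  assumes B: "inner_function B" and h: "h \<in> model_space B" and [measurable]: "g \<in> borel_measurable borel"
  shows "(\<integral>\<^sup>+z. ennreal ((cmod (rep_L2 h z))\<^sup>2) * g (B z) \<partial>circle_measure) =
    ennreal ((norm h)\<^sup>2) * (\<integral>\<^sup>+z. g z \<partial>circle_measure)"
proof -
  have [measurable]: "B \<in> borel_measurable borel"
    by (rule inner_functionD[OF B])
  have "(\<integral>\<^sup>+z. ennreal ((cmod (rep_L2 h z))\<^sup>2) * g (B z) \<partial>circle_measure) =
      (\<integral>\<^sup>+z. g z \<partial>distr (density circle_measure (\<lambda>z. ennreal ((cmod (rep_L2 h z))\<^sup>2))) borel B)"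
    by (simp add: nn_integral_distr nn_integral_density)
  then show ?thesis
    unfolding distr_model_space[OF B h] by (simp add: nn_integral_density nn_integral_cmult)
qed

lemma norm_square_integrable_comp:
  assumes B: "inner_function B" and h: "h \<in> model_space B" and f: "square_integrable f"
  shows "square_integrable (\<lambda>z. rep_L2 h z * f (B z))"
    and "norm (class_L2 (\<lambda>z. rep_L2 h z * f (B z))) = norm h * norm (class_L2 f)"
proof -
  have [measurable]: "B \<in> borel_measurable borel" "f \<in> borel_measurable borel"
    using f inner_functionD[OF B] by (auto simp: square_integrable_def)
  have "(\<integral>\<^sup>+z. ennreal ((cmod (rep_L2 h z * f (B z)))\<^sup>2) \<partial>circle_measure) =
     (\<integral>\<^sup>+z. ennreal ((cmod (rep_L2 h z))\<^sup>2) * ennreal ((cmod (f (B z)))\<^sup>2) \<partial>circle_measure)"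
    by (simp add: norm_mult power_mult_distrib ennreal_mult')
  also have "\<dots> = ennreal ((norm h)\<^sup>2) * (\<integral>\<^sup>+z. ennreal ((cmod (f z))\<^sup>2) \<partial>circle_measure)"
    by (rule nn_integral_model_space[OF B h]) measurable
  also have "\<dots> = ennreal ((norm h * norm (class_L2 f))\<^sup>2)"
    by (simp add: nn_integral_norm_class f power_mult_distrib ennreal_mult')
  finally have eq: "(\<integral>\<^sup>+z. ennreal ((cmod (rep_L2 h z * f (B z)))\<^sup>2) \<partial>circle_measure) =
     ennreal ((norm h * norm (class_L2 f))\<^sup>2)" .
  show sq: "square_integrable (\<lambda>z. rep_L2 h z * f (B z))"
    by (rule square_integrableI_nn) (simp_all add: eq)
  show "norm (class_L2 (\<lambda>z. rep_L2 h z * f (B z))) = norm h * norm (class_L2 f)"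
    using eq unfolding nn_integral_norm_class[OF sq]
    by (subst (asm) ennreal_inj) (simp_all add: power2_eq_iff_nonneg)
qed

text \<open>The inner product is B(0), whose modulus is 1 only for constant inner functions. The
  strict bound is used quantitatively: 1 - |B(0)| bounds the kernel at the origin from below, and
  the powers of B(0) tend to 0.\<close>

locale nonconstant_inner =
  fixes B :: "complex \<Rightarrow> complex"
  assumes B: "inner_function B"
    and nonconstant: "cmod (cinner (class_L2 B) (zpow 0)) < 1"
begin

lemmas BD = inner_functionD[OF B]

definition b :: complex where "b = cinner (class_L2 B) (zpow 0)"

lemma B_measurable [measurable]: "B \<in> borel_measurable borel"
  by (rule BD)

lemma cmod_b: "cmod b < 1"
  using nonconstant by (simp add: b_def)

text \<open>The reproducing kernel at the origin is bounded below, which makes the image of the measure of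
  the circle under \<open>B\<close> absolutely continuous with bounded density.\<close>

lemma kernel_lower_bound: "AE z in circle_measure. 1 - cmod b \<le> cmod (rep_L2 (model_zpow B 0) z)"
proof -
  have "model_zpow B 0 = class_L2 (\<lambda>z. 1) - cnj b *\<^sub>C class_L2 B"
    using BD by (simp add: model_zpow_def b_def zpow_def mult_L2_class)
  also have "\<dots> = class_L2 (\<lambda>z. 1 - cnj b * B z)"
    using BD by (simp add: scaleC_class minus_class square_integrable_scale)
  finally have "AE z in circle_measure. rep_L2 (model_zpow B 0) z = 1 - cnj b * B z"
    using rep_class[of "\<lambda>z. 1 - cnj b * B z"] BD by (simp add: square_integrable_diff square_integrable_scale)
  then show ?thesis
    using BD(4)
  proof eventually_elim
    case (elim z)
    then show ?case
      using norm_triangle_ineq2[of 1 "cnj b * B z"] by (simp add: norm_mult)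
  qed
qed

text \<open>The squared norm of the kernel is 1 - |b|^2, so this is the square root of (1 + |b|) /
  (1 - |b|), the classical bound for the composition operator of an inner function with value b at
  0.\<close>

definition comp_bound :: real where "comp_bound = norm (model_zpow B 0) / (1 - cmod b)"

lemma comp_bound_nonneg: "0 \<le> comp_bound"
  using cmod_b by (simp add: comp_bound_def)

text \<open>Inserting the weight \<bar>h\<bar>^2 / c^2, which is at least 1 for the kernel h at the
  origin, leads to an integral that the image of the weighted measure evaluates exactly.\<close>

lemma nn_integral_comp_le:
  assumes [measurable]: "g \<in> borel_measurable borel"
  shows "(\<integral>\<^sup>+z. g (B z) \<partial>circle_measure) \<le> ennreal (comp_bound\<^sup>2) * (\<integral>\<^sup>+z. g z \<partial>circle_measure)"
proof -
  let ?h = "model_zpow B 0"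
  define c where "c = 1 - cmod b"
  have c: "c > 0"
    using cmod_b by (simp add: c_def)
  have h: "?h \<in> model_space B"
    using model_zpow_in[OF B] by blast
  have "(\<integral>\<^sup>+z. g (B z) \<partial>circle_measure) \<le>
      (\<integral>\<^sup>+z. ennreal (1 / c\<^sup>2) * (ennreal ((cmod (rep_L2 ?h z))\<^sup>2) * g (B z)) \<partial>circle_measure)"
  proof (rule nn_integral_mono_AE)
    show "AE z in circle_measure. g (B z) \<le> ennreal (1 / c\<^sup>2) * (ennreal ((cmod (rep_L2 ?h z))\<^sup>2) * g (B z))"
      using kernel_lower_bound
    proof eventually_elim
      case (elim z)
      then have "c\<^sup>2 \<le> (cmod (rep_L2 ?h z))\<^sup>2"
        using c by (intro power_mono) (auto simp: c_def)
      then have "1 \<le> 1 / c\<^sup>2 * (cmod (rep_L2 ?h z))\<^sup>2"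
        using c by (simp add: field_simps)
      then have "1 \<le> ennreal (1 / c\<^sup>2) * ennreal ((cmod (rep_L2 ?h z))\<^sup>2)"
        by (simp flip: ennreal_mult' add: ennreal_1[symmetric] del: ennreal_1)
      then have "1 * g (B z) \<le> (ennreal (1 / c\<^sup>2) * ennreal ((cmod (rep_L2 ?h z))\<^sup>2)) * g (B z)"
        by (rule mult_right_mono) simp
      then show ?case
        by (simp add: mult.assoc)
    qed
  qed
  also have "\<dots> = ennreal (1 / c\<^sup>2) * (ennreal ((norm ?h)\<^sup>2) * (\<integral>\<^sup>+z. g z \<partial>circle_measure))"
    by (simp add: nn_integral_cmult nn_integral_model_space[OF B h])
  also have "\<dots> = ennreal (comp_bound\<^sup>2) * (\<integral>\<^sup>+z. g z \<partial>circle_measure)"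
    by (simp add: comp_bound_def c_def power_divide mult.assoc[symmetric] flip: ennreal_mult')
  finally show ?thesis .
qed

text \<open>The estimate, applied to the indicator of a null set, shows that its preimage under
  \<open>B\<close> is null. This is what makes composition with \<open>B\<close> meaningful for
  classes.\<close>

lemma AE_comp:
  assumes "AE z in circle_measure. P z"
  shows "AE z in circle_measure. P (B z)"
proof -
  obtain N where N: "N \<in> sets borel" "emeasure circle_measure N = 0" "{z. \<not> P z} \<subseteq> N"
    using AE_E[OF assms] by auto
  have [measurable]: "N \<in> sets borel"
    by fact
  have "(\<integral>\<^sup>+z. indicator N (B z) \<partial>circle_measure) \<le> ennreal (comp_bound\<^sup>2) * (\<integral>\<^sup>+z. indicator N z \<partial>circle_measure)"
    by (rule nn_integral_comp_le) measurable
  also have "\<dots> = 0"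
    using N by simp
  finally have "AE z in circle_measure. (indicator N (B z) :: ennreal) = 0"
    by (subst nn_integral_0_iff_AE[symmetric]) auto
  then show ?thesis
    by eventually_elim (use N(3) in \<open>auto simp: indicator_eq_0_iff\<close>)
qed

lemma square_integrable_comp:
  assumes f: "square_integrable f"
  shows "square_integrable (\<lambda>z. f (B z))" "norm (class_L2 (\<lambda>z. f (B z))) \<le> comp_bound * norm (class_L2 f)"
proof -
  have [measurable]: "f \<in> borel_measurable borel"
    using f by (simp add: square_integrable_def)
  have "(\<integral>\<^sup>+z. ennreal ((cmod (f (B z)))\<^sup>2) \<partial>circle_measure) \<le> ennreal (comp_bound\<^sup>2) * (\<integral>\<^sup>+z. ennreal ((cmod (f z))\<^sup>2) \<partial>circle_measure)"
    by (rule nn_integral_comp_le) measurable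
  also have "\<dots> = ennreal ((comp_bound * norm (class_L2 f))\<^sup>2)"
    by (simp add: nn_integral_norm_class f power_mult_distrib ennreal_mult')
  finally show "square_integrable (\<lambda>z. f (B z))" "norm (class_L2 (\<lambda>z. f (B z))) \<le> comp_bound * norm (class_L2 f)"
    using comp_bound_nonneg by (auto intro: norm_class_leI)
qed

lemma bounded_symbol_comp:
  assumes "bounded_symbol \<psi>"
  shows "bounded_symbol (\<psi> \<circ> B)"
proof -
  obtain C where "\<psi> \<in> borel_measurable borel" "AE z in circle_measure. cmod (\<psi> z) \<le> C"
    using assms unfolding bounded_symbol_def by blast
  then show ?thesis
    using AE_comp[of "\<lambda>z. cmod (\<psi> z) \<le> C"] unfolding bounded_symbol_def by (auto simp: comp_def)
qed

section \<open>The isometries attached to vectors of the model space of \<open>B\<close>\<close>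

abbreviation V :: "L2 \<Rightarrow> L2 \<Rightarrow> L2" where "V \<equiv> weighted_comp B"

lemma V_class:
  assumes "class_L2 h \<in> model_space B" "square_integrable h" "square_integrable f"
  shows "V (class_L2 h) (class_L2 f) = class_L2 (\<lambda>z. h z * f (B z))"
    and "square_integrable (\<lambda>z. h z * f (B z))"
proof -
  have [measurable]: "h \<in> borel_measurable borel" "f \<in> borel_measurable borel"
    using assms by (auto simp: square_integrable_def)
  have ae: "AE z in circle_measure. rep_L2 (class_L2 h) z * rep_L2 (class_L2 f) (B z) = h z * f (B z)"
    using rep_class[OF assms(2)] AE_comp[OF rep_class[OF assms(3)]] by eventually_elim simp
  have sq: "square_integrable (\<lambda>z. rep_L2 (class_L2 h) z * rep_L2 (class_L2 f) (B z))"
    by (rule norm_square_integrable_comp[OF B assms(1)]) simp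
  have "integrable circle_measure (\<lambda>z. (cmod (h z * f (B z)))\<^sup>2)"
    using sq ae unfolding square_integrable_def
    by (elim conjE, subst integrable_cong_AE[of _ _ "\<lambda>z. (cmod (rep_L2 (class_L2 h) z * rep_L2 (class_L2 f) (B z)))\<^sup>2"])
      (auto elim: eventually_mono)
  then show sq': "square_integrable (\<lambda>z. h z * f (B z))"
    by (simp add: square_integrable_def)
  show "V (class_L2 h) (class_L2 f) = class_L2 (\<lambda>z. h z * f (B z))"
    unfolding weighted_comp_def by (rule class_L2_eqI[OF sq sq' ae])
qed

lemma norm_V: "h \<in> model_space B \<Longrightarrow> norm (V h f) = norm h * norm f"
  unfolding weighted_comp_def using norm_square_integrable_comp(2)[OF B, of h "rep_L2 f"] by simp

lemma V_add_right: "h \<in> model_space B \<Longrightarrow> V h (f + g) = V h f + V h g"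
  by (induct h rule: class_induct, induct f rule: class_induct, induct g rule: class_induct)
    (simp add: plus_class V_class square_integrable_add distrib_left)

lemma V_scaleC_right: "h \<in> model_space B \<Longrightarrow> V h (c *\<^sub>C f) = c *\<^sub>C V h f"
  by (induct h rule: class_induct, induct f rule: class_induct)
    (simp add: scaleC_class V_class square_integrable_scale mult.left_commute)

lemma V_add_left: "h \<in> model_space B \<Longrightarrow> h' \<in> model_space B \<Longrightarrow> V (h + h') f = V h f + V h' f"
proof (induct h rule: class_induct, induct h' rule: class_induct, induct f rule: class_induct)
  case (1 f h' h)
  then have "class_L2 (\<lambda>z. h z + h' z) \<in> model_space B"
    using csubspace_add[OF csubspace_model_space, of "class_L2 h" B "class_L2 h'"] by (simp add: plus_class)
  with 1 show ?case
    by (simp add: plus_class V_class square_integrable_add distrib_right)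
qed

lemma V_scaleC_left: "h \<in> model_space B \<Longrightarrow> V (c *\<^sub>C h) f = c *\<^sub>C V h f"
proof (induct h rule: class_induct, induct f rule: class_induct)
  case (1 f h)
  then have "class_L2 (\<lambda>z. c * h z) \<in> model_space B"
    using csubspace_scale[OF csubspace_model_space, of "class_L2 h" B c] by (simp add: scaleC_class)
  with 1 show ?case
    by (simp add: scaleC_class V_class square_integrable_scale mult.assoc)
qed

lemma bounded_linear_V: "h \<in> model_space B \<Longrightarrow> bounded_linear (V h)"
  by (intro bounded_linear_intro[of _ "norm h"])
    (simp_all add: V_add_right V_scaleC_right scaleR_conv_scaleC norm_V mult.commute)

lemma clinear_on_V_left: "clinear_on (model_space B) (\<lambda>h. V h f)"
  by (simp add: clinear_on_def V_add_left V_scaleC_left)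

lemma V_mult:
  assumes "h \<in> model_space B" "bounded_symbol \<psi>"
  shows "V h (mult_L2 \<psi> f) = mult_L2 (\<psi> \<circ> B) (V h f)"
  using assms bounded_symbol_comp[OF assms(2)]
  by (induct h rule: class_induct, induct f rule: class_induct)
    (simp add: mult_L2_class V_class square_integrable_bounded_mult mult.left_commute)

lemma V_zpow:
  assumes "h \<in> model_space B"
  shows "V h (zpow (int n)) = mult_L2 (\<lambda>z. B z ^ n) h"
  using assms bounded_symbol_power_fun[OF BD(1), of n]
  by (induct h rule: class_induct) (simp add: zpow_def V_class mult_L2_class bounded_symbol_square_integrable mult.commute)

text \<open>The norm identity is polarized twice: first in f and g for one fixed h, and then in h
  and h', where the first result supplies the diagonal.\<close>

lemma cinner_V:
  assumes "h \<in> model_space B" "h' \<in> model_space B"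
  shows "cinner (V h f) (V h' g) = cinner h h' * cinner f g"
proof -
  have 1: "cinner (V h f) (V h g) - cinner h h * cinner f g = 0" if "h \<in> model_space B" for h
  proof (rule sesquilinear_eq_0[where S = UNIV and F = "\<lambda>f g. cinner (V h f) (V h g) - cinner h h * cinner f g"])
    show "cinner (V h f) (V h f) - cinner h h * cinner f f = 0" for f
      using that by (simp add: cinner_self norm_V power_mult_distrib)
  qed (use that in \<open>auto simp: csubspace_def V_add_right V_scaleC_right cinner_add_left cinner_add_right
        cinner_scaleC_left cinner_scaleC_right algebra_simps\<close>)
  have "cinner (V h f) (V h' g) - cinner h h' * cinner f g = 0"
  proof (rule sesquilinear_eq_0[where S = "model_space B" and F = "\<lambda>h h'. cinner (V h f) (V h' g) - cinner h h' * cinner f g"])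
    show "cinner (V h f) (V h g) - cinner h h * cinner f g = 0" if "h \<in> model_space B" for h
      by (rule 1[OF that])
  qed (use assms in \<open>auto simp: csubspace_model_space V_add_left V_scaleC_left cinner_add_left cinner_add_right
        cinner_scaleC_left cinner_scaleC_right algebra_simps\<close>)
  then show ?thesis
    by simp
qed

lemma V_H2:
  assumes "h \<in> model_space B" "f \<in> H2"
  shows "V h f \<in> H2"
proof (rule closure_cspan_image[OF bounded_linear_V V_scaleC_right csubspace_H2 closed_H2])
  show "V h g \<in> H2" if g: "g \<in> zpow ` {0..}" for g
  proof -
    obtain n where "g = zpow (int n)"
      by (rule zpow_imageE[OF g])
    then show ?thesis
      using assms(1) V_zpow inner_power_H2[OF B model_space_H2] by simp
  qed
  show "f \<in> closure (cspan (zpow ` {0..}))"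
    using assms(2) by (simp add: H2_span)
qed (use assms in auto)

text \<open>Composition with \<open>B\<close> is a bounded operator that sends z^n to
  \<open>B\<close>^n, hence polynomials into the Hardy space. Approximating \<Theta> by polynomials
  replaces the composition of analytic functions in the disc.\<close>

lemma inner_function_comp:
  assumes \<Theta>: "inner_function \<Theta>"
  shows "inner_function (\<Theta> \<circ> B)"
  unfolding inner_function_def
proof (intro conjI)
  note \<Theta>D = inner_functionD[OF \<Theta>]
  show "square_integrable (\<Theta> \<circ> B)"
    using square_integrable_comp(1)[OF \<Theta>D(2)] by (simp add: comp_def)
  show "AE z in circle_measure. cmod ((\<Theta> \<circ> B) z) = 1"
    using AE_comp[OF \<Theta>D(4)] by (simp add: comp_def)
  define L where "L f = class_L2 (\<lambda>z. rep_L2 f (B z))" for f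
  have L_class: "L (class_L2 f) = class_L2 (\<lambda>z. f (B z))" if "square_integrable f" for f
    unfolding L_def using that square_integrable_comp(1) AE_comp[OF rep_class[OF that]]
    by (intro class_L2_eqI) auto
  have L_add: "L (f + g) = L f + L g" for f g
    by (induct f rule: class_induct, induct g rule: class_induct)
      (simp add: plus_class L_class square_integrable_add square_integrable_comp)
  have L_scale: "L (c *\<^sub>C f) = c *\<^sub>C L f" for c f
    by (induct f rule: class_induct)
      (simp add: scaleC_class L_class square_integrable_scale square_integrable_comp)
  have "norm (L f) \<le> norm f * comp_bound" for f
    unfolding L_def using square_integrable_comp(2)[of "rep_L2 f"] by (simp add: mult.commute)
  then have "bounded_linear L"
    by (intro bounded_linear_intro[of _ comp_bound]) (simp_all add: L_add L_scale scaleR_conv_scaleC)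
  then have "L (class_L2 \<Theta>) \<in> H2"
  proof (rule closure_cspan_image[OF _ L_scale csubspace_H2 closed_H2])
    show "class_L2 \<Theta> \<in> closure (cspan (zpow ` {0..}))"
      using \<Theta>D by (simp add: H2_span)
    show "L g \<in> H2" if g: "g \<in> zpow ` {0..}" for g
    proof -
      obtain n where "g = zpow (int n)"
        by (rule zpow_imageE[OF g])
      then have "L g = mult_L2 (\<lambda>z. B z ^ n) (zpow 0)"
        using bounded_symbol_power_fun[OF BD(1), of n] by (simp add: zpow_def L_class mult_L2_class bounded_symbol_square_integrable)
      then show ?thesis
        using inner_power_H2[OF B zpow_H2] by simp
    qed
  qed
  then show "class_L2 (\<Theta> \<circ> B) \<in> H2"
    using \<Theta>D by (simp add: L_class comp_def)
qed

subsection \<open>The Wold decomposition\<close>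

text \<open>Evaluation at 0 is multiplicative: writing f = f(0) + z g, the part z B g has no zeroth
  coefficient.\<close>

lemma coeff_0_mult:
  assumes "f \<in> H2"
  shows "cinner (mult_L2 B f) (zpow 0) = b * cinner f (zpow 0)"
proof -
  define g where "g = backward_shift f"
  have g: "g \<in> H2"
    unfolding g_def by (rule backward_shift_H2[OF assms])
  have "mult_L2 (\<lambda>z. z powi 1) g = f - cinner f (zpow 0) *\<^sub>C zpow 0"
    unfolding g_def by (rule mult_backward_shift)
  then have "f = mult_L2 (\<lambda>z. z powi 1) g + cinner f (zpow 0) *\<^sub>C zpow 0"
    by simp
  then have "cinner (mult_L2 B f) (zpow 0) =
     cinner (mult_L2 B (mult_L2 (\<lambda>z. z powi 1) g)) (zpow 0) + cinner f (zpow 0) * cinner (mult_L2 B (zpow 0)) (zpow 0)"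
    using BD(1) by (metis mult_L2_add mult_L2_scaleC cinner_add_left cinner_scaleC_left)
  also have "mult_L2 B (mult_L2 (\<lambda>z. z powi 1) g) = mult_L2 (\<lambda>z. z powi 1) (mult_L2 B g)"
    using BD(1) bounded_symbol_powi[of 1] by (simp only: mult_L2_mult_L2 mult.commute)
  also have "cinner \<dots> (zpow 0) = 0"
    unfolding cinner_mult_powi using inner_mult_H2[OF B g] by (simp add: H2_iff)
  also have "mult_L2 B (zpow 0) = class_L2 B"
    using BD(1) by (simp add: zpow_def mult_L2_class)
  finally show ?thesis
    by (simp add: b_def mult.commute)
qed

lemma cnj_power_symbol: "bounded_symbol (\<lambda>z. cnj (B z) ^ n)"
  by (intro bounded_symbol_power_fun bounded_symbol_cnj BD)

text \<open>If u = B^n w with w in the Hardy space, then w has the norm of u and |u(0)| \<le> |b|^n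
  \<parallel>u\<parallel>; letting n grow gives u(0) = 0. The set \<open>M\<close> of such u is
  therefore stable under division by z, so every further coefficient vanishes for the same
  reason.\<close>

lemma infinitely_divisible_eq_0:
  assumes u: "\<And>n. mult_L2 (\<lambda>z. cnj (B z) ^ n) u \<in> H2"
  shows "u = 0"
proof -
  define M where "M = {u. \<forall>n. mult_L2 (\<lambda>z. cnj (B z) ^ n) u \<in> H2}"
  have coeff_0: "cinner u (zpow 0) = 0" if "u \<in> M" for u
  proof -
    have "cmod (cinner u (zpow 0)) \<le> cmod b ^ n * norm u" for n
    proof -
      define w where "w = mult_L2 (\<lambda>z. cnj (B z) ^ n) u"
      have w: "w \<in> H2"
        using that by (simp add: M_def w_def)
      have uni: "AE z in circle_measure. cmod (B z ^ n) = 1"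
        using BD(4) by eventually_elim (simp add: norm_power)
      have Bn: "bounded_symbol (\<lambda>z. B z ^ n)"
        by (rule bounded_symbol_power_fun[OF BD(1)])
      have "u = mult_L2 (\<lambda>z. B z ^ n) w"
        using mult_L2_cnj_self(2)[OF Bn uni, of u] by (simp add: w_def)
      moreover have "norm w = norm u"
      proof -
        have "AE z in circle_measure. cmod (cnj (B z) ^ n) = 1"
          using uni by (simp flip: complex_cnj_power)
        then have "complex_of_real ((norm w)\<^sup>2) = of_real ((norm u)\<^sup>2)"
          unfolding cinner_self[symmetric] w_def by (rule cinner_mult_L2_unimodular[OF cnj_power_symbol])
        then show ?thesis
          unfolding of_real_eq_iff by (simp add: power2_eq_iff_nonneg)
      qed
      moreover have "cinner (mult_L2 (\<lambda>z. B z ^ n) w) (zpow 0) = b ^ n * cinner w (zpow 0)"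
      proof (induction n)
        case (Suc n)
        show ?case
          unfolding mult_L2_power_Suc[OF BD(1)] coeff_0_mult[OF inner_power_H2[OF B w]] Suc by simp
      qed (simp only: mult_L2_power_0, simp)
      moreover have "cmod (cinner w (zpow 0)) \<le> norm w * norm (zpow 0)"
        by (rule cmod_cinner_le)
      ultimately show ?thesis
        by (simp add: norm_mult norm_power mult_left_mono)
    qed
    moreover have "(\<lambda>n. cmod b ^ n * norm u) \<longlonglongrightarrow> 0"
      using cmod_b by (intro tendsto_mult_left_zero LIMSEQ_realpow_zero) auto
    ultimately have "cmod (cinner u (zpow 0)) \<le> 0"
      by (intro LIMSEQ_le_const[of "\<lambda>n. cmod b ^ n * norm u"]) auto
    then show ?thesis
      by simp
  qed
  have shift: "mult_L2 (\<lambda>z. z powi (-1)) u \<in> M" if u: "u \<in> M" for u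
    unfolding M_def
  proof (intro CollectI allI)
    fix n
    \<comment> \<open>The quotient of u by B^n lies in \<open>M\<close> again, so its zeroth
      coefficient is 0 and its division by z is the backward shift, which stays in the Hardy
      space.\<close>
    define x where "x = mult_L2 (\<lambda>z. cnj (B z) ^ n) u"
    have "mult_L2 (\<lambda>z. cnj (B z) ^ m) x = mult_L2 (\<lambda>z. cnj (B z) ^ (m + n)) u" for m
      by (simp only: x_def mult_L2_mult_L2 cnj_power_symbol power_add)
    then have x: "x \<in> M"
      using u by (simp add: M_def)
    then have "mult_L2 (\<lambda>z. cnj (B z) ^ 0) x \<in> H2"
      unfolding M_def mem_Collect_eq by (rule spec)
    then have "x \<in> H2"
      by (simp only: mult_L2_power_0)
    then have "mult_L2 (\<lambda>z. z powi (-1)) x \<in> H2"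
      using backward_shift_H2[of x] coeff_0[OF x] by (simp add: backward_shift_def)
    moreover have "mult_L2 (\<lambda>z. z powi (-1)) x = mult_L2 (\<lambda>z. cnj (B z) ^ n) (mult_L2 (\<lambda>z. z powi (-1)) u)"
      unfolding x_def by (simp only: mult_L2_mult_L2 cnj_power_symbol bounded_symbol_powi mult.commute)
    ultimately show "mult_L2 (\<lambda>z. cnj (B z) ^ n) (mult_L2 (\<lambda>z. z powi (-1)) u) \<in> H2"
      by simp
  qed
  have all: "cinner v (zpow (int m)) = 0" if "v \<in> M" for v m
    using that
  proof (induction m arbitrary: v)
    case (Suc m)
    have "cinner (mult_L2 (\<lambda>z. z powi (-1)) v) (zpow (int m)) = 0"
      by (rule Suc.IH[OF shift[OF Suc.prems]])
    then show ?case
      unfolding cinner_mult_powi by (simp add: add.commute)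
  qed (simp add: coeff_0)
  have "u \<in> M"
    using u by (simp add: M_def)
  have "u \<in> H2"
    using u[of 0] by (simp only: mult_L2_power_0)
  have "cinner u (zpow n) = 0" for n
  proof (cases "n < 0")
    case True
    then show ?thesis
      using \<open>u \<in> H2\<close> by (simp add: H2_iff)
  next
    case False
    then show ?thesis
      using all[OF \<open>u \<in> M\<close>, of "nat n"] by simp
  qed
  then show ?thesis
    by (rule L2_eq_0I)
qed

text \<open>A vector u orthogonal to every B^n h can be divided by B indefinitely: the component of
  cnj B^n u in the model space is orthogonal to that vector itself, hence 0, and one more factor B
  splits off. Only 0 is divisible in this way.\<close>

lemma Wold_decomposition:
  "closure (cspan {V h (zpow (int n)) |h n. h \<in> model_space B}) = H2"
proof (rule closure_cspan_eqI[OF csubspace_H2 complete_H2])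
  show "{V h (zpow (int n)) |h n. h \<in> model_space B} \<subseteq> H2"
    using V_H2 zpow_H2 by auto
  fix u assume u: "u \<in> H2" and orth: "\<And>g. g \<in> {V h (zpow (int n)) |h n. h \<in> model_space B} \<Longrightarrow> cinner u g = 0"
  have "mult_L2 (\<lambda>z. cnj (B z) ^ n) u \<in> H2" for n
  proof (induction n)
    case 0
    show ?case
      using u by (simp only: mult_L2_power_0)
  next
    case (Suc n)
    define w where "w = mult_L2 (\<lambda>z. cnj (B z) ^ n) u"
    obtain k g where kg: "k \<in> model_space B" "g \<in> H2" "w = k + mult_L2 B g"
      using H2_decompose[OF B Suc] unfolding w_def by blast
    have "cinner w k = cinner u (V k (zpow (int n)))"
      unfolding w_def V_zpow[OF kg(1)] cinner_mult_L2[OF cnj_power_symbol] by simp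
    also have "\<dots> = 0"
      using kg(1) by (intro orth) blast
    finally have "cinner k k + cinner (mult_L2 B g) k = 0"
      by (simp add: kg(3) cinner_add_left)
    moreover have "cinner (mult_L2 B g) k = 0"
      using kg(1,2) by (subst cinner_commute) (simp add: model_space_def)
    ultimately have "k = 0"
      by simp
    have "mult_L2 (\<lambda>z. cnj (B z) ^ Suc n) u = mult_L2 (\<lambda>z. cnj (B z)) w"
      unfolding w_def by (rule mult_L2_power_Suc[OF bounded_symbol_cnj[OF BD(1)]])
    also have "\<dots> = g"
      using kg(3) \<open>k = 0\<close> BD by (simp add: mult_L2_cnj_self)
    finally show ?case
      using kg(2) by simp
  qed
  then show "u = 0"
    by (rule infinitely_divisible_eq_0)
qed

text \<open>Orthogonality to (\<Theta> \<circ> B) H^2 needs testing only on the Wold generators,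
  where multiplication by \<Theta> \<circ> B becomes multiplication by \<Theta> in the second
  argument of V.\<close>

lemma V_model_space:
  assumes \<Theta>: "inner_function \<Theta>" and h: "h \<in> model_space B" and f: "f \<in> model_space \<Theta>"
  shows "V h f \<in> model_space (\<Theta> \<circ> B)"
  unfolding model_space_def
proof (intro CollectI conjI ballI)
  note \<Theta>D = inner_functionD[OF \<Theta>]
  show "V h f \<in> H2"
    by (intro V_H2 h model_space_H2[OF f])
  fix x assume x: "x \<in> H2"
  have "mult_L2 (\<Theta> \<circ> B) x \<in> {y. cinner (V h f) y = 0}"
  proof (rule closure_cspan_image[OF bounded_linear_mult_L2 mult_L2_scaleC csubspace_cinner_right closed_cinner_right])
    show "x \<in> closure (cspan {V h (zpow (int n)) |h n. h \<in> model_space B})"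
      using x unfolding Wold_decomposition .
    fix g assume "g \<in> {V h (zpow (int n)) |h n. h \<in> model_space B}"
    then obtain h' n where g: "h' \<in> model_space B" "g = V h' (zpow (int n))"
      by blast
    have "cinner (V h f) (mult_L2 (\<Theta> \<circ> B) g) = cinner h h' * cinner f (mult_L2 \<Theta> (zpow (int n)))"
      unfolding g(2) V_mult[OF g(1) \<Theta>D(1), symmetric] by (rule cinner_V[OF h g(1)])
    also have "\<dots> = 0"
      using f zpow_H2[of "int n"] by (simp add: model_space_def)
    finally show "mult_L2 (\<Theta> \<circ> B) g \<in> {y. cinner (V h f) y = 0}"
      by simp
  qed (rule bounded_symbol_comp[OF \<Theta>D(1)])+
  then show "cinner (V h f) (mult_L2 (\<Theta> \<circ> B) x) = 0"
    by simp
qed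

text \<open>Orthogonality of u to the generators spreads from F to the model space of \<Theta>, then
  from X to that of B. A power z^n differs from a model space vector by \<Theta> g, and V h
  (\<Theta> g) is orthogonal to u since u is in the model space of \<Theta> \<circ> B; so u is
  orthogonal to all Wold generators. Taking for F the bounded functions gives the test vectors for
  the Toeplitz operators.\<close>

lemma V_span:
  assumes \<Theta>: "inner_function \<Theta>"
    and X: "closure (cspan X) = model_space B" and F: "closure (cspan F) = model_space \<Theta>"
  shows "closure (cspan {V h f |h f. h \<in> X \<and> f \<in> F}) = model_space (\<Theta> \<circ> B)"
proof (rule closure_cspan_eqI[OF csubspace_model_space complete_model_space])
  note \<Theta>D = inner_functionD[OF \<Theta>]
  have XB: "X \<subseteq> model_space B" and F\<Theta>: "F \<subseteq> model_space \<Theta>"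
    using X F subset_closure_cspan[of X] subset_closure_cspan[of F] by simp_all
  then show "{V h f |h f. h \<in> X \<and> f \<in> F} \<subseteq> model_space (\<Theta> \<circ> B)"
    using V_model_space[OF \<Theta>] by blast
  fix u assume u: "u \<in> model_space (\<Theta> \<circ> B)" and orth: "\<And>g. g \<in> {V h f |h f. h \<in> X \<and> f \<in> F} \<Longrightarrow> cinner u g = 0"
  have 1: "V h f \<in> {y. cinner u y = 0}" if h: "h \<in> X" and f: "f \<in> model_space \<Theta>" for h f
  proof (rule closure_cspan_image[OF bounded_linear_V V_scaleC_right csubspace_cinner_right closed_cinner_right])
    show "f \<in> closure (cspan F)"
      using f F by simp
  qed (use orth h XB in auto)
  have 2: "V h f \<in> {y. cinner u y = 0}" if h: "h \<in> model_space B" and f: "f \<in> model_space \<Theta>" for h f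
  proof (rule closure_cspan_image_on[OF csubspace_model_space closed_model_space clinear_on_V_left _
        csubspace_cinner_right closed_cinner_right])
    show "norm (V h f) \<le> norm f * norm h" if "h \<in> model_space B" for h
      using that by (simp add: norm_V)
    show "h \<in> closure (cspan X)"
      using h X by simp
  qed (use 1 f XB in auto)
  have 3: "cinner u (V h (zpow (int n))) = 0" if h: "h \<in> model_space B" for h n
  proof -
    obtain k g where kg: "k \<in> model_space \<Theta>" "g \<in> H2" "zpow (int n) = k + mult_L2 \<Theta> g"
      using H2_decompose[OF \<Theta> zpow_H2[of "int n"]] by auto
    have "cinner u (mult_L2 (\<Theta> \<circ> B) (V h g)) = 0"
      using u V_H2[OF h kg(2)] by (simp add: model_space_def)
    then show ?thesis
      unfolding kg(3) using 2[OF h kg(1)] h \<Theta>D(1) by (simp add: V_add_right V_mult cinner_add_right)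
  qed
  have "cinner u u = 0"
  proof (rule orthogonal_closure_cspan)
    show "u \<in> closure (cspan {V h (zpow (int n)) |h n. h \<in> model_space B})"
      using model_space_H2[OF u] unfolding Wold_decomposition .
  qed (use 3 in auto)
  then show "u = 0"
    by simp
qed

end

section \<open>The order of an inner function\<close>

lemma model_space_cong:
  assumes "bounded_symbol \<Theta>" "bounded_symbol \<Theta>'" "AE z in circle_measure. \<Theta> z = \<Theta>' z"
  shows "model_space \<Theta> = model_space \<Theta>'"
  using mult_L2_cong[OF assms] by (simp add: model_space_def)

lemma inner_function_mult:
  assumes "inner_function \<Theta>" "inner_function \<Theta>'"
  shows "inner_function (\<lambda>z. \<Theta> z * \<Theta>' z)"
proof -
  note D = inner_functionD[OF assms(1)] and D' = inner_functionD[OF assms(2)]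
  have "class_L2 (\<lambda>z. \<Theta> z * \<Theta>' z) = mult_L2 \<Theta> (class_L2 \<Theta>')"
    using D D' by (simp add: mult_L2_class)
  moreover have "AE z in circle_measure. cmod (\<Theta> z * \<Theta>' z) = 1"
    using D(4) D'(4) by eventually_elim (simp add: norm_mult)
  ultimately show ?thesis
    using D D' inner_mult_H2[OF assms(1)] by (simp add: inner_function_def square_integrable_bounded_mult)
qed

lemma inner_function_const:
  assumes "cmod c = 1"
  shows "inner_function (\<lambda>z. c)"
proof -
  have "class_L2 (\<lambda>z. c) = c *\<^sub>C zpow 0"
    by (simp add: zpow_def scaleC_class)
  then show ?thesis
    using assms by (simp add: inner_function_def csubspace_scale[OF csubspace_H2] zpow_H2)
qed

lemma model_space_const:
  assumes "cmod c = 1"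
  shows "model_space (\<lambda>z. c) = {0}"
proof -
  have "f = 0" if "f \<in> model_space (\<lambda>z. c)" for f
  proof -
    have "cinner f (mult_L2 (\<lambda>z. c) f) = 0"
      using that by (simp add: model_space_def)
    moreover have "mult_L2 (\<lambda>z. c) f = c *\<^sub>C f"
      using scaleC_class[of "rep_L2 f" c] by (simp add: mult_L2_def)
    ultimately show ?thesis
      using assms by (auto simp: cinner_scaleC_right)
  qed
  then show ?thesis
    using csubspace_0[OF csubspace_model_space] by blast
qed

lemma model_zpow_0: "inner_function B \<Longrightarrow> model_zpow B 0 = zpow 0 - cnj (cinner (class_L2 B) (zpow 0)) *\<^sub>C class_L2 B"
  by (simp add: model_zpow_def zpow_def mult_L2_class inner_functionD)

text \<open>By the reproducing property, the squared norm of the kernel is its own value at the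
  origin.\<close>

lemma norm_model_zpow_0:
  assumes "inner_function B"
  shows "(norm (model_zpow B 0))\<^sup>2 = 1 - (cmod (cinner (class_L2 B) (zpow 0)))\<^sup>2"
proof -
  have "complex_of_real ((norm (model_zpow B 0))\<^sup>2) = cinner (model_zpow B 0) (zpow 0)"
    using cinner_model_zpow[OF assms, of "model_zpow B 0" 0] model_zpow_in[OF assms, of 0]
    by (simp add: cinner_self)
  also have "\<dots> = of_real (1 - (cmod (cinner (class_L2 B) (zpow 0)))\<^sup>2)"
    unfolding model_zpow_0[OF assms] of_real_diff complex_norm_square
    by (simp add: cinner.diff_left cinner_scaleC_left cinner_zpow mult.commute)
  finally show ?thesis
    by (simp only: of_real_eq_iff)
qed

lemma constant_if_model_zpow_0:
  assumes B: "inner_function B" and 0: "model_zpow B 0 = 0"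
  shows "\<exists>c. cmod c = 1 \<and> (AE z in circle_measure. B z = c)"
proof -
  define b where "b = cinner (class_L2 B) (zpow 0)"
  have "(cmod b)\<^sup>2 = 1"
    using norm_model_zpow_0[OF B] 0 by (simp add: b_def)
  then have b: "cmod b = 1"
    by (metis abs_norm_cancel power2_eq_1_iff abs_1 abs_minus_cancel)
  have "zpow 0 = cnj b *\<^sub>C class_L2 B"
    using 0 model_zpow_0[OF B] by (simp add: b_def)
  then have "b *\<^sub>C zpow 0 = (b * cnj b) *\<^sub>C class_L2 B"
    by (simp add: scaleC_scaleC)
  also have "b * cnj b = 1"
    using b by (simp flip: complex_norm_square)
  finally have "class_L2 B = class_L2 (\<lambda>z. b)"
    by (simp add: zpow_def scaleC_class)
  then have "AE z in circle_measure. B z = b"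
    using inner_functionD[OF B] by (intro class_L2_eqD) auto
  then show ?thesis
    using b by blast
qed

subsection \<open>Products\<close>

text \<open>The model space of a product is the orthogonal sum of that of the first factor and the
  first factor times that of the second, stated as two inclusions, orthogonality and
  completeness.\<close>

lemma model_space_product:
  assumes B\<^sub>1: "inner_function B\<^sub>1" and B\<^sub>2: "inner_function B\<^sub>2"
  shows "model_space B\<^sub>1 \<subseteq> model_space (\<lambda>z. B\<^sub>1 z * B\<^sub>2 z)"
    and "f \<in> model_space B\<^sub>2 \<Longrightarrow> mult_L2 B\<^sub>1 f \<in> model_space (\<lambda>z. B\<^sub>1 z * B\<^sub>2 z)"
    and "e \<in> model_space B\<^sub>1 \<Longrightarrow> f \<in> model_space B\<^sub>2 \<Longrightarrow> cinner e (mult_L2 B\<^sub>1 f) = 0"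
    and "u \<in> model_space (\<lambda>z. B\<^sub>1 z * B\<^sub>2 z) \<Longrightarrow> (\<And>e. e \<in> model_space B\<^sub>1 \<Longrightarrow> cinner u e = 0) \<Longrightarrow>
      (\<And>f. f \<in> model_space B\<^sub>2 \<Longrightarrow> cinner u (mult_L2 B\<^sub>1 f) = 0) \<Longrightarrow> u = 0"
proof -
  note D1 = inner_functionD[OF B\<^sub>1] and D2 = inner_functionD[OF B\<^sub>2]
  have mult: "mult_L2 (\<lambda>z. B\<^sub>1 z * B\<^sub>2 z) f = mult_L2 B\<^sub>1 (mult_L2 B\<^sub>2 f)" for f
    using D1 D2 by (simp add: mult_L2_mult_L2)
  show "model_space B\<^sub>1 \<subseteq> model_space (\<lambda>z. B\<^sub>1 z * B\<^sub>2 z)"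
    by (auto simp: model_space_def mult inner_mult_H2[OF B\<^sub>2])
  show "mult_L2 B\<^sub>1 f \<in> model_space (\<lambda>z. B\<^sub>1 z * B\<^sub>2 z)" if "f \<in> model_space B\<^sub>2" for f
    using that by (auto simp: model_space_def mult inner_mult_H2[OF B\<^sub>1] inner_cinner[OF B\<^sub>1])
  show "cinner e (mult_L2 B\<^sub>1 f) = 0" if "e \<in> model_space B\<^sub>1" "f \<in> model_space B\<^sub>2" for e f
    using that by (auto simp: model_space_def)
  show "u = 0" if u: "u \<in> model_space (\<lambda>z. B\<^sub>1 z * B\<^sub>2 z)"
    and 1: "\<And>e. e \<in> model_space B\<^sub>1 \<Longrightarrow> cinner u e = 0"
    and 2: "\<And>f. f \<in> model_space B\<^sub>2 \<Longrightarrow> cinner u (mult_L2 B\<^sub>1 f) = 0"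
  proof -
    obtain k g where kg: "k \<in> model_space B\<^sub>1" "g \<in> H2" "u = k + mult_L2 B\<^sub>1 g"
      using H2_decompose[OF B\<^sub>1 model_space_H2[OF u]] by blast
    have "cinner (mult_L2 B\<^sub>1 g) k = 0"
      using kg(1,2) by (subst cinner_commute) (simp add: model_space_def)
    then have "cinner k k = 0"
      using 1[OF kg(1)] by (simp add: kg(3) cinner_add_left)
    then have u_eq: "u = mult_L2 B\<^sub>1 g"
      using kg(3) by simp
    have "g \<in> model_space B\<^sub>2"
      using u kg(2) unfolding model_space_def u_eq by (simp add: mult inner_cinner[OF B\<^sub>1])
    then have "cinner u u = 0"
      using 2 u_eq by simp
    then show "u = 0"
      by simp
  qed
qed

text \<open>Used in both directions: to build bases of Blaschke products, and to see that splitting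
  off a factor lowers the bound on orthonormal systems by one.\<close>

lemma corthonormal_product:
  assumes B\<^sub>1: "inner_function B\<^sub>1" and B\<^sub>2: "inner_function B\<^sub>2"
    and e: "e \<in> model_space B\<^sub>1" "cinner e e = 1" and Y: "corthonormal Y" "finite Y" "Y \<subseteq> model_space B\<^sub>2"
  shows "corthonormal (insert e (mult_L2 B\<^sub>1 ` Y))" "card (insert e (mult_L2 B\<^sub>1 ` Y)) = Suc (card Y)"
    "insert e (mult_L2 B\<^sub>1 ` Y) \<subseteq> model_space (\<lambda>z. B\<^sub>1 z * B\<^sub>2 z)"
proof -
  have inj: "inj_on (mult_L2 B\<^sub>1) Y"
    using mult_L2_cnj_self(1)[OF inner_functionD(1,4)[OF B\<^sub>1]] by (metis inj_onI)
  have orth: "cinner e (mult_L2 B\<^sub>1 y) = 0" "cinner (mult_L2 B\<^sub>1 y) e = 0" if "y \<in> Y" for y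
  proof -
    show "cinner e (mult_L2 B\<^sub>1 y) = 0"
      using model_space_product(3)[OF B\<^sub>1 B\<^sub>2 e(1)] that Y(3) by blast
    then show "cinner (mult_L2 B\<^sub>1 y) e = 0"
      by (metis cinner_commute complex_cnj_zero)
  qed
  then have "e \<notin> mult_L2 B\<^sub>1 ` Y"
    using e(2) by fastforce
  then show "card (insert e (mult_L2 B\<^sub>1 ` Y)) = Suc (card Y)"
    using Y(2) by (simp add: card_image[OF inj])
  show "corthonormal (insert e (mult_L2 B\<^sub>1 ` Y))"
    unfolding corthonormal_def
  proof (intro ballI)
    fix x y assume xy: "x \<in> insert e (mult_L2 B\<^sub>1 ` Y)" "y \<in> insert e (mult_L2 B\<^sub>1 ` Y)"
    have "cinner (mult_L2 B\<^sub>1 y) (mult_L2 B\<^sub>1 y') = (if mult_L2 B\<^sub>1 y = mult_L2 B\<^sub>1 y' then 1 else 0)"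
      if "y \<in> Y" "y' \<in> Y" for y y'
      using that Y(1) inj by (simp add: inner_cinner[OF B\<^sub>1] corthonormal_def inj_on_eq_iff)
    then show "cinner x y = (if x = y then 1 else 0)"
      using xy e(2) orth \<open>e \<notin> mult_L2 B\<^sub>1 ` Y\<close> by (elim insertE imageE) auto
  qed
  show "insert e (mult_L2 B\<^sub>1 ` Y) \<subseteq> model_space (\<lambda>z. B\<^sub>1 z * B\<^sub>2 z)"
    using model_space_product(1,2)[OF B\<^sub>1 B\<^sub>2] e(1) Y(3) by blast
qed

subsection \<open>Blaschke factors\<close>

text \<open>The Szego kernel, that is, the reproducing kernel of the Hardy space at
  \<open>a\<close>.\<close>

definition kernel_fun :: "complex \<Rightarrow> complex \<Rightarrow> complex" where
  "kernel_fun a z = 1 / (1 - cnj a * z)"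

definition blaschke_factor :: "complex \<Rightarrow> complex \<Rightarrow> complex" where
  "blaschke_factor a z = (z - a) / (1 - cnj a * z)"

context
  fixes a :: complex
  assumes a: "cmod a < 1"
begin

lemma kernel_denom_bound: "cmod z = 1 \<Longrightarrow> 1 - cmod a \<le> cmod (1 - cnj a * z)"
  using norm_triangle_ineq2[of 1 "cnj a * z"] by (simp add: norm_mult)

lemma kernel_denom_nz: "cmod z = 1 \<Longrightarrow> 1 - cnj a * z \<noteq> 0"
  using kernel_denom_bound[of z] a by auto

lemma bounded_symbol_kernel: "bounded_symbol (kernel_fun a)"
  unfolding bounded_symbol_def
proof (intro conjI exI)
  show "kernel_fun a \<in> borel_measurable borel"
    unfolding kernel_fun_def by measurable
  show "AE z in circle_measure. cmod (kernel_fun a z) \<le> 1 / (1 - cmod a)"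
    using AE_circle
  proof eventually_elim
    case (elim z)
    then show ?case
      using kernel_denom_bound[OF elim] a by (simp add: kernel_fun_def norm_divide frac_le)
  qed
qed

definition kernel :: L2 where
  "kernel = class_L2 (kernel_fun a)"

text \<open>Comparison of coefficients in (1 - cnj a z) k = 1, where k is the kernel.\<close>

lemma kernel_recursion: "cinner kernel (zpow n) - cnj a * cinner kernel (zpow (n - 1)) = (if n = 0 then 1 else 0)"
proof -
  have "kernel - cnj a *\<^sub>C mult_L2 (\<lambda>z. z powi 1) kernel = class_L2 (\<lambda>z. kernel_fun a z - cnj a * (z powi 1 * kernel_fun a z))"
    using bounded_symbol_kernel unfolding kernel_def
    by (simp only: mult_L2_class scaleC_class minus_class bounded_symbol_square_integrable
        bounded_symbol_powi square_integrable_bounded_mult square_integrable_scale)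
  also have "\<dots> = zpow 0"
    unfolding zpow_def
  proof (rule class_L2_eqI)
    show "AE z in circle_measure. kernel_fun a z - cnj a * (z powi 1 * kernel_fun a z) = z powi 0"
      using AE_circle
    proof eventually_elim
      case (elim z)
      then show ?case
        using kernel_denom_nz[OF elim] by (simp add: kernel_fun_def divide_simps)
    qed
  qed (use bounded_symbol_kernel in \<open>simp_all only: square_integrable_diff square_integrable_scale
      square_integrable_bounded_mult bounded_symbol_powi bounded_symbol_square_integrable\<close>)
  finally have "cinner (kernel - cnj a *\<^sub>C mult_L2 (\<lambda>z. z powi 1) kernel) (zpow n) = cinner (zpow 0) (zpow n)"
    by simp
  then show ?thesis
    by (simp only: cinner.diff_left cinner_scaleC_left cinner_mult_powi cinner_zpow eq_commute)
qed

text \<open>Followed downwards from a negative index, the recursion expresses the coefficient as cnj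
  a^m times a coefficient bounded by the norm of the kernel; as |a| < 1, it is 0. No power series is
  summed.\<close>

lemma kernel_H2: "kernel \<in> H2"
  unfolding H2_iff
proof (intro allI impI)
  fix n :: int assume n: "n < 0"
  have step: "cinner kernel (zpow n) = cnj a ^ m * cinner kernel (zpow (n - int m))" for m
  proof (induction m)
    case (Suc m)
    have "cinner kernel (zpow (n - int m)) = cnj a * cinner kernel (zpow (n - int m - 1))"
      using kernel_recursion[of "n - int m"] n by simp
    moreover have "n - int m - 1 = n - int (Suc m)"
      by simp
    ultimately show ?case
      using Suc by (simp only: power_Suc2 mult.assoc)
  qed simp
  have "cmod (cinner kernel (zpow n)) \<le> cmod a ^ m * norm kernel" for m
  proof -
    have "cmod (cinner kernel (zpow (n - int m))) \<le> norm kernel"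
      using cmod_cinner_le[of kernel "zpow (n - int m)"] by simp
    then show ?thesis
      unfolding step[of m] by (simp add: norm_mult norm_power mult_left_mono)
  qed
  moreover have "(\<lambda>m. cmod a ^ m * norm kernel) \<longlonglongrightarrow> 0"
    using a by (intro tendsto_mult_left_zero LIMSEQ_realpow_zero) auto
  ultimately have "cmod (cinner kernel (zpow n)) \<le> 0"
    by (intro LIMSEQ_le_const[of "\<lambda>m. cmod a ^ m * norm kernel"]) auto
  then show "cinner kernel (zpow n) = 0"
    by simp
qed

lemma kernel_coeff: "cinner kernel (zpow (int n)) = cnj a ^ n"
proof (induction n)
  case 0
  then show ?case
    using kernel_recursion[of 0] kernel_H2 by (simp add: H2_iff)
next
  case (Suc n)
  then show ?case
    using kernel_recursion[of "int (Suc n)"] by simp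
qed

text \<open>Identifies kernels from their coefficients in two places: the model space of a Blaschke
  factor and the eigenvectors of the backward shift.\<close>

lemma geometric_coeff_kernel:
  assumes "f \<in> H2" "\<And>n::nat. cinner f (zpow (int (Suc n))) = cnj a * cinner f (zpow (int n))"
  shows "f = cinner f (zpow 0) *\<^sub>C kernel"
proof -
  have coeff: "cinner f (zpow (int n)) = cnj a ^ n * cinner f (zpow 0)" for n
  proof (induction n)
    case (Suc n)
    then show ?case
      unfolding assms(2) by simp
  qed simp
  have "f - cinner f (zpow 0) *\<^sub>C kernel = 0"
  proof (rule L2_eq_0I)
    fix n
    show "cinner (f - cinner f (zpow 0) *\<^sub>C kernel) (zpow n) = 0"
    proof (cases "n < 0")
      case True
      then show ?thesis
        using assms(1) kernel_H2 by (simp add: cinner.diff_left cinner_scaleC_left H2_iff)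
    next
      case False
      then have "n = int (nat n)"
        by simp
      then show ?thesis
        using coeff[of "nat n"] kernel_coeff[of "nat n"] by (simp add: cinner.diff_left cinner_scaleC_left)
    qed
  qed
  then show ?thesis
    by simp
qed

lemma kernel_nz: "kernel \<noteq> 0"
  using kernel_coeff[of 0] by (auto simp: cinner.zero_left)

lemma cmod_blaschke_factor:
  assumes "cmod z = 1"
  shows "cmod (blaschke_factor a z) = 1"
proof -
  have "z * cnj z = 1"
    using assms by (simp flip: complex_norm_square)
  then have "1 - cnj a * z = z * cnj (z - a)"
    by (simp add: algebra_simps)
  then have "cmod (1 - cnj a * z) = cmod (z - a)"
    using assms by (simp only: norm_mult complex_mod_cnj)
  then show ?thesis
    using kernel_denom_nz[OF assms] by (cases "z = a") (auto simp: blaschke_factor_def norm_divide)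
qed

lemma blaschke_factor_measurable: "blaschke_factor a \<in> borel_measurable borel"
  unfolding blaschke_factor_def by measurable

lemma inner_blaschke_factor: "inner_function (blaschke_factor a)"
proof -
  have ae: "AE z in circle_measure. cmod (blaschke_factor a z) = 1"
    using AE_circle by eventually_elim (rule cmod_blaschke_factor)
  then have bs: "bounded_symbol (blaschke_factor a)"
    by (intro bounded_symbol_unimodular blaschke_factor_measurable)
  have "mult_L2 (\<lambda>z. z powi 1) kernel - a *\<^sub>C kernel = class_L2 (\<lambda>z. z powi 1 * kernel_fun a z - a * kernel_fun a z)"
    using bounded_symbol_kernel unfolding kernel_def
    by (simp only: mult_L2_class scaleC_class minus_class bounded_symbol_square_integrable
        bounded_symbol_powi square_integrable_bounded_mult square_integrable_scale)
  also have "\<dots> = class_L2 (blaschke_factor a)"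
    by (intro arg_cong[of _ _ class_L2]) (auto simp: fun_eq_iff kernel_fun_def blaschke_factor_def diff_divide_distrib)
  finally have "class_L2 (blaschke_factor a) \<in> H2"
    using csubspace_diff[OF csubspace_H2 mult_powi_H2[OF _ kernel_H2, of 1] csubspace_scale[OF csubspace_H2 kernel_H2, of a]]
    by simp
  then show ?thesis
    using ae bs by (simp add: inner_function_def bounded_symbol_square_integrable)
qed

text \<open>On the circle the conjugate kernel is z / (z - a), which cancels the numerator of the
  Blaschke factor. The factor z that remains is what makes the kernel orthogonal to all multiples of
  the Blaschke factor.\<close>

lemma cnj_kernel_blaschke:
  assumes "cmod z = 1"
  shows "cnj (kernel_fun a z) * blaschke_factor a z = z powi 1 * kernel_fun a z"
proof -
  have 1: "z * cnj z = 1"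
    using assms by (simp flip: complex_norm_square)
  have "1 - a * cnj z \<noteq> 0"
    using kernel_denom_nz[OF assms] by (metis complex_cnj_cnj complex_cnj_diff complex_cnj_mult complex_cnj_one complex_cnj_zero)
  moreover have "z - a = z * (1 - a * cnj z)"
    using 1 by (simp add: algebra_simps)
  ultimately show ?thesis
    by (simp add: kernel_fun_def blaschke_factor_def)
qed

lemma kernel_in_model_space: "kernel \<in> model_space (blaschke_factor a)"
proof (rule model_spaceI[OF inner_functionD(1)[OF inner_blaschke_factor] kernel_H2])
  note bf = inner_functionD(1)[OF inner_blaschke_factor]
  fix n :: int assume n: "0 \<le> n"
  have kernel_eq: "kernel = mult_L2 (kernel_fun a) (zpow 0)"
    using bounded_symbol_kernel by (simp add: kernel_def zpow_def mult_L2_class)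
  have "cinner (mult_L2 (blaschke_factor a) (zpow n)) kernel =
      cinner (mult_L2 (\<lambda>z. cnj (kernel_fun a z)) (mult_L2 (blaschke_factor a) (zpow n))) (zpow 0)"
    unfolding kernel_eq by (subst (2) cinner_mult_L2) (simp_all add: bounded_symbol_cnj bounded_symbol_kernel)
  also have "mult_L2 (\<lambda>z. cnj (kernel_fun a z)) (mult_L2 (blaschke_factor a) (zpow n)) =
      mult_L2 (\<lambda>z. cnj (kernel_fun a z) * blaschke_factor a z) (zpow n)"
    by (intro mult_L2_mult_L2 bounded_symbol_cnj bounded_symbol_kernel bf)
  also have "\<dots> = mult_L2 (\<lambda>z. z powi 1 * kernel_fun a z) (zpow n)"
  proof (rule mult_L2_cong)
    show "AE z in circle_measure. cnj (kernel_fun a z) * blaschke_factor a z = z powi 1 * kernel_fun a z"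
      using AE_circle by eventually_elim (rule cnj_kernel_blaschke)
  qed (intro bounded_symbol_mult bounded_symbol_cnj bounded_symbol_kernel bf bounded_symbol_powi)+
  also have "\<dots> = mult_L2 (\<lambda>z. z powi 1) (mult_L2 (kernel_fun a) (zpow n))"
    by (intro mult_L2_mult_L2[symmetric] bounded_symbol_kernel bounded_symbol_powi)
  also have "mult_L2 (kernel_fun a) (zpow n) = mult_L2 (\<lambda>z. z powi n) kernel"
    using bounded_symbol_kernel
    by (simp add: kernel_def zpow_def mult_L2_class bounded_symbol_square_integrable mult.commute)
  also have "cinner (mult_L2 (\<lambda>z. z powi 1) (mult_L2 (\<lambda>z. z powi n) kernel)) (zpow 0) = 0"
    unfolding cinner_mult_powi using kernel_H2 n by (simp add: H2_iff)
  finally show "cinner kernel (mult_L2 (blaschke_factor a) (zpow n)) = 0"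
    by (metis cinner_commute complex_cnj_zero)
qed

lemma model_space_blaschke_factor:
  assumes u: "u \<in> model_space (blaschke_factor a)"
  shows "u = cinner u (zpow 0) *\<^sub>C kernel"
proof (rule geometric_coeff_kernel[OF model_space_H2[OF u]])
  fix n :: nat
  note bf = inner_functionD(1)[OF inner_blaschke_factor]
  \<comment> \<open>\<open>h\<close> is (1 - cnj a z) z^n, chosen to cancel the denominator of the
    Blaschke factor; orthogonality to the remaining z^(n+1) - a z^n is the geometric
    recursion.\<close>
  define h where "h = zpow (int n) - cnj a *\<^sub>C zpow (int (Suc n))"
  have "h \<in> H2"
    unfolding h_def by (intro csubspace_diff csubspace_scale csubspace_H2 zpow_H2) auto
  have h_class: "h = class_L2 (\<lambda>z. z powi int n - cnj a * z powi int (Suc n))"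
    unfolding h_def zpow_def by (simp only: scaleC_class minus_class square_integrable_powi square_integrable_scale)
  have sq: "square_integrable (\<lambda>z. z powi int n - cnj a * z powi int (Suc n))"
    by (intro square_integrable_diff square_integrable_scale square_integrable_powi)
  have "mult_L2 (blaschke_factor a) h = class_L2 (\<lambda>z. blaschke_factor a z * (z powi int n - cnj a * z powi int (Suc n)))"
    unfolding h_class by (rule mult_L2_class[OF bf sq])
  also have "\<dots> = class_L2 (\<lambda>z. z powi int (Suc n) - a * z powi int n)"
  proof (rule class_L2_eqI)
    show "AE z in circle_measure. blaschke_factor a z * (z powi int n - cnj a * z powi int (Suc n)) = z powi int (Suc n) - a * z powi int n"
      using AE_circle
    proof eventually_elim
      case (elim z)
      have "z powi int n - cnj a * z powi int (Suc n) = (1 - cnj a * z) * z ^ n"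
        unfolding power_int_of_nat by (simp add: algebra_simps)
      moreover have "z powi int (Suc n) - a * z powi int n = (z - a) * z ^ n"
        unfolding power_int_of_nat by (simp add: algebra_simps)
      ultimately show ?case
        using kernel_denom_nz[OF elim] by (simp add: blaschke_factor_def)
    qed
  qed (intro square_integrable_bounded_mult bf sq square_integrable_diff square_integrable_scale square_integrable_powi)+
  also have "\<dots> = zpow (int (Suc n)) - a *\<^sub>C zpow (int n)"
    unfolding zpow_def by (simp only: scaleC_class minus_class square_integrable_powi square_integrable_scale)
  finally have "mult_L2 (blaschke_factor a) h = zpow (int (Suc n)) - a *\<^sub>C zpow (int n)" .
  moreover have "cinner u (mult_L2 (blaschke_factor a) h) = 0"
    using u \<open>h \<in> H2\<close> by (simp add: model_space_def)
  ultimately have "cinner u (zpow (int (Suc n)) - a *\<^sub>C zpow (int n)) = 0"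
    by (simp only:)
  then show "cinner u (zpow (int (Suc n))) = cnj a * cinner u (zpow (int n))"
    by (simp add: cinner.diff_right cinner_scaleC_right del: of_nat_Suc)
qed

definition unit_kernel :: L2 where
  "unit_kernel = of_real (1 / norm kernel) *\<^sub>C kernel"

lemma unit_kernel: "unit_kernel \<in> model_space (blaschke_factor a)" "cinner unit_kernel unit_kernel = 1"
proof -
  show "unit_kernel \<in> model_space (blaschke_factor a)"
    unfolding unit_kernel_def by (intro csubspace_scale csubspace_model_space kernel_in_model_space)
  have "norm unit_kernel = 1"
    using kernel_nz by (simp add: unit_kernel_def norm_scaleC norm_divide)
  then show "cinner unit_kernel unit_kernel = 1"
    by (simp add: cinner_self)
qed

lemma unit_kernel_orthogonal:
  assumes "cinner u unit_kernel = 0" "e \<in> model_space (blaschke_factor a)"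
  shows "cinner u e = 0"
proof -
  have "cinner u kernel = 0"
    using assms(1) kernel_nz by (simp add: unit_kernel_def cinner_scaleC_right)
  then show ?thesis
    using model_space_blaschke_factor[OF assms(2)] by (metis cinner_scaleC_right mult_zero_right)
qed

end

text \<open>Each new factor contributes its normalized kernel, and multiplication by it carries the
  old basis along. The result is a Takenaka-Malmquist basis.\<close>

lemma blaschke_basis:
  assumes "cmod c = 1" "\<And>i. i < n \<Longrightarrow> cmod (a i) < 1"
  shows "inner_function (\<lambda>z. c * (\<Prod>i<n. blaschke_factor (a i) z)) \<and>
    (\<exists>X. corthonormal X \<and> finite X \<and> card X = n \<and>
      closure (cspan X) = model_space (\<lambda>z. c * (\<Prod>i<n. blaschke_factor (a i) z)))"
  using assms(2)
proof (induction n)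
  case 0
  have "closure (cspan {}) = model_space (\<lambda>z. c)"
    using assms(1) by (simp add: cspan_eq model_space_const)
  then have "\<exists>X. corthonormal X \<and> finite X \<and> card X = 0 \<and> closure (cspan X) = model_space (\<lambda>z. c)"
    by (intro exI[of _ "{}"]) (simp add: corthonormal_def)
  then show ?case
    using inner_function_const[OF assms(1)] by simp
next
  case (Suc n)
  define B\<^sub>2 where "B\<^sub>2 = (\<lambda>z. c * (\<Prod>i<n. blaschke_factor (a i) z))"
  have an: "cmod (a n) < 1"
    using Suc.prems by simp
  obtain Y where B\<^sub>2: "inner_function B\<^sub>2" and Y: "corthonormal Y" "finite Y" "card Y = n" "closure (cspan Y) = model_space B\<^sub>2"
    using Suc unfolding B\<^sub>2_def by auto
  have Y_sub: "Y \<subseteq> model_space B\<^sub>2"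
    using Y(4) subset_closure_cspan[of Y] by simp
  note B\<^sub>1 = inner_blaschke_factor[OF an]
  define X where "X = insert (unit_kernel (a n)) (mult_L2 (blaschke_factor (a n)) ` Y)"
  have eq: "(\<lambda>z. c * (\<Prod>i<Suc n. blaschke_factor (a i) z)) = (\<lambda>z. blaschke_factor (a n) z * B\<^sub>2 z)"
    by (simp add: B\<^sub>2_def fun_eq_iff)
  note prod = corthonormal_product[OF B\<^sub>1 B\<^sub>2 unit_kernel[OF an] Y(1,2) Y_sub, folded X_def]
  have "closure (cspan X) = model_space (\<lambda>z. blaschke_factor (a n) z * B\<^sub>2 z)"
  proof (rule closure_cspan_eqI[OF csubspace_model_space complete_model_space prod(3)])
    fix u assume u: "u \<in> model_space (\<lambda>z. blaschke_factor (a n) z * B\<^sub>2 z)"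
      and orth: "\<And>g. g \<in> X \<Longrightarrow> cinner u g = 0"
    show "u = 0"
    proof (rule model_space_product(4)[OF B\<^sub>1 B\<^sub>2 u])
      show "cinner u e = 0" if "e \<in> model_space (blaschke_factor (a n))" for e
        using unit_kernel_orthogonal[OF an _ that] orth by (simp add: X_def)
      fix f assume f: "f \<in> model_space B\<^sub>2"
      have "mult_L2 (blaschke_factor (a n)) f \<in> {y. cinner u y = 0}"
      proof (rule closure_cspan_image[OF bounded_linear_mult_L2 mult_L2_scaleC csubspace_cinner_right closed_cinner_right])
        show "f \<in> closure (cspan Y)"
          using f Y(4) by simp
        show "mult_L2 (blaschke_factor (a n)) g \<in> {y. cinner u y = 0}" if "g \<in> Y" for g
          using that orth by (simp add: X_def)
      qed (rule inner_functionD(1)[OF B\<^sub>1])+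
      then show "cinner u (mult_L2 (blaschke_factor (a n)) f) = 0"
        by simp
    qed
  qed
  moreover have "finite X"
    using Y(2) by (simp add: X_def)
  ultimately show ?case
    unfolding eq using prod Y(3) inner_function_mult[OF B\<^sub>1 B\<^sub>2] by blast
qed


subsection \<open>Eigenvectors\<close>

text \<open>In finite dimension some nonzero polynomial p in T annihilates f. One of least degree is
  not constant, so it has a root c, and p = (X - c) q; by minimality q(T) f is not 0, and it is an
  eigenvector with eigenvalue c.\<close>

lemma eigenvector_exists:
  fixes T :: "'a::complex_inner \<Rightarrow> 'a"
  assumes K: "csubspace K" "K \<subseteq> cspan X" "finite X"
    and add: "\<And>x y. T (x + y) = T x + T y" and scale: "\<And>c x. T (c *\<^sub>C x) = c *\<^sub>C T x"
    and T: "\<And>x. x \<in> K \<Longrightarrow> T x \<in> K" and f: "f \<in> K" "f \<noteq> 0"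
  shows "\<exists>c g. g \<in> K \<and> g \<noteq> 0 \<and> T g = c *\<^sub>C g"
proof -
  have T0: "T 0 = 0"
    using scale[of 0 0] by simp
  \<comment> \<open>\<open>ev p\<close> is p(T) f, evaluated by Horner's scheme from the
    coefficients.\<close>
  define ev where "ev p = fold_coeffs (\<lambda>a v. a *\<^sub>C f + T v) p 0" for p
  have ev_0: "ev 0 = 0"
    by (simp add: ev_def)
  have ev_pCons: "ev (pCons a p) = a *\<^sub>C f + T (ev p)" for a p
    by (cases "p = 0 \<and> a = 0") (auto simp: ev_def T0)
  have ev_add: "ev (p + q) = ev p + ev q" for p q
  proof (induction p q rule: poly_induct2)
    case (pCons a p b q)
    then show ?case
      by (simp add: ev_pCons add scaleC_add_left)
  qed (simp add: ev_0)
  have ev_smult: "ev (smult c p) = c *\<^sub>C ev p" for c p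
    by (induction p) (simp_all add: ev_0 ev_pCons scaleC_add_right scale scaleC_scaleC)
  have ev_monom: "ev (monom 1 n) = (T ^^ n) f" for n
    by (induction n) (simp_all add: monom_0 monom_Suc ev_pCons ev_0 T0)
  have ev_K: "ev p \<in> K" for p
    by (induction p) (auto simp: ev_0 ev_pCons intro: csubspace_0 csubspace_add csubspace_scale T f K)
  define S where "S n = (\<lambda>i. (T ^^ i) f) ` {..<n}" for n
  have "\<exists>n. (T ^^ n) f \<in> cvs.span (S n)"
  proof (rule ccontr)
    assume "\<not> ?thesis"
    then have out: "(T ^^ n) f \<notin> cvs.span (S n)" for n
      by blast
    have S: "\<not> cvs.dependent (S n) \<and> card (S n) = n" for n
    proof (induction n)
      case (Suc n)
      have "(T ^^ n) f \<notin> S n"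
        using out[of n] cvs.span_superset by blast
      then show ?case
        using Suc out[of n] by (simp add: S_def lessThan_Suc cvs.independent_insert)
    qed (simp add: S_def cvs.independent_empty)
    have "(T ^^ i) f \<in> K" for i
      using ev_K[of "monom 1 i"] by (simp add: ev_monom)
    then have "S (Suc (card X)) \<subseteq> cvs.span X"
      using K(2) by (auto simp: S_def cspan_eq)
    then have "card (S (Suc (card X))) \<le> card X"
      using cvs.independent_span_bound[OF K(3)] S by blast
    then show False
      using S by simp
  qed
  then obtain n where n: "(T ^^ n) f \<in> cvs.span (S n)"
    by blast
  \<comment> \<open>The combinations of the first n iterates. Bounding the support of the
    coefficients, not the degree, also covers n = 0 and ensures that subtracting such a q from X^n
    leaves the leading coefficient 1.\<close>
  define Q where "Q = {ev q |q. \<forall>i\<ge>n. coeff q i = 0}"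
  have "csubspace Q"
    unfolding csubspace_def
  proof (intro conjI ballI allI)
    show "0 \<in> Q"
      unfolding Q_def by (intro CollectI exI[of _ 0]) (simp add: ev_0)
    show "x + y \<in> Q" if xy: "x \<in> Q" "y \<in> Q" for x y
    proof -
      obtain p q where "x = ev p" "\<forall>i\<ge>n. coeff p i = 0" "y = ev q" "\<forall>i\<ge>n. coeff q i = 0"
        using xy unfolding Q_def by blast
      then show ?thesis
        unfolding Q_def by (intro CollectI exI[of _ "p + q"]) (simp add: ev_add)
    qed
    show "c *\<^sub>C x \<in> Q" if x: "x \<in> Q" for c x
    proof -
      obtain p where "x = ev p" "\<forall>i\<ge>n. coeff p i = 0"
        using x unfolding Q_def by blast
      then show ?thesis
        unfolding Q_def by (intro CollectI exI[of _ "smult c p"]) (simp add: ev_smult)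
    qed
  qed
  moreover have "S n \<subseteq> Q"
  proof
    fix x assume "x \<in> S n"
    then obtain i where "i < n" "x = ev (monom 1 i)"
      by (auto simp: S_def ev_monom)
    then show "x \<in> Q"
      unfolding Q_def by (intro CollectI exI[of _ "monom 1 i"]) auto
  qed
  ultimately have "(T ^^ n) f \<in> Q"
    using n cvs.span_minimal[of "S n" Q] by (auto simp: csubspace_iff)
  then obtain q where q: "(T ^^ n) f = ev q" "\<forall>i\<ge>n. coeff q i = 0"
    unfolding Q_def by blast
  define p0 where "p0 = monom 1 n + smult (-1) q"
  have "ev p0 = 0"
    unfolding p0_def ev_add ev_smult ev_monom q(1) by simp
  moreover have "coeff p0 n = 1"
    using q(2) by (simp add: p0_def)
  then have "p0 \<noteq> 0"
    by auto
  ultimately have ex: "\<exists>p. p \<noteq> 0 \<and> ev p = 0"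
    by blast
  define p where "p = (ARG_MIN degree p. p \<noteq> 0 \<and> ev p = 0)"
  have p: "p \<noteq> 0" "ev p = 0" and min: "\<And>q. q \<noteq> 0 \<Longrightarrow> ev q = 0 \<Longrightarrow> degree p \<le> degree q"
    unfolding p_def using arg_min_nat_lemma[of "\<lambda>p. p \<noteq> 0 \<and> ev p = 0" p0 degree]
      \<open>ev p0 = 0\<close> \<open>p0 \<noteq> 0\<close> by auto
  have "degree p \<noteq> 0"
  proof
    assume "degree p = 0"
    then obtain a where "p = [:a:]"
      by (rule degree_eq_zeroE)
    then show False
      using p f(2) by (auto simp: ev_pCons ev_0 T0)
  qed
  then obtain c where "poly p c = 0"
    using fundamental_theorem_of_algebra[of p] by (auto simp: constant_degree)
  then obtain q where q: "p = [:- c, 1:] * q"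
    unfolding poly_eq_0_iff_dvd by (auto simp: dvd_def)
  have "q \<noteq> 0"
    using p(1) q by auto
  then have "degree q < degree p"
    unfolding q by (subst degree_mult_eq) auto
  then have "ev q \<noteq> 0"
    using min[OF \<open>q \<noteq> 0\<close>] by auto
  have "p = smult (- c) q + pCons 0 q"
    by (simp add: q)
  then have "- c *\<^sub>C ev q + T (ev q) = 0"
    using p(2) by (simp only: ev_add ev_smult ev_pCons) simp
  then have "T (ev q) = c *\<^sub>C ev q"
    by (simp add: add_eq_0_iff2)
  then show ?thesis
    using ev_K \<open>ev q \<noteq> 0\<close> by blast
qed

lemma card_corthonormal_le:
  assumes "corthonormal Y" "Y \<subseteq> cspan X" "finite X"
  shows "finite Y \<and> card Y \<le> card X"
  using cvs.independent_span_bound[OF assms(3) independent_corthonormal[OF assms(1)]] assms(2)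
  by (simp add: cspan_eq)

text \<open>An orthonormal system in \<open>K\<close> of largest cardinality spans \<open>K\<close>,
  since otherwise a Gram-Schmidt step would enlarge it.\<close>

lemma finite_span_if_bounded:
  fixes K :: "'a::complex_inner set"
  assumes K: "csubspace K" and bound: "\<And>Y. corthonormal Y \<Longrightarrow> finite Y \<Longrightarrow> Y \<subseteq> K \<Longrightarrow> card Y \<le> n"
  shows "\<exists>X. finite X \<and> K \<subseteq> cspan X"
proof -
  let ?P = "\<lambda>Y. corthonormal Y \<and> finite Y \<and> Y \<subseteq> K"
  have "?P {}"
    by (simp add: corthonormal_def)
  moreover have "\<forall>Y. ?P Y \<longrightarrow> card Y < Suc n"
    using bound by (simp add: less_Suc_eq_le)
  ultimately have "\<exists>X. ?P X \<and> (\<forall>Y. ?P Y \<longrightarrow> card Y \<le> card X)"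
    by (rule ex_has_greatest_nat)
  then obtain X where X: "?P X" "\<And>Y. ?P Y \<Longrightarrow> card Y \<le> card X"
    by blast
  have "u \<in> cspan X" if u: "u \<in> K" for u
  proof (rule ccontr)
    assume "u \<notin> cspan X"
    then obtain e where e: "e \<notin> X" "e \<in> cspan (insert u X)" "corthonormal (insert e X)"
      using corthonormal_extend[of X u] X(1) by blast
    have "cspan (insert u X) \<subseteq> K"
      using X(1) u K by (intro cspan_minimal) auto
    then have "card (insert e X) \<le> card X"
      using X(1) e by (intro X(2)) auto
    then show False
      using X(1) e(1) by simp
  qed
  then show ?thesis
    using X(1) by blast
qed

subsection \<open>Finite-dimensional model spaces\<close>

lemma backward_shift_add: "backward_shift (f + g) = backward_shift f + backward_shift g"
  unfolding backward_shift_def mult_L2_add[OF bounded_symbol_powi, symmetric]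
  by (rule arg_cong[of _ _ "mult_L2 _"]) (simp add: cinner_add_left scaleC_add_left)

lemma backward_shift_scaleC: "backward_shift (c *\<^sub>C f) = c *\<^sub>C backward_shift f"
  unfolding backward_shift_def mult_L2_scaleC[OF bounded_symbol_powi, symmetric]
  by (simp add: cinner_scaleC_left cvs.scale_right_diff_distrib scaleC_scaleC)

text \<open>After multiplying both arguments by z, the inner product of the shifted vector with B
  z^n becomes that of f - f(0) with B z^(n+1). The part with f vanishes by hypothesis, the constant
  part because n + 1 > 0.\<close>

lemma backward_shift_model_space:
  assumes B: "inner_function B" and f: "f \<in> model_space B"
  shows "backward_shift f \<in> model_space B"
proof (rule model_spaceI[OF inner_functionD(1)[OF B]])
  show "backward_shift f \<in> H2"
    by (rule backward_shift_H2[OF model_space_H2[OF f]])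
  fix n :: int assume n: "n \<ge> 0"
  have uni: "AE z in circle_measure. cmod (z powi 1) = 1"
    using AE_circle by (simp add: norm_power_int)
  have "cinner (backward_shift f) (mult_L2 B (zpow n)) =
      cinner (mult_L2 (\<lambda>z. z powi 1) (backward_shift f)) (mult_L2 (\<lambda>z. z powi 1) (mult_L2 B (zpow n)))"
    by (rule cinner_mult_L2_unimodular[OF bounded_symbol_powi uni, symmetric])
  also have "mult_L2 (\<lambda>z. z powi 1) (mult_L2 B (zpow n)) = mult_L2 B (mult_L2 (\<lambda>z. z powi 1) (zpow n))"
    using inner_functionD(1)[OF B] bounded_symbol_powi[of 1] by (simp only: mult_L2_mult_L2 mult.commute)
  also have "cinner (mult_L2 (\<lambda>z. z powi 1) (backward_shift f)) (mult_L2 B (mult_L2 (\<lambda>z. z powi 1) (zpow n))) =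
      cinner f (mult_L2 B (zpow (1 + n))) - cinner f (zpow 0) * cinner (zpow 0) (mult_L2 B (zpow (1 + n)))"
    unfolding mult_backward_shift mult_zpow by (simp add: cinner.diff_left cinner_scaleC_left)
  also have "cinner f (mult_L2 B (zpow (1 + n))) = 0"
    using f n zpow_H2[of "1 + n"] by (simp add: model_space_def)
  also have "cinner (zpow 0) (mult_L2 B (zpow (1 + n))) = 0"
  proof -
    have "mult_L2 B (zpow (1 + n)) = mult_L2 (\<lambda>z. z powi (1 + n)) (class_L2 B)"
      unfolding zpow_def using inner_functionD(1,2)[OF B]
      by (simp only: mult_L2_class bounded_symbol_powi square_integrable_powi mult.commute)
    then have "cinner (mult_L2 B (zpow (1 + n))) (zpow 0) = 0"
      using inner_functionD(3)[OF B] n by (simp only: cinner_mult_powi) (simp add: H2_iff)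
    then show ?thesis
      by (metis cinner_commute complex_cnj_zero)
  qed
  finally show "cinner (backward_shift f) (mult_L2 B (zpow n)) = 0"
    by simp
qed

text \<open>The coefficients form a geometric sequence with ratio c, so f(0) = 0 would force f = 0.
  The backward shift lowers the squared norm by |f(0)|^2, which gives |c| < 1. The eigenvector for c
  is a multiple of the kernel at cnj c.\<close>

lemma backward_shift_eigenvalue:
  assumes f: "f \<in> H2" "f \<noteq> 0" and eig: "backward_shift f = c *\<^sub>C f"
  shows "cmod c < 1" "cinner f (zpow 0) \<noteq> 0" "f = cinner f (zpow 0) *\<^sub>C kernel (cnj c)"
proof -
  have coeff: "cinner f (zpow (int (Suc n))) = c * cinner f (zpow (int n))" for n
  proof -
    have "cinner (backward_shift f) (zpow (int n)) = cinner f (zpow (int (Suc n)))"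
      by (simp add: cinner_backward_shift add.commute)
    then show ?thesis
      unfolding eig by (simp add: cinner_scaleC_left)
  qed
  show f0: "cinner f (zpow 0) \<noteq> 0"
  proof
    assume 0: "cinner f (zpow 0) = 0"
    have nat0: "cinner f (zpow (int n)) = 0" for n
    proof (induction n)
      case (Suc n)
      then show ?case
        unfolding coeff by simp
    qed (simp add: 0)
    have "cinner f (zpow n) = 0" for n
      using f(1) nat0[of "nat n"] by (cases "n < 0") (auto simp: H2_iff)
    then show False
      using f(2) L2_eq_0I by blast
  qed
  define f0 where "f0 = cinner f (zpow 0)"
  have uni: "AE z in circle_measure. cmod (z powi (-1)) = 1"
    using AE_circle by eventually_elim (simp add: norm_inverse)
  have "cinner (c *\<^sub>C f) (c *\<^sub>C f) = cinner (f - f0 *\<^sub>C zpow 0) (f - f0 *\<^sub>C zpow 0)"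
    unfolding eig[symmetric] backward_shift_def f0_def
    by (rule cinner_mult_L2_unimodular[OF bounded_symbol_powi uni])
  also have "\<dots> = cinner f f - f0 * cnj f0"
    using cinner_commute[of "zpow 0" f]
    by (simp add: cinner.diff_left cinner.diff_right cinner_scaleC_left cinner_scaleC_right cinner_zpow f0_def)
  finally have "complex_of_real ((cmod c)\<^sup>2 * (norm f)\<^sup>2) = of_real ((norm f)\<^sup>2 - (cmod f0)\<^sup>2)"
    by (simp add: cinner_self norm_scaleC power_mult_distrib flip: complex_norm_square)
  then have "(cmod c)\<^sup>2 * (norm f)\<^sup>2 = (norm f)\<^sup>2 - (cmod f0)\<^sup>2"
    by (simp only: of_real_eq_iff)
  moreover have "(cmod f0)\<^sup>2 > 0"
    using f0 by (simp add: f0_def)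
  ultimately have "(cmod c)\<^sup>2 * (norm f)\<^sup>2 < 1 * (norm f)\<^sup>2"
    by linarith
  then have "(cmod c)\<^sup>2 < 1"
    by (rule mult_right_less_imp_less) simp
  then show c: "cmod c < 1"
    by (simp add: power2_less_1_iff abs_square_less_1)
  show "f = cinner f (zpow 0) *\<^sub>C kernel (cnj c)"
    using c f(1) coeff by (intro geometric_coeff_kernel) simp_all
qed

text \<open>The quotient is unimodular, so only its negative Fourier coefficients matter. Each
  equals the inner product of B h with the kernel for some h in the Hardy space, which is 0 because
  the kernel is in the model space of B.\<close>

lemma kernel_divides:
  assumes a: "cmod a < 1" and B: "inner_function B" and kernel: "kernel a \<in> model_space B"
  shows "inner_function (\<lambda>z. cnj (blaschke_factor a z) * B z)"
proof -
  note BD = inner_functionD[OF B] and bf = inner_functionD[OF inner_blaschke_factor[OF a]]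
  have "mult_L2 (\<lambda>z. cnj (blaschke_factor a z)) (class_L2 B) \<in> H2"
    unfolding H2_iff
  proof (intro allI impI)
    fix n :: int assume n: "n < 0"
    \<comment> \<open>\<open>h\<close> is (1 - cnj a z) z^(-n-1): on the circle, the conjugate
      Blaschke factor times z^(-n) is \<open>h\<close> times the conjugate kernel. Both exponents in
      \<open>h\<close> are nonnegative because n < 0.\<close>
    define h where "h = zpow (- n - 1) - cnj a *\<^sub>C zpow (- n)"
    have "h \<in> H2"
      unfolding h_def using n by (intro csubspace_diff csubspace_scale csubspace_H2 zpow_H2) auto
    have h_class: "h = class_L2 (\<lambda>z. z powi (- n - 1) - cnj a * z powi (- n))"
      unfolding h_def zpow_def by (simp only: scaleC_class minus_class square_integrable_powi square_integrable_scale)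
    have sq: "square_integrable (\<lambda>z. z powi (- n - 1) - cnj a * z powi (- n))"
      by (intro square_integrable_diff square_integrable_scale square_integrable_powi)
    have "cinner (mult_L2 (\<lambda>z. cnj (blaschke_factor a z)) (class_L2 B)) (zpow n) =
        (\<integral>z. (cnj (blaschke_factor a z) * B z) * cnj (z powi n) \<partial>circle_measure)"
      unfolding zpow_def mult_L2_class[OF bounded_symbol_cnj[OF bf(1)] BD(2)]
      by (intro cinner_class square_integrable_bounded_mult bounded_symbol_cnj bf BD square_integrable_powi)
    also have "\<dots> = (\<integral>z. (B z * (z powi (- n - 1) - cnj a * z powi (- n))) * cnj (kernel_fun a z) \<partial>circle_measure)"
    proof (rule integral_cong_AE)
      show "AE z in circle_measure. (cnj (blaschke_factor a z) * B z) * cnj (z powi n) =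
          (B z * (z powi (- n - 1) - cnj a * z powi (- n))) * cnj (kernel_fun a z)"
        using AE_circle AE_cnj_powi[of n]
      proof eventually_elim
        case (elim z)
        have 1: "z * cnj z = 1"
          using elim(1) by (simp flip: complex_norm_square)
        then have "z \<noteq> 0"
          by auto
        have "z powi (- n) = z powi (- n - 1) * z"
          using power_int_add_1[of z "- n - 1"] \<open>z \<noteq> 0\<close> by simp
        moreover have "cnj (blaschke_factor a z) = (cnj z - cnj a) * cnj (kernel_fun a z)"
          by (simp add: blaschke_factor_def kernel_fun_def)
        moreover have "(cnj z - cnj a) * z = 1 - cnj a * z"
          using 1 by (simp add: algebra_simps)
        moreover have "(p * k * x) * (w * z) = (p * z) * (k * x * w)" for p k x w
          by simp
        ultimately have "cnj (blaschke_factor a z) * B z * z powi (- n) =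
            (1 - cnj a * z) * (cnj (kernel_fun a z) * B z * z powi (- n - 1))"
          by (simp only:)
        then show ?case
          unfolding elim(2) \<open>z powi (- n) = z powi (- n - 1) * z\<close> by (simp only:) (simp add: algebra_simps)
      qed
    qed (use bf(5) BD(5) bounded_symbol_measurable[OF bounded_symbol_kernel[OF a]] in
        \<open>simp_all only: borel_measurable_circle_measure, measurable\<close>)
    also have "\<dots> = cinner (mult_L2 B h) (kernel a)"
      unfolding h_class kernel_def[OF a] mult_L2_class[OF BD(1) sq]
      by (intro cinner_class[symmetric] square_integrable_bounded_mult BD sq
          bounded_symbol_square_integrable bounded_symbol_kernel a)
    also have "cinner (kernel a) (mult_L2 B h) = 0"
      using kernel \<open>h \<in> H2\<close> by (simp add: model_space_def)
    then have "cinner (mult_L2 B h) (kernel a) = 0"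
      by (metis cinner_commute complex_cnj_zero)
    finally show "cinner (mult_L2 (\<lambda>z. cnj (blaschke_factor a z)) (class_L2 B)) (zpow n) = 0" .
  qed
  moreover have "mult_L2 (\<lambda>z. cnj (blaschke_factor a z)) (class_L2 B) = class_L2 (\<lambda>z. cnj (blaschke_factor a z) * B z)"
    by (rule mult_L2_class[OF bounded_symbol_cnj[OF bf(1)] BD(2)])
  moreover have "AE z in circle_measure. cmod (cnj (blaschke_factor a z) * B z) = 1"
    using bf(4) BD(4) by eventually_elim (simp add: norm_mult)
  ultimately show ?thesis
    unfolding inner_function_def
    using square_integrable_bounded_mult[OF bounded_symbol_cnj[OF bf(1)] BD(2)] by simp
qed

section \<open>From finite-dimensional model spaces to finite Blaschke products, and the dimension
  count\<close>

lemma finite_blaschke_product_alt: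
  "finite_blaschke_product n B \<longleftrightarrow> (\<exists>c a. cmod c = 1 \<and> (\<forall>i<n. cmod (a i) < 1) \<and>
     (AE z in circle_measure. B z = c * (\<Prod>i<n. blaschke_factor (a i) z)))"
  by (simp add: finite_blaschke_product_def blaschke_factor_def)

lemma finite_blaschke_product_0:
  "\<exists>c. cmod c = 1 \<and> (AE z in circle_measure. B z = c) \<Longrightarrow> finite_blaschke_product 0 B"
  by (auto simp: finite_blaschke_product_def)

lemma finite_blaschke_product_Suc:
  assumes a: "cmod a < 1" and B: "finite_blaschke_product n (\<lambda>z. cnj (blaschke_factor a z) * B z)"
  shows "finite_blaschke_product (Suc n) B"
proof -
  obtain c d where cd: "cmod c = 1" "\<forall>i<n. cmod (d i) < 1"
    "AE z in circle_measure. cnj (blaschke_factor a z) * B z = c * (\<Prod>i<n. blaschke_factor (d i) z)"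
    using B unfolding finite_blaschke_product_alt by blast
  define d' where "d' = d(n := a)"
  have "AE z in circle_measure. B z = c * (\<Prod>i<Suc n. blaschke_factor (d' i) z)"
    using cd(3) AE_circle
  proof eventually_elim
    case (elim z)
    have "blaschke_factor a z * cnj (blaschke_factor a z) = 1"
      using cmod_blaschke_factor[OF a elim(2)] by (simp flip: complex_norm_square)
    then have "B z = blaschke_factor a z * (cnj (blaschke_factor a z) * B z)"
      by (simp flip: mult.assoc)
    then show ?case
      unfolding elim(1) by (simp add: d'_def)
  qed
  then show ?thesis
    unfolding finite_blaschke_product_alt using cd(1,2) a
    by (intro exI[of _ c] exI[of _ d']) (auto simp: d'_def less_Suc_eq)
qed

text \<open>Induction on a bound for finite orthonormal systems. If the kernel at the origin is 0,
  then B is constant. Otherwise the backward shift has an eigenvector in the model space, which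
  splits off a Blaschke factor; a system for the quotient, enlarged by the unit kernel, is one for
  B, so the bound drops by one.\<close>

lemma finite_dim_imp_blaschke:
  assumes "inner_function B" "\<And>Y. corthonormal Y \<Longrightarrow> finite Y \<Longrightarrow> Y \<subseteq> model_space B \<Longrightarrow> card Y \<le> n"
  shows "\<exists>m. finite_blaschke_product m B"
  using assms
proof (induction n arbitrary: B)
  case 0
  have "model_zpow B 0 = 0"
  proof (rule ccontr)
    assume nz: "model_zpow B 0 \<noteq> 0"
    then obtain e where e: "e \<in> cspan (insert (model_zpow B 0) {})" "corthonormal (insert e {})"
      using corthonormal_extend[of "{}" "model_zpow B 0"] by (auto simp: corthonormal_def cspan_eq)
    have "cspan (insert (model_zpow B 0) {}) \<subseteq> model_space B"
      using model_zpow_in[OF "0.prems"(1), of 0] by (intro cspan_minimal csubspace_model_space) auto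
    then have "card {e} \<le> 0"
      using e by (intro "0.prems"(2)) auto
    then show False
      by simp
  qed
  then show ?case
    using finite_blaschke_product_0[OF constant_if_model_zpow_0[OF "0.prems"(1)]] by blast
next
  case (Suc n)
  note B = Suc.prems(1)
  show ?case
  proof (cases "model_zpow B 0 = 0")
    case True
    then show ?thesis
      using finite_blaschke_product_0[OF constant_if_model_zpow_0[OF B]] by blast
  next
    case False
    obtain X where X: "finite X" "model_space B \<subseteq> cspan X"
      using finite_span_if_bounded[OF csubspace_model_space Suc.prems(2)] by blast
    have "model_zpow B 0 \<in> model_space B"
      using model_zpow_in[OF B] by blast
    then obtain c g where g: "g \<in> model_space B" "g \<noteq> 0" "backward_shift g = c *\<^sub>C g"
      using eigenvector_exists[OF csubspace_model_space X(2,1) backward_shift_add backward_shift_scaleC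
          backward_shift_model_space[OF B] _ False] by blast
    note eig = backward_shift_eigenvalue[OF model_space_H2[OF g(1)] g(2,3)]
    define a where "a = cnj c"
    have a: "cmod a < 1"
      using eig(1) by (simp add: a_def)
    define g0 where "g0 = cinner g (zpow 0)"
    have "kernel a = inverse g0 *\<^sub>C g"
      using eig(2) arg_cong[OF eig(3), of "scaleC (inverse g0)"]
      by (simp add: a_def g0_def scaleC_scaleC)
    then have kernel: "kernel a \<in> model_space B"
      using csubspace_scale[OF csubspace_model_space g(1)] by simp
    define B' where "B' = (\<lambda>z. cnj (blaschke_factor a z) * B z)"
    have B': "inner_function B'"
      unfolding B'_def by (rule kernel_divides[OF a B kernel])
    note bf = inner_blaschke_factor[OF a]
    have ae: "AE z in circle_measure. blaschke_factor a z * B' z = B z"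
      using inner_functionD(4)[OF bf]
    proof eventually_elim
      case (elim z)
      then show ?case
        by (simp add: B'_def flip: mult.assoc complex_norm_square)
    qed
    have ms: "model_space (\<lambda>z. blaschke_factor a z * B' z) = model_space B"
      by (intro model_space_cong ae inner_functionD inner_function_mult bf B' B)
    have "\<exists>m. finite_blaschke_product m B'"
    proof (rule Suc.IH[OF B'])
      fix Y assume Y: "corthonormal Y" "finite Y" "Y \<subseteq> model_space B'"
      note prod = corthonormal_product[OF bf B' unit_kernel[OF a] Y, unfolded ms]
      have "card (insert (unit_kernel a) (mult_L2 (blaschke_factor a) ` Y)) \<le> Suc n"
        using prod Y(2) by (intro Suc.prems(2)) auto
      then show "card Y \<le> n"
        unfolding prod(2) by simp
    qed
    then show ?thesis
      unfolding B'_def using finite_blaschke_product_Suc[OF a] by blast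
  qed
qed

lemma model_space_dim:
  assumes B: "inner_function B" and k: "has_order B k"
  shows "has_hilbert_dim (model_space B) k"
proof (cases k)
  case (enat n)
  obtain c a where ca: "cmod c = 1" "\<forall>i<n. cmod (a i) < 1"
    "AE z in circle_measure. B z = c * (\<Prod>i<n. blaschke_factor (a i) z)"
    using k unfolding enat has_order_def enat.case finite_blaschke_product_alt by blast
  have ib: "inner_function (\<lambda>z. c * (\<Prod>i<n. blaschke_factor (a i) z))"
    using blaschke_basis[of c n a] ca by blast
  have "model_space B = model_space (\<lambda>z. c * (\<Prod>i<n. blaschke_factor (a i) z))"
    by (intro model_space_cong ca inner_functionD B ib)
  moreover obtain X where "corthonormal X" "finite X" "card X = n"
    "closure (cspan X) = model_space (\<lambda>z. c * (\<Prod>i<n. blaschke_factor (a i) z))"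
    using blaschke_basis[of c n a] ca by blast
  ultimately show ?thesis
    unfolding has_hilbert_dim_def by (intro exI[of _ X]) (simp add: enat countable_finite)
next
  case infinity
  obtain X where X: "corthonormal X" "countable X" "closure (cspan X) = model_space B"
    using model_space_basis[OF B] by blast
  have "infinite X"
  proof
    assume "finite X"
    then have "model_space B = cspan X"
      using X closure_cspan_finite by blast
    then have "\<exists>m. finite_blaschke_product m B"
      using card_corthonormal_le[OF _ _ \<open>finite X\<close>] by (intro finite_dim_imp_blaschke[OF B, of "card X"]) auto
    then show False
      using k unfolding infinity has_order_def by auto
  qed
  then show ?thesis
    unfolding has_hilbert_dim_def using X infinity by (intro exI[of _ X]) simp
qed

text \<open>A value |B(0)| \<ge> 1 makes the kernel at the origin vanish and B constant. Its model
  space is then 0, so the order, read off as a dimension, is 0; this treats finite and infinite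
  orders alike.\<close>

lemma has_order_nonconstant:
  assumes B: "inner_function B" and k: "has_order B k" "1 \<le> k"
  shows "nonconstant_inner B"
proof
  show "inner_function B"
    by (rule B)
  show "cmod (cinner (class_L2 B) (zpow 0)) < 1"
  proof (rule ccontr)
    assume "\<not> ?thesis"
    then have "(cmod (cinner (class_L2 B) (zpow 0)))\<^sup>2 \<ge> 1"
      by (simp add: one_le_power)
    then have "(norm (model_zpow B 0))\<^sup>2 \<le> 0"
      using norm_model_zpow_0[OF B] by simp
    then have "model_zpow B 0 = 0"
      by simp
    then obtain c where c: "cmod c = 1" "AE z in circle_measure. B z = c"
      using constant_if_model_zpow_0[OF B] by blast
    have "model_space B = {0}"
      using model_space_cong[OF inner_functionD(1)[OF B] _ c(2)] model_space_const[OF c(1)] by simp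
    then obtain X where X: "corthonormal X" "closure (cspan X) = {0 :: L2}" "k = (if finite X then enat (card X) else \<infinity>)"
      using model_space_dim[OF B k(1)] unfolding has_hilbert_dim_def by auto
    have "X \<subseteq> {0}"
      using X(2) subset_closure_cspan[of X] by simp
    moreover have "0 \<notin> X"
      using X(1) corthonormal_norm[of X 0] by auto
    ultimately have "X = {}"
      by blast
    then show False
      using X(3) k(2) by (simp add: one_enat_def zero_enat_def)
  qed
qed

section \<open>Unitary equivalence\<close>

lemma clinear_on_compose:
  "clinear_on T S \<Longrightarrow> clinear_on K U \<Longrightarrow> U ` K \<subseteq> T \<Longrightarrow> clinear_on K (\<lambda>x. S (U x))"
  by (simp add: clinear_on_def image_subset_iff)

lemma cinner_eqI_on:
  assumes D: "csubspace D" "closed D" "clinear_on D A" "continuous_on D A"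
    and G: "G \<subseteq> D" "\<And>g. g \<in> G \<Longrightarrow> cinner (A g) w = cinner g w'" and x: "x \<in> closure (cspan G)"
  shows "cinner (A x) w = cinner x w'"
proof -
  have "closure (cspan G) \<subseteq> {x \<in> D. cinner (A x) w - cinner x w' = 0}"
  proof (rule closure_cspan_minimal)
    show "G \<subseteq> {x \<in> D. cinner (A x) w - cinner x w' = 0}"
      using G by auto
    show "csubspace {x \<in> D. cinner (A x) w - cinner x w' = 0}"
      using D(1,3) by (auto simp: csubspace_def clinear_on_def clinear_on_0 cinner_add_left
          cinner_scaleC_left cinner.zero_left)
    show "closed {x \<in> D. cinner (A x) w - cinner x w' = 0}"
      by (intro continuous_closed_preimage_constant continuous_on_diff cinner.continuous_on
          continuous_on_const continuous_on_id D)
  qed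
  then show ?thesis
    using x by auto
qed

lemma cinner_orth_proj:
  assumes "csubspace S" "complete S" "z \<in> S"
  shows "cinner (orth_proj S x) z = cinner x z"
  using orth_proj(2)[OF assms, of x] by (simp add: cinner.diff_left)

text \<open>Extending the matching of copies in both directions gives two contractions. They invert
  each other on the generators, hence everywhere, so both preserve norms; polarization then gives
  the inner products.\<close>

lemma isometric_family_unitary:
  fixes V :: "'i \<Rightarrow> 'a::complex_inner \<Rightarrow> 'b::complex_inner" and W :: "'i \<Rightarrow> 'a \<Rightarrow> 'c::complex_inner"
  assumes V: "isometric_family X K V" and W: "isometric_family X K W" and K: "csubspace K"
    and S: "csubspace S" "complete S" "closure (cspan {V h f |h f. h \<in> X \<and> f \<in> K}) = S"
    and T: "csubspace T" "complete T" "closure (cspan {W h f |h f. h \<in> X \<and> f \<in> K}) = T"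
  shows "\<exists>U. unitary_between S T U \<and> (\<forall>h\<in>X. \<forall>f\<in>K. U (V h f) = W h f)"
proof -
  have VS: "{V h f |h f. h \<in> X \<and> f \<in> K} \<subseteq> S" and WT: "{W h f |h f. h \<in> X \<and> f \<in> K} \<subseteq> T"
    using subset_closure_cspan[of "{V h f |h f. h \<in> X \<and> f \<in> K}"]
      subset_closure_cspan[of "{W h f |h f. h \<in> X \<and> f \<in> K}"] S(3) T(3) by simp_all
  have id: "(\<lambda>f. f) ` K \<subseteq> K" "clinear_on K (\<lambda>f. f)"
    by (auto simp: clinear_on_def)
  have "\<exists>U. clinear_on S U \<and> (\<forall>h\<in>X. \<forall>f\<in>K. U (V h f) = W h f) \<and> (\<forall>u\<in>S. U u \<in> T \<and> norm (U u) \<le> 1 * norm u)"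
    using WT by (intro isometric_family_extension[OF V W K id _ _ T(1,2) _ eq_refl[OF S(3)[symmetric]]]) auto
  then obtain U where U: "clinear_on S U" "\<And>h f. h \<in> X \<Longrightarrow> f \<in> K \<Longrightarrow> U (V h f) = W h f"
      "\<And>u. u \<in> S \<Longrightarrow> U u \<in> T" "\<And>u. u \<in> S \<Longrightarrow> norm (U u) \<le> 1 * norm u"
    by blast
  have "\<exists>U. clinear_on T U \<and> (\<forall>h\<in>X. \<forall>f\<in>K. U (W h f) = V h f) \<and> (\<forall>u\<in>T. U u \<in> S \<and> norm (U u) \<le> 1 * norm u)"
    using VS by (intro isometric_family_extension[OF W V K id _ _ S(1,2) _ eq_refl[OF T(3)[symmetric]]]) auto
  then obtain U' where U': "clinear_on T U'" "\<And>h f. h \<in> X \<Longrightarrow> f \<in> K \<Longrightarrow> U' (W h f) = V h f"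
      "\<And>u. u \<in> T \<Longrightarrow> U' u \<in> S" "\<And>u. u \<in> T \<Longrightarrow> norm (U' u) \<le> 1 * norm u"
    by blast
  have cont: "continuous_on S U" "continuous_on T U'"
    using continuous_on_clinear[OF S(1) U(1,4)] continuous_on_clinear[OF T(1) U'(1,4)] by blast+
  have img: "U ` S \<subseteq> T" "U' ` T \<subseteq> S"
    using U(3) U'(3) by blast+
  have U'U: "U' (U u) = u" if u: "u \<in> S" for u
  proof (rule clinear_on_eqI[OF S(1) complete_imp_closed[OF S(2)] _ _ _ _ VS])
    show "clinear_on S (\<lambda>u. U' (U u))"
      by (rule clinear_on_compose[OF U'(1) U(1) img(1)])
    show "continuous_on S (\<lambda>u. U' (U u))"
      by (rule continuous_on_compose2[OF cont(2,1) img(1)])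
    show "u \<in> closure (cspan {V h f |h f. h \<in> X \<and> f \<in> K})"
      using u unfolding S(3) .
    show "U' (U g) = g" if "g \<in> {V h f |h f. h \<in> X \<and> f \<in> K}" for g
      using that U(2) U'(2) by auto
  qed (auto simp: clinear_on_def)
  have UU': "U (U' u) = u" if u: "u \<in> T" for u
  proof (rule clinear_on_eqI[OF T(1) complete_imp_closed[OF T(2)] _ _ _ _ WT])
    show "clinear_on T (\<lambda>u. U (U' u))"
      by (rule clinear_on_compose[OF U(1) U'(1) img(2)])
    show "continuous_on T (\<lambda>u. U (U' u))"
      by (rule continuous_on_compose2[OF cont(1,2) img(2)])
    show "u \<in> closure (cspan {W h f |h f. h \<in> X \<and> f \<in> K})"
      using u unfolding T(3) .
    show "U (U' g) = g" if "g \<in> {W h f |h f. h \<in> X \<and> f \<in> K}" for g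
      using that U(2) U'(2) by auto
  qed (auto simp: clinear_on_def)
  have "U ` S = T"
    using img(1) U'(3) UU' by (metis (no_types, lifting) image_eqI subsetI subset_antisym)
  moreover have norm: "norm (U u) = norm u" if "u \<in> S" for u
    using U(4)[OF that] U'(4)[OF U(3)[OF that]] U'U[OF that] by simp
  have "cinner (U x) (U y) - cinner x y = 0" if "x \<in> S" "y \<in> S" for x y
  proof (rule sesquilinear_eq_0[where S = S and F = "\<lambda>x y. cinner (U x) (U y) - cinner x y"])
    show "cinner (U x) (U x) - cinner x x = 0" if "x \<in> S" for x
      using norm[OF that] by (simp add: cinner_self)
  qed (use that S(1) U(1) in \<open>simp_all add: clinear_on_add clinear_on_scale cinner_add_left
        cinner_add_right cinner_scaleC_left cinner_scaleC_right algebra_simps\<close>)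
  ultimately show ?thesis
    using U(1,2) unfolding unitary_between_def by auto
qed

section \<open>Bounded extensions of truncated Toeplitz operators\<close>

lemma bounded_operator_onE:
  assumes "bounded_operator_on S A"
  obtains C where "0 \<le> C" "A ` S \<subseteq> S" "clinear_on S A" "\<And>x. x \<in> S \<Longrightarrow> norm (A x) \<le> C * norm x"
proof -
  obtain C where C: "A ` S \<subseteq> S" "clinear_on S A" "\<And>x. x \<in> S \<Longrightarrow> norm (A x) \<le> C * norm x"
    using assms unfolding bounded_operator_on_def by blast
  have "norm (A x) \<le> max C 0 * norm x" if "x \<in> S" for x
    using C(3)[OF that] mult_right_mono[of C "max C 0" "norm x"] by simp
  then show ?thesis
    using that[of "max C 0"] C(1,2) by simp
qed

lemma continuous_on_bounded_operator:
  "csubspace S \<Longrightarrow> bounded_operator_on S A \<Longrightarrow> continuous_on S A"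
  by (elim bounded_operator_onE) (rule continuous_on_clinear)

text \<open>Bounded functions span the model space densely. This allows the chosen operator
  \<open>tto\<close> to be replaced by any extension that has been constructed.\<close>

lemma tto_extension_unique:
  assumes "inner_function \<Theta>" "tto_extension \<Theta> \<phi> A" "tto_extension \<Theta> \<phi> A'" "f \<in> model_space \<Theta>"
  shows "A f = A' f"
proof (rule clinear_on_eqI[where A = A and A' = A', OF csubspace_model_space closed_model_space])
  have b: "bounded_operator_on (model_space \<Theta>) A" "bounded_operator_on (model_space \<Theta>) A'"
    using assms(2,3) by (simp_all add: tto_extension_def)
  then show "clinear_on (model_space \<Theta>) A" "clinear_on (model_space \<Theta>) A'"
    by (simp_all add: bounded_operator_on_def)
  show "continuous_on (model_space \<Theta>) A" "continuous_on (model_space \<Theta>) A'"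
    by (rule continuous_on_bounded_operator[OF csubspace_model_space] b)+
  show "A g = A' g" if "g \<in> model_space \<Theta> \<inter> Hinf" for g
    using that assms(2,3) by (simp add: tto_extension_def)
  show "f \<in> closure (cspan (model_space \<Theta> \<inter> Hinf))"
    using assms(4) model_space_Hinf_dense[OF assms(1)] by simp
qed simp

lemma tto_extension_tto: "tto_bounded \<Theta> \<phi> \<Longrightarrow> tto_extension \<Theta> \<phi> (tto \<Theta> \<phi>)"
  using someI_ex[of "tto_extension \<Theta> \<phi>"] by (simp add: tto_bounded_def tto_def)

lemma square_integrable_cnj: "square_integrable \<phi> \<Longrightarrow> square_integrable (\<lambda>z. cnj (\<phi> z))"
  by (auto simp: square_integrable_def intro: measurable_compose[OF _ cnj_borel])

lemma square_integrable_mult_Hinf: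
  assumes "square_integrable \<phi>" "f \<in> Hinf"
  shows "square_integrable (\<lambda>z. \<phi> z * rep_L2 f z)"
  using square_integrable_bounded_mult[of "rep_L2 f" \<phi>] assms
  by (simp add: Hinf_eq bounded_symbol_rep mult.commute)

text \<open>The hypotheses ask for square integrable products rather than bounded factors, because g
  will be of the form h (w \<circ> B), which need not be bounded.\<close>

lemma cinner_mult_symbol:
  assumes "square_integrable (\<lambda>z. \<phi> z * rep_L2 f z)" "square_integrable g" "square_integrable (\<lambda>z. cnj (\<phi> z) * g z)"
  shows "cinner (mult_L2 \<phi> f) (class_L2 g) = cinner f (class_L2 (\<lambda>z. cnj (\<phi> z) * g z))"
proof -
  have "cinner f (class_L2 (\<lambda>z. cnj (\<phi> z) * g z)) = cinner (class_L2 (rep_L2 f)) (class_L2 (\<lambda>z. cnj (\<phi> z) * g z))"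
    by simp
  also have "\<dots> = (\<integral>z. rep_L2 f z * cnj (cnj (\<phi> z) * g z) \<partial>circle_measure)"
    using assms by (intro cinner_class) simp_all
  also have "\<dots> = (\<integral>z. \<phi> z * rep_L2 f z * cnj (g z) \<partial>circle_measure)"
    by (simp add: mult_ac)
  also have "\<dots> = cinner (mult_L2 \<phi> f) (class_L2 g)"
    unfolding mult_L2_def using assms by (intro cinner_class[symmetric])
  finally show ?thesis
    by simp
qed

text \<open>For bounded f the formula is the definition of the projection. Since w is bounded, cnj
  \<phi> w is a fixed vector of L^2, so both sides are continuous in f and the formula extends to
  all of the model space.\<close>

lemma cinner_tto_extension:
  assumes \<Theta>: "inner_function \<Theta>" and \<phi>: "square_integrable \<phi>" and A: "tto_extension \<Theta> \<phi> A"
    and f: "f \<in> model_space \<Theta>" and w: "w \<in> model_space \<Theta> \<inter> Hinf"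
  shows "cinner (A f) w = cinner f (class_L2 (\<lambda>z. cnj (\<phi> z) * rep_L2 w z))"
proof (rule cinner_eqI_on[OF csubspace_model_space closed_model_space])
  have b: "bounded_operator_on (model_space \<Theta>) A"
    using A by (simp add: tto_extension_def)
  then show "clinear_on (model_space \<Theta>) A"
    by (simp add: bounded_operator_on_def)
  show "continuous_on (model_space \<Theta>) A"
    by (rule continuous_on_bounded_operator[OF csubspace_model_space b])
  show "f \<in> closure (cspan (model_space \<Theta> \<inter> Hinf))"
    using f model_space_Hinf_dense[OF \<Theta>] by simp
  fix g assume g: "g \<in> model_space \<Theta> \<inter> Hinf"
  have "cinner (A g) w = cinner (mult_L2 \<phi> g) w"
    using g w A by (simp add: tto_extension_def cinner_orth_proj csubspace_model_space complete_model_space)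
  also have "\<dots> = cinner (mult_L2 \<phi> g) (class_L2 (rep_L2 w))"
    by simp
  also have "\<dots> = cinner g (class_L2 (\<lambda>z. cnj (\<phi> z) * rep_L2 w z))"
    using g w \<phi> by (intro cinner_mult_symbol square_integrable_mult_Hinf square_integrable_cnj) auto
  finally show "cinner (A g) w = cinner g (class_L2 (\<lambda>z. cnj (\<phi> z) * rep_L2 w z))" .
qed simp

context nonconstant_inner
begin

lemma isometric_family_V:
  assumes "corthonormal X" "X \<subseteq> model_space B"
  shows "isometric_family X M V"
  unfolding isometric_family_def
proof (intro conjI ballI)
  show "clinear_on M (V h)" if "h \<in> X" for h
    using that assms(2) by (auto simp: clinear_on_def V_add_right V_scaleC_right)
  show "cinner (V h f) (V h' g) = (if h = h' then cinner f g else 0)" if "h \<in> X" "h' \<in> X" for h h' f g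
    using that assms by (simp add: cinner_V subset_iff corthonormal_def)
qed

text \<open>The diagonal operator \<open>L\<close> is bounded by construction; what remains is that
  it is the compressed multiplication by \<phi> \<circ> B on bounded u. Both are tested against V h
  w with w bounded, and both yield the inner product of u with one and the same vector V h
  w'.\<close>

lemma tto_extension_comp:
  assumes \<Theta>: "inner_function \<Theta>" and \<phi>: "square_integrable \<phi>" and A: "tto_extension \<Theta> \<phi> A"
    and X: "corthonormal X" "closure (cspan X) = model_space B"
  shows "\<exists>A'. tto_extension (\<Theta> \<circ> B) (\<phi> \<circ> B) A' \<and>
    (\<forall>h\<in>X. \<forall>f\<in>model_space \<Theta>. A' (V h f) = V h (A f))"
proof -
  let ?K = "model_space \<Theta>" and ?K' = "model_space (\<Theta> \<circ> B)"
  have XB: "X \<subseteq> model_space B"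
    using X(2) subset_closure_cspan[of X] by simp
  have self: "closure (cspan ?K) = ?K"
    by (intro closure_cspan_eqI csubspace_model_space complete_model_space order_refl) force
  note span = V_span[OF \<Theta> X(2) self] and span_Hinf = V_span[OF \<Theta> X(2) model_space_Hinf_dense[OF \<Theta>]]
  have "bounded_operator_on ?K A"
    using A by (simp add: tto_extension_def)
  then obtain C where C: "0 \<le> C" "A ` ?K \<subseteq> ?K" "clinear_on ?K A" "\<And>x. x \<in> ?K \<Longrightarrow> norm (A x) \<le> C * norm x"
    by (rule bounded_operator_onE) (rule that)
  note V = isometric_family_V[OF X(1) XB]
  have "\<exists>L. clinear_on ?K' L \<and> (\<forall>h\<in>X. \<forall>f\<in>?K. L (V h f) = V h (A f)) \<and> (\<forall>u\<in>?K'. L u \<in> ?K' \<and> norm (L u) \<le> C * norm u)"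
    using V_model_space[OF \<Theta>] XB
    by (intro isometric_family_extension[OF V V csubspace_model_space C(2,3,4,1) csubspace_model_space
          complete_model_space _ eq_refl[OF span[symmetric]]]) auto
  then obtain L where L: "clinear_on ?K' L" "\<And>h f. h \<in> X \<Longrightarrow> f \<in> ?K \<Longrightarrow> L (V h f) = V h (A f)"
    "\<And>u. u \<in> ?K' \<Longrightarrow> L u \<in> ?K'" "\<And>u. u \<in> ?K' \<Longrightarrow> norm (L u) \<le> C * norm u"
    by blast
  have bounded: "bounded_operator_on ?K' L"
    unfolding bounded_operator_on_def using L by blast
  have "L u = orth_proj ?K' (mult_L2 (\<phi> \<circ> B) u)" if u: "u \<in> ?K' \<inter> Hinf" for u
  proof (rule orth_proj_eqI[OF csubspace_model_space, symmetric])
    show "L u \<in> ?K'"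
      using u L(3) by blast
    fix z assume z: "z \<in> ?K'"
    show "cinner (mult_L2 (\<phi> \<circ> B) u - L u) z = 0"
    proof (rule orthogonal_closure_cspan)
      show "z \<in> closure (cspan {V h f |h f. h \<in> X \<and> f \<in> ?K \<inter> Hinf})"
        using z unfolding span_Hinf .
      fix g assume "g \<in> {V h f |h f. h \<in> X \<and> f \<in> ?K \<inter> Hinf}"
      then obtain h w where h: "h \<in> X" and w: "w \<in> ?K \<inter> Hinf" and g: "g = V h w"
        by blast
      have hB: "h \<in> model_space B"
        using h XB by blast
      \<comment> \<open>Chosen so that V h w' is the conjugate of \<phi> \<circ> B times V h w; its
        square integrability therefore comes with that of cnj \<phi> w.\<close>
      define w' where "w' = class_L2 (\<lambda>z. cnj (\<phi> z) * rep_L2 w z)"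
      have sq: "square_integrable (\<lambda>z. cnj (\<phi> z) * rep_L2 w z)"
        using w \<phi> by (intro square_integrable_mult_Hinf square_integrable_cnj) auto
      have Vw: "V h w = class_L2 (\<lambda>z. rep_L2 h z * rep_L2 w (B z))" "square_integrable (\<lambda>z. rep_L2 h z * rep_L2 w (B z))"
        using V_class[of "rep_L2 h" "rep_L2 w"] hB by simp_all
      have eq: "(\<lambda>z. rep_L2 h z * (cnj (\<phi> (B z)) * rep_L2 w (B z))) = (\<lambda>z. cnj ((\<phi> \<circ> B) z) * (rep_L2 h z * rep_L2 w (B z)))"
        by (simp add: fun_eq_iff)
      have Vw': "V h w' = class_L2 (\<lambda>z. cnj ((\<phi> \<circ> B) z) * (rep_L2 h z * rep_L2 w (B z)))"
        "square_integrable (\<lambda>z. cnj ((\<phi> \<circ> B) z) * (rep_L2 h z * rep_L2 w (B z)))"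
        using V_class[of "rep_L2 h", OF _ _ sq] hB unfolding w'_def eq by simp_all
      have \<phi>B: "square_integrable (\<phi> \<circ> B)"
        using square_integrable_comp(1)[OF \<phi>] by (simp add: comp_def)
      have "cinner (mult_L2 (\<phi> \<circ> B) u) (V h w) = cinner u (V h w')"
        unfolding Vw(1) Vw'(1) using u
        by (intro cinner_mult_symbol square_integrable_mult_Hinf[OF \<phi>B] Vw(2) Vw'(2)) auto
      \<comment> \<open>Only here is u approximated by sums of vectors V h' f, with arbitrary f of
        the model space: the symbol already sits in w', so no product of \<phi> with f
        occurs.\<close>
      moreover have "cinner (L u) (V h w) = cinner u (V h w')"
      proof (rule cinner_eqI_on[OF csubspace_model_space closed_model_space L(1)])
        show "continuous_on ?K' L"
          by (rule continuous_on_bounded_operator[OF csubspace_model_space bounded])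
        show "u \<in> closure (cspan {V h f |h f. h \<in> X \<and> f \<in> ?K})"
          using u unfolding span by blast
        show "{V h f |h f. h \<in> X \<and> f \<in> ?K} \<subseteq> ?K'"
          using V_model_space[OF \<Theta>] XB by blast
        fix g' assume "g' \<in> {V h f |h f. h \<in> X \<and> f \<in> ?K}"
        then obtain h' f where h': "h' \<in> X" "f \<in> ?K" "g' = V h' f"
          by blast
        then have h'B: "h' \<in> model_space B"
          using XB by blast
        have "cinner (L g') (V h w) = cinner h' h * cinner (A f) w"
          unfolding h'(3) L(2)[OF h'(1,2)] by (rule cinner_V[OF h'B hB])
        also have "cinner (A f) w = cinner f w'"
          unfolding w'_def by (rule cinner_tto_extension[OF \<Theta> \<phi> A h'(2) w])
        also have "cinner h' h * cinner f w' = cinner g' (V h w')"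
          unfolding h'(3) by (rule cinner_V[OF h'B hB, symmetric])
        finally show "cinner (L g') (V h w) = cinner g' (V h w')" .
      qed
      ultimately show "cinner (mult_L2 (\<phi> \<circ> B) u - L u) g = 0"
        by (simp add: g cinner.diff_left)
    qed
  qed
  then have "tto_extension (\<Theta> \<circ> B) (\<phi> \<circ> B) L"
    using bounded by (simp add: tto_extension_def)
  then show ?thesis
    using L(2) by blast
qed

end

section \<open>Matching bases, the tensor product and the unitary equivalence\<close>

lemma has_hilbert_dim_bij:
  assumes "has_hilbert_dim E k" "has_hilbert_dim E' k"
  shows "\<exists>X Y \<sigma>. corthonormal X \<and> closure (cspan X) = E \<and> corthonormal Y \<and> closure (cspan Y) = E' \<and> bij_betw \<sigma> X Y"
proof -
  obtain X where X: "corthonormal X" "countable X" "closure (cspan X) = E" "k = (if finite X then enat (card X) else \<infinity>)"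
    using assms(1) unfolding has_hilbert_dim_def by blast
  obtain Y where Y: "corthonormal Y" "countable Y" "closure (cspan Y) = E'" "k = (if finite Y then enat (card Y) else \<infinity>)"
    using assms(2) unfolding has_hilbert_dim_def by blast
  have "\<exists>\<sigma>. bij_betw \<sigma> X Y"
  proof (cases "finite X")
    case True
    then have "finite Y" "card X = card Y"
      using X(4) Y(4) by (auto split: if_splits)
    then show ?thesis
      using True finite_same_card_bij by blast
  next
    case False
    then have "infinite Y"
      using X(4) Y(4) by (auto split: if_splits)
    then have "bij_betw (inv_into Y (to_nat_on Y) \<circ> to_nat_on X) X Y"
      using False X(2) Y(2) by (intro bij_betw_trans[OF to_nat_on_infinite bij_betw_inv_into[OF to_nat_on_infinite]])
    then show ?thesis
      by blast
  qed
  then show ?thesis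
    using X Y by blast
qed

lemma norm_tensor:
  assumes "hilbert_tensor_product E F T \<tau>" "e \<in> E" "f \<in> F"
  shows "norm (\<tau> e f) = norm e * norm f"
proof -
  have "cinner (\<tau> e f) (\<tau> e f) = cinner e e * cinner f f"
    using assms unfolding hilbert_tensor_product_def by blast
  then have "complex_of_real ((norm (\<tau> e f))\<^sup>2) = of_real ((norm e * norm f)\<^sup>2)"
    by (simp add: cinner_self power_mult_distrib)
  then show ?thesis
    unfolding of_real_eq_iff by (simp add: power2_eq_iff_nonneg)
qed

theorem corollary3p4:
  fixes \<Theta> \<phi> B :: "complex \<Rightarrow> complex" and k :: enat
  assumes "inner_function \<Theta>"
    and "square_integrable \<phi>"
    and "inner_function B" and "has_order B k" and "1 \<le> k"
    and "tto_bounded \<Theta> \<phi>"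
  shows "tto_bounded (\<Theta> \<circ> B) (\<phi> \<circ> B) \<and>
    (\<forall>(E :: 'e::complex_inner set) (T :: 't::complex_inner set) \<tau>.
       hilbert_subspace E \<longrightarrow> has_hilbert_dim E k \<longrightarrow>
       hilbert_tensor_product E (model_space \<Theta>) T \<tau> \<longrightarrow>
       unitarily_equivalent
         (model_space (\<Theta> \<circ> B)) (tto (\<Theta> \<circ> B) (\<phi> \<circ> B))
         T (tensor_operator E (model_space \<Theta>) T \<tau> id (tto \<Theta> \<phi>)))"
proof (intro conjI allI impI)
  interpret nonconstant_inner B
    by (rule has_order_nonconstant[OF assms(3,4,5)])
  let ?K = "model_space \<Theta>" and ?K' = "model_space (\<Theta> \<circ> B)"
  note \<Theta> = assms(1) and \<phi> = assms(2)
  have dimB: "has_hilbert_dim (model_space B) k"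
    by (rule model_space_dim[OF assms(3,4)])
  define A where "A = tto \<Theta> \<phi>"
  have A: "tto_extension \<Theta> \<phi> A"
    unfolding A_def by (rule tto_extension_tto[OF assms(6)])
  show bounded: "tto_bounded (\<Theta> \<circ> B) (\<phi> \<circ> B)"
    using tto_extension_comp[OF \<Theta> \<phi> A] dimB unfolding has_hilbert_dim_def tto_bounded_def by metis
  fix E :: "'e set" and T :: "'t set" and \<tau>
  assume E: "hilbert_subspace E" "has_hilbert_dim E k" and T: "hilbert_tensor_product E ?K T \<tau>"
  have E_sub: "csubspace E" "closed E"
    using E(1) by (auto simp: hilbert_subspace_def complete_imp_closed)
  have T_sub: "csubspace T" "complete T" and T_span: "closure (cspan {\<tau> e f |e f. e \<in> E \<and> f \<in> ?K}) = T"
    and lin1: "\<And>f. f \<in> ?K \<Longrightarrow> clinear_on E (\<lambda>e. \<tau> e f)" and lin2: "\<And>e. e \<in> E \<Longrightarrow> clinear_on ?K (\<tau> e)"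
    and cinner_\<tau>: "\<And>e e' f f'. e \<in> E \<Longrightarrow> e' \<in> E \<Longrightarrow> f \<in> ?K \<Longrightarrow> f' \<in> ?K \<Longrightarrow>
      cinner (\<tau> e f) (\<tau> e' f') = cinner e e' * cinner f f'"
    using T unfolding hilbert_tensor_product_def hilbert_subspace_def by blast+
  have \<tau>_T: "\<tau> e f \<in> T" if "e \<in> E" "f \<in> ?K" for e f
    using T_span subset_closure_cspan[of "{\<tau> e f |e f. e \<in> E \<and> f \<in> ?K}"] that by blast
  have cont_\<tau>: "continuous_on E (\<lambda>e. \<tau> e f)" if "f \<in> ?K" for f
    by (rule continuous_on_clinear[OF E_sub(1) lin1[OF that], of "norm f"])
      (simp add: norm_tensor[OF T _ that] mult.commute)
  obtain X Y \<sigma> where X: "corthonormal X" "closure (cspan X) = model_space B"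
    and Y: "corthonormal Y" "closure (cspan Y) = E" and \<sigma>: "bij_betw \<sigma> X Y"
    using has_hilbert_dim_bij[OF dimB E(2)] by blast
  have XB: "X \<subseteq> model_space B" and YE: "Y \<subseteq> E"
    using X(2) Y(2) subset_closure_cspan[of X] subset_closure_cspan[of Y] by simp_all
  have \<sigma>_in: "\<sigma> h \<in> Y" if "h \<in> X" for h
    using \<sigma> that by (auto simp: bij_betw_def)
  \<comment> \<open>The copies of the model space of \<Theta> inside \<open>T\<close> are indexed by
    the basis of \<open>E\<close>, relabelled along \<sigma> by the basis of the model space of
    \<open>B\<close>.\<close>
  define W where "W h = \<tau> (\<sigma> h)" for h
  have W: "isometric_family X ?K W"
    unfolding isometric_family_def
  proof (intro conjI ballI)
    show "clinear_on ?K (W h)" if "h \<in> X" for h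
      unfolding W_def using \<sigma>_in[OF that] YE by (intro lin2) blast
    show "cinner (W h f) (W h' g) = (if h = h' then cinner f g else 0)"
      if "h \<in> X" "h' \<in> X" "f \<in> ?K" "g \<in> ?K" for h h' f g
    proof -
      have "cinner (W h f) (W h' g) = cinner (\<sigma> h) (\<sigma> h') * cinner f g"
        unfolding W_def using \<sigma>_in that YE by (intro cinner_\<tau>) blast+
      also have "cinner (\<sigma> h) (\<sigma> h') = (if h = h' then 1 else 0)"
        using Y(1) \<sigma>_in that inj_on_eq_iff[OF bij_betw_imp_inj_on[OF \<sigma>] that(1,2)]
        by (simp add: corthonormal_def)
      finally show ?thesis
        by simp
    qed
  qed
  \<comment> \<open>For fixed f an elementary tensor depends linearly and continuously on e, and the
    basis Y spans E densely; so the copies for basis vectors already reach every elementary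
    tensor.\<close>
  have \<tau>_closure: "\<tau> e f \<in> closure (cspan {W h f |h f. h \<in> X \<and> f \<in> ?K})" if e: "e \<in> E" and f: "f \<in> ?K" for e f
  proof (rule closure_cspan_image_on[OF E_sub lin1[OF f] _ csubspace_closure[OF csubspace_cspan] closed_closure YE])
    show "norm (\<tau> e f) \<le> norm f * norm e" if "e \<in> E" for e
      by (simp add: norm_tensor[OF T that f])
    show "e \<in> closure (cspan Y)"
      using e Y(2) by simp
    fix g assume "g \<in> Y"
    then obtain h where "h \<in> X" "g = \<sigma> h"
      using \<sigma> by (auto simp: bij_betw_def)
    then have "\<tau> g f \<in> {W h f |h f. h \<in> X \<and> f \<in> ?K}"
      unfolding W_def using f by blast
    then show "\<tau> g f \<in> closure (cspan {W h f |h f. h \<in> X \<and> f \<in> ?K})"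
      by (rule subset_closure_cspan[THEN subsetD])
  qed
  have W_T: "W h f \<in> T" if "h \<in> X" "f \<in> ?K" for h f
    unfolding W_def using \<sigma>_in[OF that(1)] YE that(2) by (intro \<tau>_T) blast+
  have W_span: "closure (cspan {W h f |h f. h \<in> X \<and> f \<in> ?K}) = T"
  proof
    show "closure (cspan {W h f |h f. h \<in> X \<and> f \<in> ?K}) \<subseteq> T"
      using W_T by (intro closure_cspan_minimal T_sub complete_imp_closed) blast
    have "{\<tau> e f |e f. e \<in> E \<and> f \<in> ?K} \<subseteq> closure (cspan {W h f |h f. h \<in> X \<and> f \<in> ?K})"
      using \<tau>_closure by blast
    then show "T \<subseteq> closure (cspan {W h f |h f. h \<in> X \<and> f \<in> ?K})"
      unfolding T_span[symmetric] by (rule closure_cspan_mono)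
  qed
  have self: "closure (cspan ?K) = ?K"
    by (intro closure_cspan_eqI csubspace_model_space complete_model_space order_refl) force
  note V_family = isometric_family_V[OF X(1) XB, of ?K] and span = V_span[OF \<Theta> X(2) self]
  obtain U where U: "unitary_between ?K' T U" "\<And>h f. h \<in> X \<Longrightarrow> f \<in> ?K \<Longrightarrow> U (V h f) = W h f"
    using isometric_family_unitary[OF V_family W csubspace_model_space csubspace_model_space
        complete_model_space span T_sub W_span] by blast
  obtain A' where A': "tto_extension (\<Theta> \<circ> B) (\<phi> \<circ> B) A'"
    "\<And>h f. h \<in> X \<Longrightarrow> f \<in> ?K \<Longrightarrow> A' (V h f) = V h (A f)"
    using tto_extension_comp[OF \<Theta> \<phi> A X] by blast
  have "bounded_operator_on ?K A"
    using A by (simp add: tto_extension_def)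
  then obtain C where C: "0 \<le> C" "A ` ?K \<subseteq> ?K" "clinear_on ?K A" "\<And>x. x \<in> ?K \<Longrightarrow> norm (A x) \<le> C * norm x"
    by (rule bounded_operator_onE) (rule that)
  \<comment> \<open>\<open>tensor_operator\<close> is a choice, so its defining properties are
    available only once such an operator exists.\<close>
  have "\<exists>S. bounded_operator_on T S \<and> (\<forall>e\<in>E. \<forall>f\<in>?K. S (\<tau> e f) = \<tau> (id e) (A f))"
  proof -
    have "\<exists>S. clinear_on T S \<and> (\<forall>h\<in>X. \<forall>f\<in>?K. S (W h f) = W h (A f)) \<and> (\<forall>u\<in>T. S u \<in> T \<and> norm (S u) \<le> C * norm u)"
      by (rule isometric_family_extension[OF W W csubspace_model_space C(2,3,4,1) T_sub W_T eq_refl[OF W_span[symmetric]]])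
    then obtain S where S: "clinear_on T S" "\<And>h f. h \<in> X \<Longrightarrow> f \<in> ?K \<Longrightarrow> S (W h f) = W h (A f)"
      "\<And>u. u \<in> T \<Longrightarrow> S u \<in> T" "\<And>u. u \<in> T \<Longrightarrow> norm (S u) \<le> C * norm u"
      by blast
    \<comment> \<open>By construction this is known for e in the basis Y only; both sides are linear
      and continuous in e.\<close>
    have "S (\<tau> e f) = \<tau> e (A f)" if e: "e \<in> E" and f: "f \<in> ?K" for e f
    proof (rule clinear_on_eqI[where A = "\<lambda>e. S (\<tau> e f)" and A' = "\<lambda>e. \<tau> e (A f)", OF E_sub _ _ _ _ YE])
      have Af: "A f \<in> ?K"
        using C(2) f by blast
      have img: "(\<lambda>e. \<tau> e f) ` E \<subseteq> T"
        using \<tau>_T f by blast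
      show "clinear_on E (\<lambda>e. S (\<tau> e f))"
        by (rule clinear_on_compose[OF S(1) lin1[OF f] img])
      show "continuous_on E (\<lambda>e. S (\<tau> e f))"
        by (rule continuous_on_compose2[OF continuous_on_clinear[OF T_sub(1) S(1,4)] cont_\<tau>[OF f] img])
      show "clinear_on E (\<lambda>e. \<tau> e (A f))" "continuous_on E (\<lambda>e. \<tau> e (A f))"
        by (rule lin1[OF Af] cont_\<tau>[OF Af])+
      show "e \<in> closure (cspan Y)"
        using e Y(2) by simp
      fix g assume "g \<in> Y"
      then obtain h where "h \<in> X" "g = \<sigma> h"
        using \<sigma> by (auto simp: bij_betw_def)
      then show "S (\<tau> g f) = \<tau> g (A f)"
        using S(2)[of h f] f by (simp add: W_def)
    qed
    moreover have "bounded_operator_on T S"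
      unfolding bounded_operator_on_def using S by blast
    ultimately show ?thesis
      by auto
  qed
  then have "bounded_operator_on T (tensor_operator E ?K T \<tau> id A) \<and>
      (\<forall>e\<in>E. \<forall>f\<in>?K. tensor_operator E ?K T \<tau> id A (\<tau> e f) = \<tau> (id e) (A f))"
    unfolding tensor_operator_def by (rule someI_ex)
  then obtain S where S_def: "S = tensor_operator E ?K T \<tau> id A" and S: "bounded_operator_on T S"
    "\<And>e f. e \<in> E \<Longrightarrow> f \<in> ?K \<Longrightarrow> S (\<tau> e f) = \<tau> e (A f)"
    by simp
  have U_lin: "clinear_on ?K' U" and U_img: "U ` ?K' \<subseteq> T"
    and U_norm: "\<And>x. x \<in> ?K' \<Longrightarrow> norm (U x) \<le> 1 * norm x"
  proof -
    show "clinear_on ?K' U" "U ` ?K' \<subseteq> T"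
      using U(1) by (auto simp: unitary_between_def)
    show "norm (U x) \<le> 1 * norm x" if "x \<in> ?K'" for x
    proof -
      have "cinner (U x) (U x) = cinner x x"
        using U(1) that by (simp add: unitary_between_def)
      then have "complex_of_real ((norm (U x))\<^sup>2) = of_real ((norm x)\<^sup>2)"
        by (simp only: cinner_self)
      then show ?thesis
        unfolding of_real_eq_iff by (simp add: power2_eq_iff_nonneg)
    qed
  qed
  have U_cont: "continuous_on ?K' U"
    by (rule continuous_on_clinear[OF csubspace_model_space U_lin U_norm])
  have A'_b: "bounded_operator_on ?K' A'"
    using A'(1) by (simp add: tto_extension_def)
  then have A'_lin: "clinear_on ?K' A'" and A'_img: "A' ` ?K' \<subseteq> ?K'"
    by (simp_all add: bounded_operator_on_def)
  have S_lin: "clinear_on T S"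
    using S(1) by (simp add: bounded_operator_on_def)
  have "U (tto (\<Theta> \<circ> B) (\<phi> \<circ> B) u) = S (U u)" if u: "u \<in> ?K'" for u
  proof -
    \<comment> \<open>Uniqueness of the extension exchanges the chosen operator for
      \<open>A'\<close>, whose values on the vectors V h f are known.\<close>
    have "tto (\<Theta> \<circ> B) (\<phi> \<circ> B) u = A' u"
      by (rule tto_extension_unique[OF inner_function_comp[OF \<Theta>] tto_extension_tto[OF bounded] A'(1) u])
    moreover have "U (A' u) = S (U u)"
    proof (rule clinear_on_eqI[where A = "\<lambda>u. U (A' u)" and A' = "\<lambda>u. S (U u)", OF csubspace_model_space closed_model_space])
      show "clinear_on ?K' (\<lambda>u. U (A' u))" "clinear_on ?K' (\<lambda>u. S (U u))"
        by (rule clinear_on_compose[OF U_lin A'_lin A'_img] clinear_on_compose[OF S_lin U_lin U_img])+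
      show "continuous_on ?K' (\<lambda>u. U (A' u))"
        by (rule continuous_on_compose2[OF U_cont continuous_on_bounded_operator[OF csubspace_model_space A'_b] A'_img])
      show "continuous_on ?K' (\<lambda>u. S (U u))"
        by (rule continuous_on_compose2[OF continuous_on_bounded_operator[OF T_sub(1) S(1)] U_cont U_img])
      show "{V h f |h f. h \<in> X \<and> f \<in> ?K} \<subseteq> ?K'"
        using V_model_space[OF \<Theta>] XB by blast
      show "u \<in> closure (cspan {V h f |h f. h \<in> X \<and> f \<in> ?K})"
        using u unfolding span .
      fix g assume "g \<in> {V h f |h f. h \<in> X \<and> f \<in> ?K}"
      then obtain h f where hf: "h \<in> X" "f \<in> ?K" "g = V h f"
        by blast
      have Af: "A f \<in> ?K"
        using C(2) hf(2) by blast
      have "\<sigma> h \<in> E"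
        using \<sigma>_in[OF hf(1)] YE by blast
      then show "U (A' g) = S (U g)"
        unfolding hf(3) A'(2)[OF hf(1,2)] U(2)[OF hf(1) Af] U(2)[OF hf(1,2)]
        using S(2)[OF _ hf(2)] by (simp add: W_def)
    qed
    ultimately show ?thesis
      by simp
  qed
  then show "unitarily_equivalent ?K' (tto (\<Theta> \<circ> B) (\<phi> \<circ> B)) T (tensor_operator E ?K T \<tau> id (tto \<Theta> \<phi>))"
    unfolding unitarily_equivalent_def S_def A_def using U(1) by blast
qed

end
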